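(* Let $s\in C^2(\mathbb{R}^{B},\mathbb{R})$ satisfy (S1)-(S3), and suppose that the gap conditions $( *_0)$ and $( *_1)$ hold, with $v_0<w_0$ the adjacent pair in $\mathcal{M}_0$ from $( *_0)$. Then: (1) there are infinitely many homoclinic solutions of (EL) asymptotic to $v_0$ as $|\mathbf{i}_1|\to\infty$ and $1$-periodic in $\mathbf{i}_2,\dots,\mathbf{i}_n$; likewise there are infinitely many homoclinic solutions of (EL) asymptotic to $w_0$ as $|\mathbf{i}_1|\to\infty$ and $1$-periodic in $\mathbf{i}_2,\dots,\mathbf{i}_n$; (2) there are infinitely many solutions of (EL) that are asymptotic to $v_0$ as $\mathbf{i}_1\to-\infty$ and to $w_0$ as $\mathbf{i}_1\to\infty$ and are $1$-periodic in $\mathbf{i}_2,\dots,\mathbf{i}_n$; likewise there are infinitely many solutions of (EL) that are asymptotic to $w_0$ as $\mathbf{i}_1\to-\infty$ and to $v_0$ as $\mathbf{i}_1\to\infty$ and are $1$-periodic in $\mathbf{i}_2,\dots,\mathbf{i}_n$.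
   Context: Model. Fix integers $n\ge 2$, $r\ge 1$. For $\mathbf{i}=(\mathbf{i}_1,\dots,\mathbf{i}_n)\in\mathbb{Z}^n$ let $\|\mathbf{i}\|=\sum_k|\mathbf{i}_k|$, and let $B=\{\mathbf{k}\in\mathbb{Z}^n:\|\mathbf{k}\|\le r\}$. A configuration is a function $u:\mathbb{Z}^n\to\mathbb{R}$; inequalities between configurations are pointwise ($u<v$ means $u(\mathbf{j})<v(\mathbf{j})$ for all $\mathbf{j}$). A function $s\in C^2(\mathbb{R}^{B},\mathbb{R})$ satisfies: (S1) $s(u+1_B)=s(u)$ for all $u\in\mathbb{R}^B$, where $1_B$ is the constant function $1$; (S2) $s$ is bounded from below, and $s(u)\to\infty$ as $|u(\mathbf{k})-u(\mathbf{j})|\to\infty$ for $\mathbf{k},\mathbf{j}\in B$ with $\|\mathbf{k}-\mathbf{j}\|=1$; (S3) the second partial derivatives satisfy $\partial_{\mathbf{k},\mathbf{j}}s\le 0$ for all $\mathbf{k}\ne\mathbf{j}$ in $B$, and $\partial_{\mathbf{0},\mathbf{j}}s<0$ whenever $\|\mathbf{j}\|=1$. For a configuration $u$ and $\mathbf{j}\in\mathbb{Z}^n$ put $S_{\mathbf{j}}(u)=s\big((u(\mathbf{j}+\mathbf{k}))_{\mathbf{k}\in B}\big)$. The Euler-Lagrange equation is (EL): $\sum_{\mathbf{j}:\|\mathbf{j}-\mathbf{i}\|\le r}\partial_{\mathbf{i}}S_{\mathbf{j}}(u)=0$ for all $\mathbf{i}\in\mathbb{Z}^n$, where $\partial_{\mathbf{i}}$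 is the derivative with respect to $u(\mathbf{i})$. A solution is a configuration satisfying (EL). Periodic minimizers. A configuration is $1$-periodic in $\mathbf{i}_j$ if $u(\mathbf{i}+\mathbf{e}_j)=u(\mathbf{i})$ for all $\mathbf{i}$, $\mathbf{e}_j$ being the $j$th unit vector. Let $c_0=\inf S_{\mathbf{0}}(u)$ over configurations $u$ that are $1$-periodic in all directions, and let $\mathcal{M}_0$ be the set of such $u$ with $S_{\mathbf{0}}(u)=c_0$. In an ordered set $A$ of configurations, $v<w$ in $A$ are adjacent if no $u\in A$ satisfies $v<u<w$. Gap condition $( *_0)$: there are adjacent $v_0,w_0\in\mathcal{M}_0$ with $v_0<w_0$. Basic heteroclinics. For $v<w$ in $\mathcal{M}_0$ let $\hat\Gamma_1(v,w)$ be the set of configurations $u$ that are $1$-periodic in $\mathbf{i}_2,\dots,\mathbf{i}_n$ with $v\le u\le w$. With $\mathbf{T}_i=i\mathbf{e}_1$ and $\|u\|_{\mathbf{T}_i}=|u(\mathbf{T}_i)|$, let $\Gamma_1(v_0,w_0)$ (resp. $\Gamma_1(w_0,v_0)$) be the set of $u\in\hat\Gamma_1(v_0,w_0)$ with $\|u-v_0\|_{\mathbf{T}_i}\to0$ as $i\to-\infty$ and $\|u-w_0\|_{\mathbf{T}_i}\to0$ as $i\to\infty$ (resp. with $v_0$ and $w_0$ interchanged in these limits). Put $J_{1,p}(u)=S_{\mathbf{T}_p}(u)-c_0$, $J_{1;p,q}(u)=\sum_{j=p}^qJ_{1,j}(u)$, $J_1(u)=\liminf_{p\to-\infty,\,q\to\infty}J_{1;p,q}(u)$.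 Let $c_1(v_0,w_0)=\inf_{\Gamma_1(v_0,w_0)}J_1$ and $\mathcal{M}_1(v_0,w_0)=\{u\in\Gamma_1(v_0,w_0):J_1(u)=c_1(v_0,w_0)\}$; $c_1(w_0,v_0)$ and $\mathcal{M}_1(w_0,v_0)$ are defined in the same way from $\Gamma_1(w_0,v_0)$. Gap condition $( *_1)$: there are adjacent $v_1<w_1$ in $\mathcal{M}_1(v_0,w_0)$ and adjacent $\tilde v_1<\tilde w_1$ in $\mathcal{M}_1(w_0,v_0)$. A configuration $u$ that is $1$-periodic in $\mathbf{i}_2,\dots,\mathbf{i}_n$ is asymptotic to $v_0$ as $\mathbf{i}_1\to\pm\infty$ if $\|u-v_0\|_{\mathbf{T}_i}\to0$ as $i\to\pm\infty$. A homoclinic solution asymptotic to $v_0$ is a solution $u\ne v_0$ asymptotic to $v_0$ both as $\mathbf{i}_1\to-\infty$ and as $\mathbf{i}_1\to\infty$ (similarly for $w_0$). *)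

theory Defs
  imports "HOL-Analysis.Analysis"
begin

text \<open>The lattice \<open>\<int>\<^sup>n\<close> is \<open>int ^ 'n\<close> with \<open>n = CARD('n)\<close>.  The index type carries
  no order, so the first coordinate is an explicit parameter \<open>a :: 'n\<close>; the other indices play the
  role of \<open>2, \<dots>, n\<close>, and \<open>\<^bold>e\<^sub>k\<close> is \<open>axis k 1\<close>.\<close>

type_synonym 'n config = "int ^ 'n \<Rightarrow> real"

definition l1 :: "int ^ ('n::finite) \<Rightarrow> int" where
  "l1 i = (\<Sum>k\<in>UNIV. \<bar>i $ k\<bar>)"

definition B :: "int \<Rightarrow> (int ^ ('n::finite)) set" where
  "B r = {k. l1 k \<le> r}"

lemma finite_B: "finite (B r :: (int ^ 'n::finite) set)"
proof -
  have "\<bar>k $ i\<bar> \<le> r" if "l1 k \<le> r" for k :: "int ^ 'n" and i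
    using that member_le_sum[of i UNIV "\<lambda>i. \<bar>k $ i\<bar>"] by (simp add: l1_def)
  then have "vec_nth ` (B r :: (int ^ 'n) set) \<subseteq> PiE UNIV (\<lambda>_. {-r..r})"
    by (auto simp: B_def abs_le_iff PiE_def minus_le_iff)
  then have "finite (vec_nth ` (B r :: (int ^ 'n) set))"
    by (rule finite_subset) (simp add: finite_PiE)
  then show ?thesis
    by (rule finite_imageD) (simp add: inj_on_def vec_nth_inject)
qed

text \<open>The space \<open>\<real>\<^sup>B\<close> is \<open>extensional B\<close>, with the topology inherited from the product topology
  on functions.  If \<open>x \<in> extensional B\<close> and \<open>k \<in> B\<close>, then \<open>x(k := t) \<in> extensional B\<close>, so the
  following partial derivatives only involve values of \<open>f\<close> on \<open>\<real>\<^sup>B\<close>.\<close>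

definition pderiv_at :: "'i \<Rightarrow> (('i \<Rightarrow> real) \<Rightarrow> real) \<Rightarrow> ('i \<Rightarrow> real) \<Rightarrow> real" where
  "pderiv_at k f x = deriv (\<lambda>t. f (x(k := t))) (x k)"

definition C1_on :: "'i set \<Rightarrow> (('i \<Rightarrow> real) \<Rightarrow> real) \<Rightarrow> bool" where
  "C1_on I f \<longleftrightarrow> continuous_on (extensional I) f \<and>
     (\<forall>k\<in>I. (\<forall>x\<in>extensional I. (\<lambda>t. f (x(k := t))) differentiable at (x k)) \<and>
            continuous_on (extensional I) (pderiv_at k f))"

definition C2_on :: "'i set \<Rightarrow> (('i \<Rightarrow> real) \<Rightarrow> real) \<Rightarrow> bool" where
  "C2_on I f \<longleftrightarrow> C1_on I f \<and> (\<forall>k\<in>I. C1_on I (pderiv_at k f))"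

definition S1 :: "int \<Rightarrow> (('n::finite) config \<Rightarrow> real) \<Rightarrow> bool" where
  "S1 r s \<longleftrightarrow> (\<forall>u\<in>extensional (B r). s (restrict (\<lambda>k. u k + 1) (B r)) = s u)"

definition S2 :: "int \<Rightarrow> (('n::finite) config \<Rightarrow> real) \<Rightarrow> bool" where
  "S2 r s \<longleftrightarrow> bdd_below (s ` extensional (B r)) \<and>
     (\<forall>k\<in>B r. \<forall>j\<in>B r. l1 (k - j) = 1 \<longrightarrow>
        (\<forall>M. \<exists>R. \<forall>u\<in>extensional (B r). R \<le> \<bar>u k - u j\<bar> \<longrightarrow> M \<le> s u))"

definition S3 :: "int \<Rightarrow> (('n::finite) config \<Rightarrow> real) \<Rightarrow> bool" where
  "S3 r s \<longleftrightarrow> (\<forall>x\<in>extensional (B r).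
     (\<forall>k\<in>B r. \<forall>j\<in>B r. k \<noteq> j \<longrightarrow> pderiv_at k (pderiv_at j s) x \<le> 0) \<and>
     (\<forall>j. l1 j = 1 \<longrightarrow> pderiv_at 0 (pderiv_at j s) x < 0))"

definition S_at :: "int \<Rightarrow> (('n::finite) config \<Rightarrow> real) \<Rightarrow> int ^ 'n \<Rightarrow> 'n config \<Rightarrow> real" where
  "S_at r s j u = s (restrict (\<lambda>k. u (j + k)) (B r))"

definition solution_EL :: "int \<Rightarrow> (('n::finite) config \<Rightarrow> real) \<Rightarrow> 'n config \<Rightarrow> bool" where
  "solution_EL r s u \<longleftrightarrow> (\<forall>i. (\<Sum>j | l1 (j - i) \<le> r. pderiv_at i (S_at r s j) u) = 0)"

text \<open>The order \<open><\<close> of the library on functions means \<open>\<le>\<close> and \<open>\<noteq>\<close>; the strict order between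
  configurations is strict at every site.  The library order \<open>\<le>\<close> is the pointwise one.\<close>

definition strictly_below :: "('n::finite) config \<Rightarrow> 'n config \<Rightarrow> bool" (infix "\<lless>" 50) where
  "u \<lless> v \<longleftrightarrow> (\<forall>j. u j < v j)"

definition adjacent :: "('n::finite) config set \<Rightarrow> 'n config \<Rightarrow> 'n config \<Rightarrow> bool" where
  "adjacent A v w \<longleftrightarrow> v \<in> A \<and> w \<in> A \<and> v \<lless> w \<and> \<not> (\<exists>u\<in>A. v \<lless> u \<and> u \<lless> w)"

definition periodic_in :: "('n::finite) \<Rightarrow> 'n config \<Rightarrow> bool" where
  "periodic_in k u \<longleftrightarrow> (\<forall>i. u (i + axis k 1) = u i)"

definition c0 :: "int \<Rightarrow> (('n::finite) config \<Rightarrow> real) \<Rightarrow> real" where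
  "c0 r s = (INF u\<in>{u. \<forall>k. periodic_in k u}. S_at r s 0 u)"

definition M0 :: "int \<Rightarrow> (('n::finite) config \<Rightarrow> real) \<Rightarrow> 'n config set" where
  "M0 r s = {u. (\<forall>k. periodic_in k u) \<and> S_at r s 0 u = c0 r s}"

definition periodic_off :: "('n::finite) \<Rightarrow> 'n config \<Rightarrow> bool" where
  "periodic_off a u \<longleftrightarrow> (\<forall>k. k \<noteq> a \<longrightarrow> periodic_in k u)"

text \<open>\<open>asymp_to a v F u\<close> says that \<open>u\<close> is asymptotic to \<open>v\<close> along \<open>\<^bold>T\<^sub>i = i \<^bold>e\<^sub>1\<close>, where
  \<open>F\<close> is \<open>at_bot\<close> for \<open>i \<rightarrow> -\<infinity>\<close> and \<open>at_top\<close> for \<open>i \<rightarrow> \<infinity>\<close>.\<close>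

definition asymp_to :: "('n::finite) \<Rightarrow> 'n config \<Rightarrow> int filter \<Rightarrow> 'n config \<Rightarrow> bool" where
  "asymp_to a v F u \<longleftrightarrow> ((\<lambda>i. \<bar>u (axis a i) - v (axis a i)\<bar>) \<longlongrightarrow> 0) F"

definition Gamma1_hat :: "('n::finite) \<Rightarrow> 'n config \<Rightarrow> 'n config \<Rightarrow> 'n config set" where
  "Gamma1_hat a v w = {u. periodic_off a u \<and> v \<le> u \<and> u \<le> w}"

text \<open>With \<open>v\<^sub>0 < w\<^sub>0\<close>, both classes of heteroclinics live in \<open>Gamma1_hat a v\<^sub>0 w\<^sub>0\<close>:
  \<open>Gamma1 a v\<^sub>0 w\<^sub>0 v\<^sub>0 w\<^sub>0\<close> is \<open>\<Gamma>\<^sub>1(v\<^sub>0, w\<^sub>0)\<close> and \<open>Gamma1 a v\<^sub>0 w\<^sub>0 w\<^sub>0 v\<^sub>0\<close> is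
  \<open>\<Gamma>\<^sub>1(w\<^sub>0, v\<^sub>0)\<close>.\<close>

definition Gamma1 ::
    "('n::finite) \<Rightarrow> 'n config \<Rightarrow> 'n config \<Rightarrow> 'n config \<Rightarrow> 'n config \<Rightarrow> 'n config set" where
  "Gamma1 a v w x y = {u \<in> Gamma1_hat a v w. asymp_to a x at_bot u \<and> asymp_to a y at_top u}"

definition J1_sum ::
    "int \<Rightarrow> (('n::finite) config \<Rightarrow> real) \<Rightarrow> 'n \<Rightarrow> int \<Rightarrow> int \<Rightarrow> 'n config \<Rightarrow> real" where
  "J1_sum r s a p q u = (\<Sum>j=p..q. S_at r s (axis a j) u - c0 r s)"

definition J1 :: "int \<Rightarrow> (('n::finite) config \<Rightarrow> real) \<Rightarrow> 'n \<Rightarrow> 'n config \<Rightarrow> ereal" where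
  "J1 r s a u = Liminf (at_bot \<times>\<^sub>F at_top) (\<lambda>(p, q). ereal (J1_sum r s a p q u))"

definition c1 :: "int \<Rightarrow> (('n::finite) config \<Rightarrow> real) \<Rightarrow> 'n \<Rightarrow>
    'n config \<Rightarrow> 'n config \<Rightarrow> 'n config \<Rightarrow> 'n config \<Rightarrow> ereal" where
  "c1 r s a v w x y = (INF u\<in>Gamma1 a v w x y. J1 r s a u)"

definition M1 :: "int \<Rightarrow> (('n::finite) config \<Rightarrow> real) \<Rightarrow> 'n \<Rightarrow>
    'n config \<Rightarrow> 'n config \<Rightarrow> 'n config \<Rightarrow> 'n config \<Rightarrow> 'n config set" where
  "M1 r s a v w x y = {u \<in> Gamma1 a v w x y. J1 r s a u = c1 r s a v w x y}"

definition gap1 :: "int \<Rightarrow> (('n::finite) config \<Rightarrow> real) \<Rightarrow> 'n \<Rightarrow> 'n config \<Rightarrow> 'n config \<Rightarrow> bool" where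
  "gap1 r s a v0 w0 \<longleftrightarrow>
     (\<exists>v1 w1. adjacent (M1 r s a v0 w0 v0 w0) v1 w1) \<and>
     (\<exists>v1' w1'. adjacent (M1 r s a v0 w0 w0 v0) v1' w1')"

definition homoclinic :: "int \<Rightarrow> (('n::finite) config \<Rightarrow> real) \<Rightarrow> 'n \<Rightarrow> 'n config \<Rightarrow> 'n config \<Rightarrow> bool" where
  "homoclinic r s a v u \<longleftrightarrow> solution_EL r s u \<and> periodic_off a u \<and> u \<noteq> v \<and>
     asymp_to a v at_bot u \<and> asymp_to a v at_top u"

definition heteroclinic ::
    "int \<Rightarrow> (('n::finite) config \<Rightarrow> real) \<Rightarrow> 'n \<Rightarrow> 'n config \<Rightarrow> 'n config \<Rightarrow> 'n config \<Rightarrow> bool" where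
  "heteroclinic r s a x y u \<longleftrightarrow> solution_EL r s u \<and> periodic_off a u \<and>
     asymp_to a x at_bot u \<and> asymp_to a y at_top u"

end

theory Submission imports Defs begin

text \<open>A configuration that is periodic off the first coordinate is a sequence of reals, and \<open>v\<^sub>0\<close>, \<open>w\<^sub>0\<close>
  are constants, so translates of one non-constant solution already give infinitely many: it suffices
  that minimal heteroclinics solve the equation, and to find a single homoclinic at either end.

  The tool is submodularity of the energy.  Sorting the shifts of a periodic sequence shows that its
  energy is at least the sum of the on-site energies \<open>h(x\<^sub>j)\<close> of the constants \<open>x\<^sub>j\<close>; this makes partial sums of the
  renormalized energy almost monotone, so that they converge as soon as they are bounded, and forces
  sequences of bounded energy to be close to \<open>v\<^sub>0\<close> or \<open>w\<^sub>0\<close> at all but boundedly many sites.  A homoclinic to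
  \<open>v\<^sub>0\<close> is obtained by constrained minimization near a heteroclinic \<open>v\<^sub>0 \<rightarrow> w\<^sub>0\<close> followed by a distant
  heteroclinic \<open>w\<^sub>0 \<rightarrow> v\<^sub>0\<close>, where the gaps keep the two transitions from moving towards each other.
  The homoclinic to \<open>w\<^sub>0\<close> follows by the symmetry \<open>u \<mapsto> -u\<close>.\<close>

text \<open>The constant \<open>v\<close> has energy zero and already minimizes among all sequences
  tending to \<open>v\<close> at both ends, so a nontrivial homoclinic needs constraints. An active
  constraint would leave only a one-sided inequality in place of the equation. Two mechanisms
  exclude this. Barriers made of equilibria or of minimal heteroclinics are harmless, since order
  reversal of the derivative supplies the missing inequality at a contact. Levels prescribed at the
  two transitions become strict by stability of the gaps. Between the transitions a fixed level
  \<open>c\<close> is imposed where the on-site energy has negative derivative; such a level exists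
  because this energy is positive inside the gap and zero at \<open>w\<close>. The distance
  \<open>N\<close> of the transitions has to be fixed before the minimizer is known, so tail
  estimates, cutting errors and the length of a stretch guaranteed to come near \<open>w\<close>
  must be uniform in the sequence. Single terms of the energy have no sign, which is why partial
  sums are monotone only up to small errors.\<close>

type_synonym sequence = "int \<Rightarrow> real"

abbreviation mx :: "('a \<Rightarrow> real) \<Rightarrow> ('a \<Rightarrow> real) \<Rightarrow> 'a \<Rightarrow> real" where
  "mx x y \<equiv> \<lambda>i. max (x i) (y i)"

abbreviation mn :: "('a \<Rightarrow> real) \<Rightarrow> ('a \<Rightarrow> real) \<Rightarrow> 'a \<Rightarrow> real" where
  "mn x y \<equiv> \<lambda>i. min (x i) (y i)"

definition sh :: "int \<Rightarrow> sequence \<Rightarrow> sequence" where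
  "sh j x = (\<lambda>i. x (i + j))"

section \<open>Sorting families of functions\<close>

text \<open>Insertion by compare-swaps whose positions do not depend on the values, that is, a
  sorting network. A family of functions can therefore be sorted at all arguments at once, each swap
  being one pair \<open>mn\<close>, \<open>mx\<close>.\<close>

primrec bubble :: "('a \<Rightarrow> real) \<Rightarrow> ('a \<Rightarrow> real) list \<Rightarrow> ('a \<Rightarrow> real) list" where
  "bubble z [] = [z]"
| "bubble z (y # ys) = mn y z # bubble (mx y z) ys"

lemma bubble_apply:
  "sorted (map (\<lambda>f. f p) ys) \<Longrightarrow>
     map (\<lambda>f. f p) (bubble z ys) = insort (z p) (map (\<lambda>f. f p) ys)"
proof (induction ys arbitrary: z)
  case (Cons y ys)
  then have IH: "map (\<lambda>f. f p) (bubble (mx y z) ys) = insort (max (y p) (z p)) (map (\<lambda>f. f p) ys)"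
    by simp
  show ?case
  proof (cases "z p \<le> y p")
    case True
    then have "insort (y p) (map (\<lambda>f. f p) ys) = y p # map (\<lambda>f. f p) ys"
      using Cons.prems by (intro insort_is_Cons) auto
    then show ?thesis using True IH by (simp add: max_def min_def)
  next
    case False
    then show ?thesis using IH by (simp add: max_def min_def)
  qed
qed simp

lemma foldr_bubble_apply:
  "map (\<lambda>f. f p) (foldr bubble fs []) = sort (map (\<lambda>f. f p) fs)"
  by (induction fs) (simp_all add: bubble_apply)

lemma sum_list_foldr_bubble:
  fixes E :: "('a \<Rightarrow> real) \<Rightarrow> real"
  assumes "\<And>x y. E (mx x y) + E (mn x y) \<le> E x + E y"
  shows "sum_list (map E (foldr bubble fs [])) \<le> sum_list (map E fs)"
proof -
  have *: "sum_list (map E (bubble z ys)) \<le> E z + sum_list (map E ys)" for z ys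
  proof (induction ys arbitrary: z)
    case (Cons y ys)
    show ?case using Cons[of "mx y z"] assms[of y z] by simp
  qed simp
  show ?thesis
  proof (induction fs)
    case (Cons f fs)
    then show ?case using *[of f "foldr bubble fs []"] by simp
  qed simp
qed

text \<open>Moving the window by one drops a value and appends the one a full period later, which is
  the same.\<close>

lemma mset_period:
  fixes x :: "int \<Rightarrow> 'a"
  assumes per: "\<And>i. x (i + N) = x i" and N: "N > 0"
  shows "mset (map (\<lambda>j. x (q + j)) [p..p + N - 1]) = mset (map x [p..p + N - 1])"
proof -
  have step: "mset (map (\<lambda>j. x (q + 1 + j)) [p..p + N - 1]) = mset (map (\<lambda>j. x (q + j)) [p..p + N - 1])" for q
  proof -
    have "map (\<lambda>j. x (q + 1 + j)) [p..p + N - 1] = map (\<lambda>j. x (q + j)) [p + 1..p + N]"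
    proof (rule nth_equalityI)
      show "length (map (\<lambda>j. x (q + 1 + j)) [p..p + N - 1]) = length (map (\<lambda>j. x (q + j)) [p + 1..p + N])"
        by simp
      fix i assume "i < length (map (\<lambda>j. x (q + 1 + j)) [p..p + N - 1])"
      then show "map (\<lambda>j. x (q + 1 + j)) [p..p + N - 1] ! i = map (\<lambda>j. x (q + j)) [p + 1..p + N] ! i"
        by (simp add: add.assoc add.left_commute)
    qed
    moreover have "[p + 1..p + N] = [p + 1..p + N - 1] @ [p + N]"
      using N by (subst upto_rec2) auto
    moreover have "[p..p + N - 1] = p # [p + 1..p + N - 1]"
      using N by (subst upto_rec1) auto
    moreover have "x (q + (p + N)) = x (q + p)" using per[of "q + p"] by (simp add: add.assoc)
    ultimately show ?thesis by simp
  qed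
  show ?thesis
  proof (induction q rule: int_induct[of _ 0])
    case (step1 i) then show ?case using step[of i] by simp
  next
    case (step2 i) then show ?case using step[of "i - 1"] by simp
  qed simp
qed

section \<open>Energies of sequences\<close>

text \<open>\<open>D p x\<close> is the derivative of the formal total energy \<open>\<Sum>j. H (sh j x)\<close> with respect to the
  site \<open>p\<close>, of which only the terms \<open>j\<close> with \<open>\<bar>j - p\<bar> \<le> r\<close> depend on \<open>x p\<close>.\<close>

locale sequence_energy =
  fixes r :: int and H :: "sequence \<Rightarrow> real" and D :: "int \<Rightarrow> sequence \<Rightarrow> real" and v w c0 :: real
  assumes r1: "r \<ge> 1"
    and H_local: "\<And>x y. (\<And>i. \<bar>i\<bar> \<le> r \<Longrightarrow> x i = y i) \<Longrightarrow> H x = H y"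
    and H_tendsto: "\<And>X x. (\<And>i. (\<lambda>n. X n i) \<longlonglongrightarrow> x i) \<Longrightarrow> (\<lambda>n::nat. H (X n)) \<longlonglongrightarrow> H x"
    and H_submodular: "\<And>x y. H (mx x y) + H (mn x y) \<le> H x + H y"
    and D_deriv: "\<And>p x. ((\<lambda>t. \<Sum>j=p-r..p+r. H (sh j (x(p := t)))) has_real_derivative D p x) (at (x p))"
    and D_const: "\<And>p c. ((\<lambda>t. H (\<lambda>_. t)) has_real_derivative D p (\<lambda>_. c)) (at c)"
    and D_antimono: "\<And>p x y. \<lbrakk>\<And>i. x i \<le> y i; x p = y p\<rbrakk> \<Longrightarrow> D p y \<le> D p x"
    and D_strict: "\<And>p x y. \<lbrakk>\<And>i. x i \<le> y i; x p = y p; D p x = D p y\<rbrakk> \<Longrightarrow>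
                     x (p - 1) = y (p - 1) \<and> x (p + 1) = y (p + 1)"
    and vw: "v < w"
    and Hv: "H (\<lambda>_. v) = c0" and Hw: "H (\<lambda>_. w) = c0"
    and Hge: "\<And>t. c0 \<le> H (\<lambda>_. t)"
    and Hgt: "\<And>t. v < t \<Longrightarrow> t < w \<Longrightarrow> c0 < H (\<lambda>_. t)"
begin

definition f :: "real \<Rightarrow> real" where "f t = H (\<lambda>_. t) - c0"
definition e :: "int \<Rightarrow> sequence \<Rightarrow> real" where "e j x = H (sh j x) - c0"
definition J :: "int \<Rightarrow> int \<Rightarrow> sequence \<Rightarrow> real" where "J p q x = (\<Sum>j=p..q. e j x)"

lemma f_nonneg: "0 \<le> f t" using Hge by (simp add: f_def)

lemma e_local: "(\<And>i. \<bar>i - j\<bar> \<le> r \<Longrightarrow> x i = y i) \<Longrightarrow> e j x = e j y"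
  unfolding e_def sh_def by (auto intro!: arg_cong[where f="\<lambda>a. a - c0"] H_local)

lemma e_const: "(\<And>i. \<bar>i - j\<bar> \<le> r \<Longrightarrow> x i = t) \<Longrightarrow> e j x = f t"
  using e_local[of j x "\<lambda>_. t"] by (simp add: e_def f_def sh_def)

lemma e_tendsto: "(\<And>i. (\<lambda>n. X n i) \<longlonglongrightarrow> x i) \<Longrightarrow> (\<lambda>n::nat. e j (X n)) \<longlonglongrightarrow> e j x"
  unfolding e_def sh_def by (intro tendsto_diff H_tendsto tendsto_const)

lemma J_tendsto: "(\<And>i. (\<lambda>n. X n i) \<longlonglongrightarrow> x i) \<Longrightarrow> (\<lambda>n::nat. J p q (X n)) \<longlonglongrightarrow> J p q x"
  unfolding J_def by (intro tendsto_sum e_tendsto)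

lemma J_submodular: "J p q (mx x y) + J p q (mn x y) \<le> J p q x + J p q y"
  unfolding J_def sum.distrib[symmetric]
proof (rule sum_mono)
  fix j show "e j (mx x y) + e j (mn x y) \<le> e j x + e j y"
    using H_submodular[of "sh j x" "sh j y"] by (simp add: e_def sh_def)
qed

text \<open>Sorting the \<open>N\<close> shifts of an \<open>N\<close>-periodic sequence pointwise produces constant sequences with
  the values \<open>x p, \<dots>, x (p + N - 1)\<close>, and submodularity makes each comparison-swap of the sorting
  decrease the total energy.\<close>

lemma periodic_energy_ge:
  assumes per: "\<And>i. x (i + N) = x i" and N: "N > 0"
  shows "(\<Sum>j=p..p+N-1. f (x j)) \<le> J p (p+N-1) x"
proof -
  define js where "js = [p..p + N - 1]"
  define fs where "fs = map (\<lambda>j. sh j x) js"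
  define ss where "ss = sort (map x js)"
  \<comment> \<open>At each \<open>q\<close> the shifts take the values of \<open>x\<close> over one
    period, a multiset independent of \<open>q\<close>; hence every sorted function is
    constant.\<close>
  have ev: "map (\<lambda>g. g q) (foldr bubble fs []) = ss" for q
  proof -
    have "map (\<lambda>g. g q) fs = map (\<lambda>j. x (q + j)) js"
      by (simp add: fs_def sh_def)
    then have "mset (map (\<lambda>g. g q) fs) = mset (map x js)"
      using mset_period[where x=x and N=N and q=q and p=p, OF per N] unfolding js_def by metis
    then show ?thesis
      unfolding foldr_bubble_apply ss_def by (intro properties_for_sort) auto
  qed
  have len: "length (foldr bubble fs []) = length ss" using ev[of 0] by (metis length_map)
  have "foldr bubble fs [] = map (\<lambda>c _. c) ss"
  proof (rule nth_equalityI)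
    show "length (foldr bubble fs []) = length (map (\<lambda>c _. c) ss)" using len by simp
    fix k assume k: "k < length (foldr bubble fs [])"
    show "foldr bubble fs [] ! k = map (\<lambda>c _. c) ss ! k"
    proof
      fix q show "(foldr bubble fs [] ! k) q = (map (\<lambda>c _. c) ss ! k) q"
        using k len ev[of q] by (metis nth_map)
    qed
  qed
  then have "sum_list (map H (map (\<lambda>c _. c) ss)) \<le> sum_list (map H fs)"
    using sum_list_foldr_bubble[of H fs] H_submodular by metis
  moreover have "sum_list (map H (map (\<lambda>c _. c) ss)) = sum_list (map (\<lambda>c. H (\<lambda>_. c)) ss)"
    by (simp add: o_def)
  moreover have "sum_list (map (\<lambda>c. H (\<lambda>_. c)) ss) = sum_list (map (\<lambda>c. H (\<lambda>_. c)) (map x js))"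
    by (metis (no_types, lifting) mset_map mset_sort ss_def sum_mset_sum_list)
  moreover have "sum_list (map (\<lambda>c. H (\<lambda>_. c)) (map x js)) = (\<Sum>j=p..p+N-1. H (\<lambda>_. x j))"
    unfolding js_def map_map o_def by (simp add: sum_list_distinct_conv_sum_set)
  moreover have "sum_list (map H fs) = (\<Sum>j=p..p+N-1. H (sh j x))"
    unfolding js_def fs_def map_map o_def by (simp add: sum_list_distinct_conv_sum_set)
  ultimately show ?thesis by (simp add: f_def J_def e_def sum_subtractf)
qed

text \<open>The segment is continued with period \<open>q - p + 1\<close>. The plateaus at both ends
  make the continuation agree with \<open>x\<close> on all sites that \<open>J p q\<close> reads, so
  the periodic inequality applies.\<close>

lemma closed_energy_ge:
  assumes pq: "p \<le> q"
    and xp: "\<And>i. \<bar>i - p\<bar> \<le> r \<Longrightarrow> x i = \<theta>" and xq: "\<And>i. \<bar>i - q\<bar> \<le> r \<Longrightarrow> x i = \<theta>"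
  shows "(\<Sum>j=p..q. f (x j)) \<le> J p q x"
proof -
  define N where "N = q - p + 1"
  define y where "y = (\<lambda>i. x (p + (i - p) mod N))"
  have N: "N > 0" using pq by (simp add: N_def)
  have per: "y (i + N) = y i" for i
    by (simp add: y_def diff_add_eq[symmetric])
  have in0: "y i = x i" if "p \<le> i" "i \<le> q" for i
    using that by (simp add: y_def N_def)
  \<comment> \<open>A period of length at most \<open>r\<close> lies inside the plateau at
    \<open>p\<close>. It is treated apart because the shift by one period used below might not reach
    the segment.\<close>
  have short: "y i = \<theta>" if "N \<le> r" for i
  proof -
    have "0 \<le> (i - p) mod N" "(i - p) mod N < N" using N by auto
    then show ?thesis unfolding y_def using that by (intro xp) auto
  qed
  have left: "y i = \<theta>" if "p - r \<le> i" "i < p" for i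
  proof (cases "N \<le> r")
    case False
    have "y i = y (i + N)" using per by simp
    also have "\<dots> = x (i + N)" using that False by (intro in0) (auto simp: N_def)
    also have "\<dots> = \<theta>" using that False by (intro xq) (auto simp: N_def)
    finally show ?thesis .
  qed (use short in auto)
  have right: "y i = \<theta>" if "q < i" "i \<le> q + r" for i
  proof (cases "N \<le> r")
    case False
    have "y i = y (i - N)" using per[of "i - N"] by simp
    also have "\<dots> = x (i - N)" using that False by (intro in0) (auto simp: N_def)
    also have "\<dots> = \<theta>" using that False by (intro xp) (auto simp: N_def)
    finally show ?thesis .
  qed (use short in auto)
  have eq: "y i = x i" if "p - r \<le> i" "i \<le> q + r" for i
    using that in0[of i] left[of i] right[of i] xp[of i] xq[of i] by (cases "i < p"; cases "q < i") auto
  have "(\<Sum>j=p..p+N-1. f (y j)) \<le> J p (p+N-1) y" by (rule periodic_energy_ge[where x=y and N=N, OF per N])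
  moreover have "p + N - 1 = q" by (simp add: N_def)
  moreover have "J p q y = J p q x" unfolding J_def
    by (intro sum.cong refl e_local eq) auto
  moreover have "(\<Sum>j=p..q. f (y j)) = (\<Sum>j=p..q. f (x j))"
    by (intro sum.cong refl) (auto simp: in0)
  ultimately show ?thesis by simp
qed

section \<open>Estimates near an equilibrium, uniform in the sequence\<close>

lemma f_cont: "continuous_on A f"
proof -
  have "isCont f t" for t
    unfolding f_def using DERIV_isCont[OF D_const[of 0 t]] by (intro continuous_intros) auto
  then show ?thesis by (simp add: continuous_at_imp_continuous_on)
qed

lemma e_small:
  assumes \<theta>: "f \<theta> = 0" and \<epsilon>: "\<epsilon> > 0"
  obtains \<delta> where "\<delta> > 0" "\<And>j x. (\<And>i. \<bar>i - j\<bar> \<le> r \<Longrightarrow> \<bar>x i - \<theta>\<bar> \<le> \<delta>) \<Longrightarrow> \<bar>e j x\<bar> \<le> \<epsilon>"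
proof -
  have "\<exists>\<delta>>0. \<forall>x. (\<forall>i. \<bar>i\<bar> \<le> r \<longrightarrow> \<bar>x i - \<theta>\<bar> \<le> \<delta>) \<longrightarrow> \<bar>H x - c0\<bar> \<le> \<epsilon>"
  proof (rule ccontr)
    assume neg: "\<not> ?thesis"
    have "\<exists>x. (\<forall>i. \<bar>i\<bar> \<le> r \<longrightarrow> \<bar>x i - \<theta>\<bar> \<le> inverse (real (Suc n))) \<and> \<bar>H x - c0\<bar> > \<epsilon>" for n
    proof -
      have "inverse (real (Suc n)) > 0" by simp
      with neg show ?thesis by (meson not_le)
    qed
    then obtain X where X: "\<And>n i. \<bar>i\<bar> \<le> r \<Longrightarrow> \<bar>X n i - \<theta>\<bar> \<le> inverse (real (Suc n))"
      and XH: "\<And>n. \<bar>H (X n) - c0\<bar> > \<epsilon>" by metis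
    \<comment> \<open>\<open>H_tendsto\<close> asks for convergence at every site; resetting the
      sites that \<open>H\<close> does not read to \<theta> provides it.\<close>
    define Y where "Y = (\<lambda>n i. if \<bar>i\<bar> \<le> r then X n i else \<theta>)"
    have HY: "H (Y n) = H (X n)" for n by (intro H_local) (simp add: Y_def)
    have "(\<lambda>n. Y n i) \<longlonglongrightarrow> \<theta>" for i
    proof (rule LIM_zero_cancel, rule tendsto_rabs_zero_cancel, rule tendsto_sandwich[where f="\<lambda>_. 0"])
      show "\<forall>\<^sub>F n in sequentially. \<bar>Y n i - \<theta>\<bar> \<le> inverse (real (Suc n))"
        using X by (intro always_eventually) (simp add: Y_def)
    qed (auto simp del: of_nat_Suc intro: LIMSEQ_inverse_real_of_nat)
    then have "(\<lambda>n. H (Y n)) \<longlonglongrightarrow> H (\<lambda>_. \<theta>)" by (intro H_tendsto)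
    then have "(\<lambda>n. H (X n)) \<longlonglongrightarrow> c0" using \<theta> by (simp add: HY f_def)
    then have "eventually (\<lambda>n. dist (H (X n)) c0 < \<epsilon>) sequentially" using \<epsilon> by (rule tendstoD)
    then obtain n where "\<bar>H (X n) - c0\<bar> < \<epsilon>" by (auto simp: eventually_sequentially dist_real_def)
    then show False using XH[of n] by simp
  qed
  then obtain \<delta> where d: "\<delta> > 0" "\<And>x. (\<forall>i. \<bar>i\<bar> \<le> r \<longrightarrow> \<bar>x i - \<theta>\<bar> \<le> \<delta>) \<Longrightarrow> \<bar>H x - c0\<bar> \<le> \<epsilon>" by blast
  have "\<bar>e j x\<bar> \<le> \<epsilon>" if "\<And>i. \<bar>i - j\<bar> \<le> r \<Longrightarrow> \<bar>x i - \<theta>\<bar> \<le> \<delta>" for j x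
    unfolding e_def sh_def using that by (intro d(2)) auto
  with d(1) that show ?thesis by blast
qed

text \<open>Setting \<open>x\<close> to \<theta> within \<open>r\<close> of both ends reduces to
  exact plateaus. Only terms within \<open>2*r\<close> of \<open>p\<close> or \<open>q\<close>
  change, and they read sites within \<open>3*r\<close>. Their number is independent of
  \<open>q - p\<close>, hence so is \<delta>.\<close>

lemma tail_energy_ge:
  assumes \<theta>: "f \<theta> = 0" and \<epsilon>: "\<epsilon> > 0"
  obtains \<delta> where "\<delta> > 0"
    "\<And>p q x. \<lbrakk>p \<le> q; \<And>i. \<bar>i - p\<bar> \<le> 3*r \<Longrightarrow> \<bar>x i - \<theta>\<bar> \<le> \<delta>; \<And>i. \<bar>i - q\<bar> \<le> 3*r \<Longrightarrow> \<bar>x i - \<theta>\<bar> \<le> \<delta>\<rbrakk>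
       \<Longrightarrow> (\<Sum>j\<in>{p+r<..<q-r}. f (x j)) \<le> J p q x + \<epsilon>"
proof -
  \<comment> \<open>At most \<open>2 * (4*r + 1)\<close> terms are affected, each by at most
    \<open>2 * \<epsilon>'\<close>.\<close>
  define K where "K = real_of_int (8 * r + 2)"
  have K: "K > 0" using r1 by (simp add: K_def)
  define \<epsilon>' where "\<epsilon>' = \<epsilon> / (2 * K)"
  have \<epsilon>': "\<epsilon>' > 0" using \<epsilon> K by (simp add: \<epsilon>'_def)
  obtain \<delta> where \<delta>: "\<delta> > 0"
    and small: "\<And>j x. (\<And>i. \<bar>i - j\<bar> \<le> r \<Longrightarrow> \<bar>x i - \<theta>\<bar> \<le> \<delta>) \<Longrightarrow> \<bar>e j x\<bar> \<le> \<epsilon>'"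
    using e_small[OF \<theta> \<epsilon>'] by metis
  have "(\<Sum>j\<in>{p+r<..<q-r}. f (x j)) \<le> J p q x + \<epsilon>"
    if pq: "p \<le> q" and xp: "\<And>i. \<bar>i - p\<bar> \<le> 3*r \<Longrightarrow> \<bar>x i - \<theta>\<bar> \<le> \<delta>"
      and xq: "\<And>i. \<bar>i - q\<bar> \<le> 3*r \<Longrightarrow> \<bar>x i - \<theta>\<bar> \<le> \<delta>" for p q x
  proof -
    define y where "y = (\<lambda>i. if \<bar>i - p\<bar> \<le> r \<or> \<bar>i - q\<bar> \<le> r then \<theta> else x i)"
    define W where "W = {p-2*r..p+2*r} \<union> {q-2*r..q+2*r}"
    have ey: "e j y \<le> e j x + (if j \<in> W then 2 * \<epsilon>' else 0)" for j
    proof (cases "j \<in> W")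
      case True
      have x1: "\<bar>x i - \<theta>\<bar> \<le> \<delta>" if "\<bar>i - j\<bar> \<le> r" for i
      proof -
        have "\<bar>i - p\<bar> \<le> 3 * r \<or> \<bar>i - q\<bar> \<le> 3 * r"
          using True that unfolding W_def Un_iff atLeastAtMost_iff by linarith
        then show ?thesis using xp xq by blast
      qed
      then have "\<bar>e j x\<bar> \<le> \<epsilon>'" by (rule small)
      moreover have "\<bar>e j y\<bar> \<le> \<epsilon>'"
        by (rule small) (use x1 \<delta> in \<open>auto simp: y_def\<close>)
      ultimately show ?thesis using True by auto
    next
      case False
      then have "e j y = e j x" by (intro e_local) (auto simp: y_def W_def)
      then show ?thesis using False by simp
    qed
    have fin: "finite W" and card: "real (card W) \<le> K"
    proof -
      show "finite W" by (simp add: W_def)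
      have "card W \<le> card {p-2*r..p+2*r} + card {q-2*r..q+2*r}"
        unfolding W_def by (rule card_Un_le)
      then show "real (card W) \<le> K" using r1 by (simp add: K_def)
    qed
    have "(\<Sum>j\<in>{p+r<..<q-r}. f (x j)) = (\<Sum>j\<in>{p+r<..<q-r}. f (y j))"
      by (intro sum.cong refl) (auto simp: y_def)
    also have "\<dots> \<le> (\<Sum>j=p..q. f (y j))"
      using r1 by (intro sum_mono2) (auto intro: f_nonneg)
    also have "\<dots> \<le> J p q y"
      by (rule closed_energy_ge[OF pq, where \<theta>=\<theta>]) (auto simp: y_def)
    also have "\<dots> \<le> J p q x + (\<Sum>j=p..q. if j \<in> W then 2 * \<epsilon>' else 0)"
      unfolding J_def sum.distrib[symmetric] by (intro sum_mono ey)
    also have "(\<Sum>j=p..q. if j \<in> W then 2 * \<epsilon>' else 0) = (\<Sum>j\<in>{p..q} \<inter> W. 2 * \<epsilon>')"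
      by (rule sum.inter_restrict[symmetric]) simp
    also have "\<dots> \<le> (\<Sum>j\<in>W. 2 * \<epsilon>')"
      using \<epsilon>' fin by (intro sum_mono2) auto
    also have "\<dots> \<le> 2 * \<epsilon>' * K"
      using card \<epsilon>' by (simp add: mult.commute mult_left_mono)
    also have "2 * \<epsilon>' * K = \<epsilon>" using K by (simp add: \<epsilon>'_def)
    finally show ?thesis by simp
  qed
  with \<delta> that show ?thesis by blast
qed

end

text \<open>Tychonoff gives compactness, and countability of the index type makes the product
  metrizable, so that compactness is sequential.\<close>

lemma bounded_sequences_subseq:
  fixes X :: "nat \<Rightarrow> 'a::countable \<Rightarrow> real"
  assumes "\<And>n i. v \<le> X n i \<and> X n i \<le> w"
  obtains x \<sigma> where "strict_mono (\<sigma> :: nat \<Rightarrow> nat)" "\<And>i. (\<lambda>n. X (\<sigma> n) i) \<longlonglongrightarrow> x i"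
proof -
  have "compactin (product_topology (\<lambda>_::'a. euclidean) UNIV) (PiE UNIV (\<lambda>_. {v..w}))"
    by (subst compactin_PiE) auto
  then have "compact (PiE UNIV (\<lambda>_::'a. {v..w}))"
    by (simp add: euclidean_product_topology)
  then have "seq_compact (PiE UNIV (\<lambda>_::'a. {v..w}))"
    by (simp add: compact_eq_seq_compact_metric)
  moreover have "\<forall>n. X n \<in> PiE UNIV (\<lambda>_. {v..w})" using assms by auto
  ultimately obtain x \<sigma> where "strict_mono (\<sigma> :: nat \<Rightarrow> nat)" "(X \<circ> \<sigma>) \<longlonglongrightarrow> x"
    unfolding seq_compact_def by metis
  moreover have "(\<lambda>n. X (\<sigma> n) i) \<longlonglongrightarrow> x i" for i
  proof -
    have "continuous_on UNIV (\<lambda>g::'a \<Rightarrow> real. g i)"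
      using continuous_on_product_then_coordinatewise[of UNIV "\<lambda>g. g" i] continuous_on_id by auto
    then show ?thesis
      using continuous_on_tendsto_compose[OF _ \<open>(X \<circ> \<sigma>) \<longlonglongrightarrow> x\<close>, of UNIV "\<lambda>g. g i"] by (simp add: o_def)
  qed
  ultimately show ?thesis using that by blast
qed

context sequence_energy
begin

section \<open>Renormalized energy\<close>

definition box :: "sequence \<Rightarrow> bool" where "box x \<longleftrightarrow> (\<forall>i. v \<le> x i \<and> x i \<le> w)"

definition near :: "real \<Rightarrow> real \<Rightarrow> real \<Rightarrow> int \<Rightarrow> sequence \<Rightarrow> bool" where
  "near a b \<delta> P x \<longleftrightarrow> 0 \<le> P \<and> (\<forall>i\<le>-P. \<bar>x i - a\<bar> \<le> \<delta>) \<and> (\<forall>i\<ge>P. \<bar>x i - b\<bar> \<le> \<delta>)"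

definition \<Gamma> :: "real \<Rightarrow> real \<Rightarrow> sequence set" where
  "\<Gamma> a b = {x. box x \<and> (\<forall>\<delta>>0. \<exists>P. near a b \<delta> P x)}"

text \<open>Convergence of the partial sums to a finite value as both ends recede independently.
  Energy is kept as a relation: minimality below quantifies over convergent energies only, so no
  value has to be assigned elsewhere.\<close>

definition hasJ :: "sequence \<Rightarrow> real \<Rightarrow> bool" where
  "hasJ x l \<longleftrightarrow> (\<forall>\<epsilon>>0. \<exists>P. \<forall>p\<le>-P. \<forall>q\<ge>P. \<bar>J p q x - l\<bar> \<le> \<epsilon>)"

definition argmin :: "sequence set \<Rightarrow> sequence \<Rightarrow> bool" where
  "argmin K x \<longleftrightarrow> x \<in> K \<and> (\<exists>l. hasJ x l \<and> (\<forall>y\<in>K. \<forall>l'. hasJ y l' \<longrightarrow> l \<le> l'))"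

definition lower_bound :: "real \<Rightarrow> real \<Rightarrow> real \<Rightarrow> bool" where
  "lower_bound a b c \<longleftrightarrow> (\<forall>x\<in>\<Gamma> a b. \<forall>l. hasJ x l \<longrightarrow> c \<le> l)"

lemma near_mono: "near a b \<delta> P x \<Longrightarrow> P \<le> P' \<Longrightarrow> near a b \<delta> P' x"
  by (auto simp: near_def)

lemma near_squeeze:
  assumes "near a b \<delta> P x" "near a b \<delta> P z" "\<And>i. x i \<le> y i" "\<And>i. y i \<le> z i"
  shows "near a b \<delta> P y"
proof -
  have "\<bar>y i - c\<bar> \<le> \<delta>" if "\<bar>x i - c\<bar> \<le> \<delta>" "\<bar>z i - c\<bar> \<le> \<delta>" for i c
    using that assms(3,4)[of i] by linarith
  then show ?thesis using assms(1,2) unfolding near_def by blast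
qed

lemma near_both:
  assumes "x \<in> \<Gamma> a b" "y \<in> \<Gamma> a b" "\<delta> > 0"
  obtains P where "near a b \<delta> P x" "near a b \<delta> P y"
proof -
  obtain P Q where "near a b \<delta> P x" "near a b \<delta> Q y" using assms unfolding \<Gamma>_def by blast
  then show ?thesis
    using that[of "max P Q"] near_mono[of a b \<delta> P x "max P Q"] near_mono[of a b \<delta> Q y "max P Q"] by simp
qed

text \<open>The tail thresholds come from \<open>x\<close> and \<open>z\<close> alone. This keeps a
  whole order interval under common control and prevents loss of the limits at infinity when passing
  to pointwise limits.\<close>

lemma \<Gamma>_squeeze:
  assumes "x \<in> \<Gamma> a b" "z \<in> \<Gamma> a b" "\<And>i. x i \<le> y i" "\<And>i. y i \<le> z i"
  shows "y \<in> \<Gamma> a b"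
proof -
  have "v \<le> y i \<and> y i \<le> w" for i
    using assms(1,2) assms(3,4)[of i] unfolding \<Gamma>_def box_def by (auto intro: order_trans)
  then have "box y" by (simp add: box_def)
  moreover have "\<exists>P. near a b \<delta> P y" if "\<delta> > 0" for \<delta>
  proof -
    obtain P where P: "near a b \<delta> P x" "near a b \<delta> P z" using near_both[OF assms(1,2) \<open>\<delta> > 0\<close>] .
    show ?thesis using near_squeeze[OF P assms(3,4)] ..
  qed
  ultimately show ?thesis by (simp add: \<Gamma>_def)
qed

lemma \<Gamma>_mx: assumes "x \<in> \<Gamma> a b" "y \<in> \<Gamma> a b" shows "mx x y \<in> \<Gamma> a b"
proof -
  have "box (mx x y)" using assms unfolding \<Gamma>_def box_def by (simp add: max_def)
  moreover have "\<exists>P. near a b \<delta> P (mx x y)" if "\<delta> > 0" for \<delta>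
  proof -
    obtain P where "near a b \<delta> P x" "near a b \<delta> P y" using near_both[OF assms \<open>\<delta> > 0\<close>] .
    then have "near a b \<delta> P (mx x y)" by (simp add: near_def max_def)
    then show ?thesis ..
  qed
  ultimately show ?thesis by (simp add: \<Gamma>_def)
qed

lemma \<Gamma>_mn: assumes "x \<in> \<Gamma> a b" "y \<in> \<Gamma> a b" shows "mn x y \<in> \<Gamma> a b"
proof -
  have "box (mn x y)" using assms unfolding \<Gamma>_def box_def by (simp add: min_def)
  moreover have "\<exists>P. near a b \<delta> P (mn x y)" if "\<delta> > 0" for \<delta>
  proof -
    obtain P where "near a b \<delta> P x" "near a b \<delta> P y" using near_both[OF assms \<open>\<delta> > 0\<close>] .
    then have "near a b \<delta> P (mn x y)" by (simp add: near_def min_def)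
    then show ?thesis ..
  qed
  ultimately show ?thesis by (simp add: \<Gamma>_def)
qed

lemma hasJ_unique: assumes "hasJ x k" "hasJ x l" shows "k = l"
proof (rule ccontr)
  assume "k \<noteq> l"
  define \<epsilon> where "\<epsilon> = \<bar>k - l\<bar> / 3"
  have e: "\<epsilon> > 0" using \<open>k \<noteq> l\<close> by (simp add: \<epsilon>_def)
  obtain P Q where "\<And>p q. p \<le> -P \<Longrightarrow> q \<ge> P \<Longrightarrow> \<bar>J p q x - k\<bar> \<le> \<epsilon>"
    "\<And>p q. p \<le> -Q \<Longrightarrow> q \<ge> Q \<Longrightarrow> \<bar>J p q x - l\<bar> \<le> \<epsilon>"
    using assms e unfolding hasJ_def by meson
  from this(1)[of "-max P Q" "max P Q"] this(2)[of "-max P Q" "max P Q"]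
  have "\<bar>J (-max P Q) (max P Q) x - k\<bar> \<le> \<epsilon>" "\<bar>J (-max P Q) (max P Q) x - l\<bar> \<le> \<epsilon>" by auto
  then have "\<bar>k - l\<bar> \<le> 2 * \<epsilon>" by linarith
  then show False using e by (simp add: \<epsilon>_def)
qed

lemma J_split: "p \<le> m + 1 \<Longrightarrow> m \<le> q \<Longrightarrow> J p q x = J p m x + J (m + 1) q x"
  unfolding J_def by (subst sum.union_disjoint[symmetric]) (auto intro: sum.cong)

text \<open>Enlarging the window adds two blocks in the tails, each of energy at least
  \<open>- (\<epsilon>/2)\<close> because on-site energies are nonnegative. \<delta> depends on
  \<epsilon> only and is shared by all sequences; the margin \<open>3*r + 1\<close> puts the
  neighbourhoods of the block ends inside the tails.\<close>

lemma J_almost_mono: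
  assumes a: "f a = 0" and b: "f b = 0" and \<epsilon>: "\<epsilon> > 0"
  obtains \<delta> where "\<delta> > 0"
    "\<And>x P p q p' q'. \<lbrakk>near a b \<delta> P x; p \<le> -(P+3*r+1); P+3*r+1 \<le> q; p' \<le> p; q \<le> q'\<rbrakk>
       \<Longrightarrow> J p q x \<le> J p' q' x + \<epsilon>"
proof -
  have e2: "\<epsilon> / 2 > 0" using \<epsilon> by simp
  obtain d1 where d1: "d1 > 0" "\<And>p q x. \<lbrakk>p \<le> q; \<And>i. \<bar>i - p\<bar> \<le> 3*r \<Longrightarrow> \<bar>x i - a\<bar> \<le> d1;
      \<And>i. \<bar>i - q\<bar> \<le> 3*r \<Longrightarrow> \<bar>x i - a\<bar> \<le> d1\<rbrakk> \<Longrightarrow> (\<Sum>j\<in>{p+r<..<q-r}. f (x j)) \<le> J p q x + \<epsilon>/2"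
    using tail_energy_ge[OF a e2] by metis
  obtain d2 where d2: "d2 > 0" "\<And>p q x. \<lbrakk>p \<le> q; \<And>i. \<bar>i - p\<bar> \<le> 3*r \<Longrightarrow> \<bar>x i - b\<bar> \<le> d2;
      \<And>i. \<bar>i - q\<bar> \<le> 3*r \<Longrightarrow> \<bar>x i - b\<bar> \<le> d2\<rbrakk> \<Longrightarrow> (\<Sum>j\<in>{p+r<..<q-r}. f (x j)) \<le> J p q x + \<epsilon>/2"
    using tail_energy_ge[OF b e2] by metis
  have pos: "0 \<le> (\<Sum>j\<in>A. f (x j))" for A and x :: sequence by (intro sum_nonneg f_nonneg)
  have "J p q x \<le> J p' q' x + \<epsilon>"
    if n: "near a b (min d1 d2) P x" and pP: "p \<le> -(P+3*r+1)" and qP: "P+3*r+1 \<le> q"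
      and p': "p' \<le> p" and q': "q \<le> q'" for x P p q p' q'
  proof -
    have P: "0 \<le> P" using n by (simp add: near_def)
    have "- (\<epsilon>/2) \<le> J p' (p - 1) x"
    proof (cases "p' \<le> p - 1")
      case True
      have "(\<Sum>j\<in>{p'+r<..<p-1-r}. f (x j)) \<le> J p' (p-1) x + \<epsilon>/2"
        by (rule d1(2)[OF True]) (use n pP p' in \<open>auto simp: near_def\<close>)
      then show ?thesis using pos[of x "{p'+r<..<p-1-r}"] by linarith
    qed (use \<epsilon> in \<open>simp add: J_def\<close>)
    moreover have "- (\<epsilon>/2) \<le> J (q + 1) q' x"
    proof (cases "q + 1 \<le> q'")
      case True
      have "(\<Sum>j\<in>{q+1+r<..<q'-r}. f (x j)) \<le> J (q+1) q' x + \<epsilon>/2"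
        by (rule d2(2)[OF True]) (use n qP q' in \<open>auto simp: near_def\<close>)
      then show ?thesis using pos[of x "{q+1+r<..<q'-r}"] by linarith
    qed (use \<epsilon> in \<open>simp add: J_def\<close>)
    moreover have "J p' q' x = J p' (p - 1) x + J p q' x"
      using J_split[of p' "p-1" q' x] p' pP qP q' P r1 by simp
    moreover have "J p q' x = J p q x + J (q + 1) q' x"
      using J_split[of p "q" q' x] p' pP qP q' P r1 by simp
    ultimately show ?thesis by simp
  qed
  moreover have "min d1 d2 > 0" using d1 d2 by simp
  ultimately show ?thesis using that by blast
qed

text \<open>The infimum of the levels reached on arbitrarily large windows is the lower limit of the
  partial sums. Almost monotonicity bounds it from below and turns it into a limit.\<close>

lemma hasJ_if_frequently_le:
  assumes a: "f a = 0" and b: "f b = 0" and x: "x \<in> \<Gamma> a b"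
    and C: "\<And>\<epsilon> P. \<epsilon> > 0 \<Longrightarrow> \<exists>p\<le>-P. \<exists>q\<ge>P. J p q x \<le> C + \<epsilon>"
  obtains l where "hasJ x l" "l \<le> C"
proof -
  have mono: "\<exists>P. \<forall>p\<le>-P. \<forall>q\<ge>P. \<forall>p'\<le>p. \<forall>q'\<ge>q. J p q x \<le> J p' q' x + \<epsilon>" if "\<epsilon> > 0" for \<epsilon>
  proof -
    obtain \<delta> where \<delta>: "\<delta> > 0" "\<And>x P p q p' q'. \<lbrakk>near a b \<delta> P x; p \<le> -(P+3*r+1); P+3*r+1 \<le> q; p' \<le> p; q \<le> q'\<rbrakk>
       \<Longrightarrow> J p q x \<le> J p' q' x + \<epsilon>" using J_almost_mono[OF a b \<open>\<epsilon> > 0\<close>] by metis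
    obtain P where "near a b \<delta> P x" using x \<delta>(1) unfolding \<Gamma>_def by blast
    then show ?thesis using \<delta>(2) by (intro exI[of _ "P+3*r+1"]) blast
  qed
  define S where "S = {c. \<forall>P. \<exists>p\<le>-P. \<exists>q\<ge>P. J p q x \<le> c}"
  have CS: "C + \<epsilon> \<in> S" if "\<epsilon> > 0" for \<epsilon> using C[OF that] by (simp add: S_def)
  then have ne: "S \<noteq> {}" using zero_less_one by blast
  have bdd: "bdd_below S"
  proof -
    obtain P where P: "\<forall>p\<le>-P. \<forall>q\<ge>P. \<forall>p'\<le>p. \<forall>q'\<ge>q. J p q x \<le> J p' q' x + 1" using mono[of 1] by auto
    have "J (-P) P x - 1 \<le> c" if c: "c \<in> S" for c
    proof -
      obtain p q where "p \<le> -P" "q \<ge> P" "J p q x \<le> c" using c unfolding S_def by blast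
      then show ?thesis using P[rule_format, of "-P" P p q] by simp
    qed
    then show ?thesis by (rule bdd_belowI)
  qed
  define l where "l = Inf S"
  have "l \<le> C"
  proof (rule field_le_epsilon)
    fix \<epsilon> :: real assume "\<epsilon> > 0" then show "l \<le> C + \<epsilon>"
      unfolding l_def by (intro cInf_lower CS bdd)
  qed
  moreover have "hasJ x l"
    unfolding hasJ_def
  proof (intro allI impI)
    fix \<epsilon> :: real assume e: "\<epsilon> > 0"
    have "l - \<epsilon> \<notin> S" using e cInf_lower[OF _ bdd] unfolding l_def by force
    then obtain P1 where "\<not> (\<exists>p\<le>-P1. \<exists>q\<ge>P1. J p q x \<le> l - \<epsilon>)" unfolding S_def by blast
    then have P1: "l - \<epsilon> < J p q x" if "p \<le> -P1" "q \<ge> P1" for p q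
      using that by (meson not_le)
    obtain c where c: "c \<in> S" "c < l + \<epsilon>/2"
      using e cInf_lessD[OF ne, of "l + \<epsilon>/2"] unfolding l_def by auto
    obtain P2 where P2: "\<forall>p\<le>-P2. \<forall>q\<ge>P2. \<forall>p'\<le>p. \<forall>q'\<ge>q. J p q x \<le> J p' q' x + \<epsilon>/2"
      using mono[of "\<epsilon>/2"] e by auto
    have "\<bar>J p q x - l\<bar> \<le> \<epsilon>" if "p \<le> -max P1 P2" "q \<ge> max P1 P2" for p q
    proof -
      obtain p' q' where "p' \<le> -max (-p) q" "q' \<ge> max (-p) q" and c': "J p' q' x \<le> c" using c(1) unfolding S_def by blast
      then have "p \<le> -P2" "q \<ge> P2" "p' \<le> p" "q \<le> q'" "p \<le> -P1" "q \<ge> P1" using that by linarith+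
      then have "J p q x \<le> J p' q' x + \<epsilon>/2" "l - \<epsilon> < J p q x" using P1 P2 by blast+
      then show ?thesis using c(2) c' by linarith
    qed
    then show "\<exists>P. \<forall>p\<le>-P. \<forall>q\<ge>P. \<bar>J p q x - l\<bar> \<le> \<epsilon>" by blast
  qed
  ultimately show ?thesis using that by blast
qed

text \<open>\<open>lower_bound\<close> speaks of convergent energies only. Partial sums that drop to
  \<open>c - \<epsilon>\<close> on arbitrarily large windows would converge to a value below
  \<open>c\<close>, so the bound passes to partial sums of every member.\<close>

lemma J_eventually_ge:
  assumes a: "f a = 0" and b: "f b = 0" and x: "x \<in> \<Gamma> a b"
    and c: "lower_bound a b c" and \<epsilon>: "\<epsilon> > 0"
  shows "\<exists>P. \<forall>p\<le>-P. \<forall>q\<ge>P. c - \<epsilon> \<le> J p q x"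
proof (rule ccontr)
  assume "\<not> ?thesis"
  then have "\<exists>p\<le>-P. \<exists>q\<ge>P. J p q x \<le> c - \<epsilon>" for P by (meson less_imp_le not_le)
  then have "\<exists>p\<le>-P. \<exists>q\<ge>P. J p q x \<le> (c - \<epsilon>) + \<epsilon>'" if "\<epsilon>' > 0" for \<epsilon>' P
    using that by (meson add_increasing2 less_imp_le order_refl order_trans)
  then obtain l where "hasJ x l" "l \<le> c - \<epsilon>" using hasJ_if_frequently_le[OF a b x] by blast
  then show False using c x \<epsilon> unfolding lower_bound_def by fastforce
qed

text \<open>Splitting principle: subtracting the lower bound of one piece bounds the other, and
  boundedness gives convergence. The pieces may have different limits at infinity; they will be a
  maximum and a minimum, or the two halves of a cut.\<close>

lemma hasJ_if_sum_le:
  assumes a: "f a = 0" and b: "f b = 0" and x: "x \<in> \<Gamma> a b"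
    and a': "f a' = 0" and b': "f b' = 0" and y: "y \<in> \<Gamma> a' b'"
    and c: "lower_bound a' b' c"
    and C: "\<And>\<epsilon>. \<epsilon> > 0 \<Longrightarrow> \<exists>P. \<forall>p\<le>-P. \<forall>q\<ge>P. J p q x + J p q y \<le> C + \<epsilon>"
  obtains l where "hasJ x l" "l \<le> C - c"
proof -
  have "\<exists>p\<le>-P. \<exists>q\<ge>P. J p q x \<le> (C - c) + \<epsilon>" if e: "\<epsilon> > 0" for \<epsilon> P
  proof -
    obtain P1 where P1: "\<forall>p\<le>-P1. \<forall>q\<ge>P1. J p q x + J p q y \<le> C + \<epsilon>/2" using C[of "\<epsilon>/2"] e by auto
    obtain P2 where P2: "\<forall>p\<le>-P2. \<forall>q\<ge>P2. c - \<epsilon>/2 \<le> J p q y"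
      using J_eventually_ge[OF a' b' y c, where \<epsilon>="\<epsilon>/2"] e by auto
    define Q where "Q = max P (max P1 P2)"
    have "-Q \<le> -P1" "P1 \<le> Q" "-Q \<le> -P2" "P2 \<le> Q" by (auto simp: Q_def)
    then have "J (-Q) Q x + J (-Q) Q y \<le> C + \<epsilon>/2" "c - \<epsilon>/2 \<le> J (-Q) Q y"
      using P1 P2 by blast+
    then have "J (-Q) Q x \<le> (C - c) + \<epsilon>" by linarith
    moreover have "-Q \<le> -P" "P \<le> Q" by (auto simp: Q_def)
    ultimately show ?thesis by blast
  qed
  then show ?thesis using hasJ_if_frequently_le[OF a b x] that by blast
qed

lemma hasJ_add:
  assumes "hasJ x k" "hasJ y l" "\<epsilon> > 0"
  shows "\<exists>P. \<forall>p\<le>-P. \<forall>q\<ge>P. J p q x + J p q y \<le> k + l + \<epsilon>"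
proof -
  obtain P where P: "\<forall>p\<le>-P. \<forall>q\<ge>P. \<bar>J p q x - k\<bar> \<le> \<epsilon>/2"
    using assms(1,3) half_gt_zero unfolding hasJ_def by blast
  obtain Q where Q: "\<forall>p\<le>-Q. \<forall>q\<ge>Q. \<bar>J p q y - l\<bar> \<le> \<epsilon>/2"
    using assms(2,3) half_gt_zero unfolding hasJ_def by blast
  have "J p q x + J p q y \<le> k + l + \<epsilon>" if "p \<le> -max P Q" "q \<ge> max P Q" for p q
  proof -
    have "\<bar>J p q x - k\<bar> \<le> \<epsilon>/2" "\<bar>J p q y - l\<bar> \<le> \<epsilon>/2"
      using P[rule_format, of p q] Q[rule_format, of p q] that by auto
    then show ?thesis by linarith
  qed
  then show ?thesis by blast
qed

lemma hasJ_mx_mn: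
  assumes a: "f a = 0" and b: "f b = 0" and x: "x \<in> \<Gamma> a b" and y: "y \<in> \<Gamma> a b"
    and k: "hasJ x k" and l: "hasJ y l" and c: "lower_bound a b c"
  obtains m m' where "hasJ (mx x y) m" "m \<le> k + l - c" "hasJ (mn x y) m'" "m' \<le> k + l - c"
proof -
  have *: "\<exists>P. \<forall>p\<le>-P. \<forall>q\<ge>P. J p q (mx x y) + J p q (mn x y) \<le> k + l + \<epsilon>" if "\<epsilon> > 0" for \<epsilon>
    using hasJ_add[OF k l that] J_submodular[of _ _ x y] by (meson order_trans)
  then have **: "\<exists>P. \<forall>p\<le>-P. \<forall>q\<ge>P. J p q (mn x y) + J p q (mx x y) \<le> k + l + \<epsilon>" if "\<epsilon> > 0" for \<epsilon>
    using that by (simp add: add.commute)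
  show ?thesis
    using hasJ_if_sum_le[OF a b \<Gamma>_mx[OF x y] a b \<Gamma>_mn[OF x y] c *]
      hasJ_if_sum_le[OF a b \<Gamma>_mn[OF x y] a b \<Gamma>_mx[OF x y] c **] that by metis
qed

text \<open>Lower semicontinuity. The bounds \<open>lo\<close> and \<open>hi\<close> give all
  \<open>X n\<close> a common tail, so one fixed window has energy at most
  \<open>l n + \<epsilon>\<close> for every \<open>n\<close>, and finite windows pass to the
  limit.\<close>

lemma hasJ_limit:
  assumes a: "f a = 0" and b: "f b = 0" and lo: "lo \<in> \<Gamma> a b" and hi: "hi \<in> \<Gamma> a b"
    and AX: "\<And>n i. lo i \<le> X n i" and XB: "\<And>n i. X n i \<le> hi i"
    and X: "\<And>i. (\<lambda>n. X n i) \<longlonglongrightarrow> x i"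
    and l: "\<And>n. hasJ (X n) (l n)" and lC: "l \<longlonglongrightarrow> C"
  obtains m where "x \<in> \<Gamma> a b" "hasJ x m" "m \<le> C"
proof -
  have Ax: "lo i \<le> x i" for i using X[of i] AX by (intro LIMSEQ_le_const) auto
  have xB: "x i \<le> hi i" for i using X[of i] XB by (intro LIMSEQ_le_const2) auto
  have x: "x \<in> \<Gamma> a b" by (rule \<Gamma>_squeeze[OF lo hi Ax xB])
  have "\<exists>p\<le>-P. \<exists>q\<ge>P. J p q x \<le> C + \<epsilon>" if e: "\<epsilon> > 0" for \<epsilon> P
  proof -
    have e2: "\<epsilon> / 2 > 0" using e by simp
    obtain \<delta> where \<delta>: "\<delta> > 0" "\<And>x P p q p' q'. \<lbrakk>near a b \<delta> P x; p \<le> -(P+3*r+1); P+3*r+1 \<le> q; p' \<le> p; q \<le> q'\<rbrakk>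
       \<Longrightarrow> J p q x \<le> J p' q' x + \<epsilon>/2" using J_almost_mono[OF a b e2] by metis
    obtain Q where Q: "near a b \<delta> Q lo" "near a b \<delta> Q hi" using near_both[OF lo hi \<delta>(1)] .
    define q where "q = max P (Q+3*r+1)"
    have "J (-q) q (X n) \<le> l n + \<epsilon>" for n
    proof -
      have n: "near a b \<delta> Q (X n)" by (rule near_squeeze[OF Q AX XB])
      obtain P' where P': "\<forall>p\<le>-P'. \<forall>q\<ge>P'. \<bar>J p q (X n) - l n\<bar> \<le> \<epsilon>/2"
        using l[of n] e2 unfolding hasJ_def by blast
      have "J (-q) q (X n) \<le> J (-max P' q) (max P' q) (X n) + \<epsilon>/2"
        by (rule \<delta>(2)[OF n]) (auto simp: q_def)
      moreover have "\<bar>J (-max P' q) (max P' q) (X n) - l n\<bar> \<le> \<epsilon>/2" using P' by simp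
      ultimately show ?thesis by linarith
    qed
    then have "J (-q) q x \<le> C + \<epsilon>"
      by (intro LIMSEQ_le[OF J_tendsto[OF X] tendsto_add[OF lC tendsto_const]]) auto
    moreover have "-q \<le> -P" "P \<le> q" by (auto simp: q_def)
    ultimately show ?thesis by blast
  qed
  then show ?thesis using hasJ_if_frequently_le[OF a b x] that x by blast
qed

section \<open>First variation and comparison of stationary sequences\<close>

definition G :: "int \<Rightarrow> sequence \<Rightarrow> real \<Rightarrow> real" where
  "G p x t = (\<Sum>j=p-r..p+r. H (sh j (x(p := t))))"

lemma hasJ_upd:
  assumes "hasJ x l" shows "hasJ (x(p := t)) (l + (G p x t - G p x (x p)))"
  unfolding hasJ_def
proof (intro allI impI)
  fix \<epsilon> :: real assume "\<epsilon> > 0"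
  then obtain P where P: "\<forall>p\<le>-P. \<forall>q\<ge>P. \<bar>J p q x - l\<bar> \<le> \<epsilon>" using assms unfolding hasJ_def by blast
  have diff: "J p' q (x(p := t)) - J p' q x = G p x t - G p x (x p)" if "p' \<le> p - r" "q \<ge> p + r" for p' q
  proof -
    have "J p' q (x(p := t)) - J p' q x = (\<Sum>j=p'..q. e j (x(p := t)) - e j x)"
      by (simp add: J_def sum_subtractf)
    also have "\<dots> = (\<Sum>j=p-r..p+r. e j (x(p := t)) - e j x)"
    proof (rule sum.mono_neutral_right)
      show "\<forall>i\<in>{p'..q} - {p - r..p + r}. e i (x(p := t)) - e i x = 0"
      proof
        fix i assume "i \<in> {p'..q} - {p - r..p + r}"
        then have "e i (x(p := t)) = e i x" by (intro e_local) auto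
        then show "e i (x(p := t)) - e i x = 0" by simp
      qed
    qed (use that in auto)
    also have "\<dots> = G p x t - G p x (x p)" by (simp add: G_def e_def sum_subtractf)
    finally show ?thesis .
  qed
  define Q where "Q = max P (\<bar>p\<bar> + r)"
  have "\<bar>J p' q (x(p := t)) - (l + (G p x t - G p x (x p)))\<bar> \<le> \<epsilon>" if "p' \<le> -Q" "q \<ge> Q" for p' q
  proof -
    have "p' \<le> p - r" "q \<ge> p + r" "p' \<le> -P" "q \<ge> P" using that by (auto simp: Q_def)
    then show ?thesis using diff[of p' q] P[rule_format, of p' q] by linarith
  qed
  then show "\<exists>P. \<forall>p'\<le>-P. \<forall>q\<ge>P. \<bar>J p' q (x(p := t)) - (l + (G p x t - G p x (x p)))\<bar> \<le> \<epsilon>" by blast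
qed

text \<open>One-sided first variation: only upward changes of \<open>x p\<close> have to stay in
  \<open>K\<close>, so lower constraints do no harm here.\<close>

lemma argmin_D_nonneg:
  assumes m: "argmin K x" and d: "d > x p" and K: "\<And>t. x p < t \<Longrightarrow> t < d \<Longrightarrow> x(p := t) \<in> K"
  shows "0 \<le> D p x"
proof (rule ccontr)
  assume "\<not> ?thesis"
  then have "D p x < 0" by simp
  have der: "(G p x has_real_derivative D p x) (at (x p))"
    using D_deriv[where p=p and x=x] unfolding G_def by simp
  obtain h where h: "h > 0" "\<And>k. 0 < k \<Longrightarrow> k < h \<Longrightarrow> G p x (x p + k) < G p x (x p)"
    using DERIV_neg_dec_right[OF der \<open>D p x < 0\<close>] by blast
  obtain k where "0 < k" "k < min h (d - x p)" using h(1) d dense[of 0 "min h (d - x p)"] by auto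
  then have k: "0 < k" "k < h" "x p + k < d" by auto
  obtain l where l: "hasJ x l" "\<And>y l'. y \<in> K \<Longrightarrow> hasJ y l' \<Longrightarrow> l \<le> l'" using m unfolding argmin_def by blast
  have "l \<le> l + (G p x (x p + k) - G p x (x p))"
    by (rule l(2)[OF K hasJ_upd[OF l(1)]]) (use k in auto)
  then show False using h(2)[OF k(1,2)] by simp
qed

lemma argmin_D_nonpos:
  assumes m: "argmin K x" and d: "d < x p" and K: "\<And>t. d < t \<Longrightarrow> t < x p \<Longrightarrow> x(p := t) \<in> K"
  shows "D p x \<le> 0"
proof (rule ccontr)
  assume "\<not> ?thesis"
  then have "D p x > 0" by simp
  have der: "(G p x has_real_derivative D p x) (at (x p))"
    using D_deriv[where p=p and x=x] unfolding G_def by simp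
  obtain h where h: "h > 0" "\<And>k. 0 < k \<Longrightarrow> k < h \<Longrightarrow> G p x (x p - k) < G p x (x p)"
    using DERIV_pos_inc_left[OF der \<open>D p x > 0\<close>] by blast
  obtain k where "0 < k" "k < min h (x p - d)" using h(1) d dense[of 0 "min h (x p - d)"] by auto
  then have k: "0 < k" "k < h" "x p - k > d" by auto
  obtain l where l: "hasJ x l" "\<And>y l'. y \<in> K \<Longrightarrow> hasJ y l' \<Longrightarrow> l \<le> l'" using m unfolding argmin_def by blast
  have "l \<le> l + (G p x (x p - k) - G p x (x p))"
    by (rule l(2)[OF K hasJ_upd[OF l(1)]]) (use k in auto)
  then show False using h(2)[OF k(1,2)] by simp
qed

lemma fv: "f v = 0" and fw: "f w = 0" by (simp_all add: f_def Hv Hw)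

lemma D_const_zero: assumes "f \<theta> = 0" shows "D p (\<lambda>_. \<theta>) = 0"
proof (rule DERIV_local_min[OF D_const, of 1])
  show "\<forall>y. \<bar>\<theta> - y\<bar> < 1 \<longrightarrow> H (\<lambda>_. \<theta>) \<le> H (\<lambda>_. y)" using assms Hge by (simp add: f_def)
qed simp

lemma \<Gamma>_upd: assumes "x \<in> \<Gamma> a b" "v \<le> t" "t \<le> w" shows "x(p := t) \<in> \<Gamma> a b"
proof -
  have "box (x(p := t))" using assms by (auto simp: \<Gamma>_def box_def)
  moreover have "\<exists>P. near a b \<delta> P (x(p := t))" if "\<delta> > 0" for \<delta>
  proof -
    obtain P where "near a b \<delta> P x" using assms(1) \<open>\<delta> > 0\<close> unfolding \<Gamma>_def by blast
    then have "near a b \<delta> (max P (\<bar>p\<bar> + 1)) (x(p := t))" by (auto simp: near_def)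
    then show ?thesis ..
  qed
  ultimately show ?thesis by (simp add: \<Gamma>_def)
qed

text \<open>At a site where \<open>x\<close> touches \<open>v\<close>, comparison with the
  equilibrium \<open>v\<close> gives the inequality that one-sided variation cannot; likewise for
  \<open>w\<close>.\<close>

lemma argmin_\<Gamma>_D_zero: assumes m: "argmin (\<Gamma> a b) x" shows "D p x = 0"
proof (rule antisym)
  have xG: "x \<in> \<Gamma> a b" using m by (simp add: argmin_def)
  then have bx: "v \<le> x i" "x i \<le> w" for i by (auto simp: \<Gamma>_def box_def)
  show "D p x \<le> 0"
  proof (cases "x p = v")
    case True
    then have "D p x \<le> D p (\<lambda>_. v)" by (intro D_antimono bx(1)) simp
    then show ?thesis by (simp add: D_const_zero[OF fv])
  next
    case False
    show ?thesis
    proof (rule argmin_D_nonpos[OF m, of v])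
      fix t assume "v < t" "t < x p" then show "x(p := t) \<in> \<Gamma> a b"
        using bx[of p] \<Gamma>_upd[OF xG, of t p] by linarith
    qed (use False bx[of p] in auto)
  qed
  show "0 \<le> D p x"
  proof (cases "x p = w")
    case True
    then have "D p (\<lambda>_. w) \<le> D p x" by (intro D_antimono bx(2)) simp
    then show ?thesis by (simp add: D_const_zero[OF fw])
  next
    case False
    show ?thesis
    proof (rule argmin_D_nonneg[OF m, of _ w])
      fix t assume "x p < t" "t < w" then show "x(p := t) \<in> \<Gamma> a b"
        using bx[of p] \<Gamma>_upd[OF xG, of t p] by linarith
    qed (use False bx[of p] in auto)
  qed
qed

text \<open>By \<open>D_strict\<close> a contact of two ordered stationary sequences spreads to both
  neighbours, hence to all sites.\<close>

lemma strong_comparison: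
  assumes le: "\<And>i. x i \<le> y i" and D: "\<And>p. D p x = 0" "\<And>p. D p y = 0" and lt: "x k < y k"
  shows "x p < y p"
proof (rule ccontr)
  assume "\<not> ?thesis"
  then have p: "x p = y p" using le[of p] by simp
  have step: "x (q - 1) = y (q - 1) \<and> x (q + 1) = y (q + 1)" if "x q = y q" for q
    using D_strict[where x=x and y=y and p=q] le that D by simp
  have "x k = y k"
    by (induction k rule: int_induct[of _ p]) (use p step in auto)
  then show False using lt by simp
qed


section \<open>Gaps and homoclinics\<close>

definition gap_pair :: "real \<Rightarrow> real \<Rightarrow> sequence \<Rightarrow> sequence \<Rightarrow> bool" where
  "gap_pair a b x y \<longleftrightarrow> argmin (\<Gamma> a b) x \<and> argmin (\<Gamma> a b) y \<and> (\<forall>i. x i < y i) \<and>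
     \<not> (\<exists>z. argmin (\<Gamma> a b) z \<and> (\<forall>i. x i < z i \<and> z i < y i))"

lemma near_half_gt: "\<bar>x - w'\<bar> \<le> (w' - c) / 2 \<Longrightarrow> c < w' \<Longrightarrow> c < (x::real)"
  using abs_ge_minus_self[of "x - w'"] by (simp add: field_simps)

lemma gap_pairE:
  assumes "gap_pair a b x y"
  obtains c where "x \<in> \<Gamma> a b" "y \<in> \<Gamma> a b" "hasJ x c" "hasJ y c" "lower_bound a b c"
proof -
  obtain k where k: "x \<in> \<Gamma> a b" "hasJ x k" "lower_bound a b k"
    using assms unfolding gap_pair_def argmin_def lower_bound_def by blast
  obtain l where l: "y \<in> \<Gamma> a b" "hasJ y l" "lower_bound a b l"
    using assms unfolding gap_pair_def argmin_def lower_bound_def by blast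
  have "k = l" using k l unfolding lower_bound_def by (meson order_antisym)
  then show ?thesis using that k l by blast
qed

text \<open>Truncating almost minimizers to the order interval \<open>[x, y]\<close> costs no energy, so they
  accumulate at a minimizer in this interval; the gap leaves only \<open>y\<close>.\<close>

lemma gap_pair_stable:
  assumes a: "f a = 0" and b: "f b = 0" and gap: "gap_pair a b x y"
    and c: "hasJ x c" and \<gamma>: "x 0 < \<gamma>"
  shows "\<exists>\<eta>>0. \<forall>u\<in>\<Gamma> a b. \<forall>l. hasJ u l \<longrightarrow> l \<le> c + \<eta> \<longrightarrow> \<gamma> \<le> u 0 \<longrightarrow> (x i + y i) / 2 < u i"
proof (rule ccontr)
  assume neg: "\<not> ?thesis"
  have "\<exists>u l. u \<in> \<Gamma> a b \<and> hasJ u l \<and> l \<le> c + inverse (real (Suc n)) \<and> \<gamma> \<le> u 0 \<and> u i \<le> (x i + y i) / 2" for n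
  proof -
    have "inverse (real (Suc n)) > 0" by simp
    with neg show ?thesis by (meson not_le)
  qed
  then obtain U L where U: "\<And>n. U n \<in> \<Gamma> a b" "\<And>n. hasJ (U n) (L n)"
    "\<And>n. L n \<le> c + inverse (real (Suc n))" "\<And>n. \<gamma> \<le> U n 0" "\<And>n. U n i \<le> (x i + y i) / 2"
    by metis
  obtain c' where "x \<in> \<Gamma> a b" "y \<in> \<Gamma> a b" "hasJ x c'" "hasJ y c'" "lower_bound a b c'"
    using gap_pairE[OF gap] .
  moreover from this have "c' = c" using hasJ_unique c by blast
  ultimately have x: "x \<in> \<Gamma> a b" and y: "y \<in> \<Gamma> a b" and yc: "hasJ y c" and lb: "lower_bound a b c"
    by auto
  have xy: "x i < y i" for i using gap by (simp add: gap_pair_def)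
  define Y where "Y = (\<lambda>n. mx x (mn y (U n)))"
  have "\<exists>m. hasJ (Y n) m \<and> c \<le> m \<and> m \<le> c + inverse (real (Suc n))" for n
  proof -
    obtain m1 m2 where m: "hasJ (mn y (U n)) m2" "m2 \<le> c + L n - c"
      using hasJ_mx_mn[OF a b y U(1) yc U(2) lb] by metis
    obtain m3 m4 where m3: "hasJ (Y n) m3" "m3 \<le> c + m2 - c"
      using hasJ_mx_mn[OF a b x \<Gamma>_mn[OF y U(1)] c m(1) lb] unfolding Y_def by metis
    have "Y n \<in> \<Gamma> a b" unfolding Y_def by (intro \<Gamma>_mx \<Gamma>_mn x y U)
    then have "c \<le> m3" using lb m3(1) unfolding lower_bound_def by blast
    then show ?thesis using m3 m(2) U(3)[of n] by (intro exI[of _ m3]) auto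
  qed
  then obtain M where M: "\<And>n. hasJ (Y n) (M n)" "\<And>n. c \<le> M n" "\<And>n. M n \<le> c + inverse (real (Suc n))"
    by metis
  have Mlim: "M \<longlonglongrightarrow> c"
  proof (rule tendsto_sandwich[of "\<lambda>_. c"])
    show "(\<lambda>n. c + inverse (real (Suc n))) \<longlonglongrightarrow> c"
      using tendsto_add[OF tendsto_const[of c] LIMSEQ_inverse_real_of_nat] by simp
  qed (use M in auto)
  have xY: "x i \<le> Y n i" and Yy: "Y n i \<le> y i" for n i
    using xy[of i] by (auto simp: Y_def)
  have bx: "v \<le> x i" "y i \<le> w" for i using x y by (auto simp: \<Gamma>_def box_def)
  have "v \<le> Y n i \<and> Y n i \<le> w" for n i
    using xY[of i n] Yy[of n i] bx[of i] by linarith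
  then obtain z \<sigma> where s: "strict_mono (\<sigma> :: nat \<Rightarrow> nat)" and z: "\<And>i. (\<lambda>n. Y (\<sigma> n) i) \<longlonglongrightarrow> z i"
    using bounded_sequences_subseq[of v Y w] by metis
  have "(\<lambda>n. M (\<sigma> n)) \<longlonglongrightarrow> c" using LIMSEQ_subseq_LIMSEQ[OF Mlim s] by (simp add: o_def)
  then obtain m where zG: "z \<in> \<Gamma> a b" and m: "hasJ z m" "m \<le> c"
    using hasJ_limit[OF a b x y, of "\<lambda>n. Y (\<sigma> n)" z "\<lambda>n. M (\<sigma> n)" c] xY Yy z M(1) by metis
  have zmin: "argmin (\<Gamma> a b) z"
    unfolding argmin_def using zG m lb unfolding lower_bound_def by (meson order_trans)
  have xz: "x i \<le> z i" for i using z[of i] xY by (intro LIMSEQ_le_const) auto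
  have zy: "z i \<le> y i" for i using z[of i] Yy by (intro LIMSEQ_le_const2) auto
  \<comment> \<open>The prescribed height at site \<open>0\<close> survives in the limit and
    separates \<open>z\<close> from \<open>x\<close>; the midpoint bound at \<open>i\<close> will
    separate it from \<open>y\<close>.\<close>
  have "min \<gamma> (y 0) \<le> z 0"
  proof (rule LIMSEQ_le_const[OF z])
    have "min \<gamma> (y 0) \<le> Y (\<sigma> n) 0" for n using U(4)[of "\<sigma> n"] by (auto simp: Y_def)
    then show "\<exists>N. \<forall>n\<ge>N. min \<gamma> (y 0) \<le> Y (\<sigma> n) 0" by blast
  qed
  then have lt0: "x 0 < z 0" using \<gamma> xy[of 0] by auto
  have "z i \<le> (x i + y i) / 2"
  proof (rule LIMSEQ_le_const2[OF z])
    have "Y (\<sigma> n) i \<le> (x i + y i) / 2" for n using U(5)[of "\<sigma> n"] xy[of i] by (auto simp: Y_def)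
    then show "\<exists>N. \<forall>n\<ge>N. Y (\<sigma> n) i \<le> (x i + y i) / 2" by blast
  qed
  then have lti: "z i < y i" using xy[of i] by auto
  \<comment> \<open>All three are stationary, so strictness at one site spreads to all sites and
    places \<open>z\<close> in the gap.\<close>
  have D0: "D p x = 0" "D p y = 0" "D p z = 0" for p
    using gap zmin argmin_\<Gamma>_D_zero unfolding gap_pair_def by auto
  have "x p < z p" for p by (rule strong_comparison[OF xz D0(1,3) lt0])
  moreover have "z p < y p" for p by (rule strong_comparison[OF zy D0(3,2) lti])
  ultimately show False using gap zmin unfolding gap_pair_def by blast
qed

lemma gap_pair_stable_finite:
  assumes "f a = 0" "f b = 0" "gap_pair a b x y" "hasJ x c" "x 0 < \<gamma>" "finite F"
  obtains \<eta> where "\<eta> > 0"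
    "\<And>u l i. \<lbrakk>u \<in> \<Gamma> a b; hasJ u l; l \<le> c + \<eta>; \<gamma> \<le> u 0; i \<in> F\<rbrakk> \<Longrightarrow> (x i + y i) / 2 < u i"
proof -
  obtain g where g: "\<And>i. g i > 0"
    "\<And>i. \<forall>u\<in>\<Gamma> a b. \<forall>l. hasJ u l \<longrightarrow> l \<le> c + g i \<longrightarrow> \<gamma> \<le> u 0 \<longrightarrow> (x i + y i) / 2 < u i"
    using gap_pair_stable[OF assms(1-5)] by metis
  \<comment> \<open>Inserting \<open>1\<close> keeps the minimum meaningful when \<open>F\<close> is
    empty.\<close>
  define \<eta> where "\<eta> = Min (insert 1 (g ` F))"
  have "\<eta> > 0" using g(1) assms(6) by (simp add: \<eta>_def)
  moreover have "(x i + y i) / 2 < u i"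
    if "u \<in> \<Gamma> a b" "hasJ u l" "l \<le> c + \<eta>" "\<gamma> \<le> u 0" "i \<in> F" for u l i
  proof -
    have "\<eta> \<le> g i" unfolding \<eta>_def using that(5) assms(6) by (intro Min_le) auto
    then show ?thesis using g(2)[of i] that by fastforce
  qed
  ultimately show ?thesis using that by blast
qed

section \<open>Cutting a sequence where it is close to the upper equilibrium\<close>

definition cutL :: "int \<Rightarrow> sequence \<Rightarrow> sequence" where "cutL k x = (\<lambda>i. if i \<le> k then x i else w)"
definition cutR :: "int \<Rightarrow> sequence \<Rightarrow> sequence" where "cutR k x = (\<lambda>i. if i \<le> k then w else x i)"

text \<open>For a term more than \<open>r\<close> away from \<open>k\<close>, one piece looks like
  \<open>x\<close> and the other like the constant \<open>w\<close>, whose energy is zero. The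
  \<open>2*r + 1\<close> remaining terms read sites within \<open>2*r\<close> of \<open>k\<close>,
  where \<open>x\<close> is near \<open>w\<close>, so the three energies involved are small.\<close>

lemma J_cut:
  assumes \<epsilon>: "\<epsilon> > 0"
  obtains \<delta> where "\<delta> > 0"
    "\<And>x k p q. (\<And>i. \<bar>i - k\<bar> \<le> 2*r \<Longrightarrow> \<bar>x i - w\<bar> \<le> \<delta>) \<Longrightarrow> J p q (cutL k x) + J p q (cutR k x) \<le> J p q x + \<epsilon>"
proof -
  define K where "K = real_of_int (2 * r + 1)"
  have K: "K > 0" using r1 by (simp add: K_def)
  define \<epsilon>' where "\<epsilon>' = \<epsilon> / (3 * K)"
  have \<epsilon>': "\<epsilon>' > 0" using \<epsilon> K by (simp add: \<epsilon>'_def)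
  obtain \<delta> where \<delta>: "\<delta> > 0"
    and small: "\<And>j x. (\<And>i. \<bar>i - j\<bar> \<le> r \<Longrightarrow> \<bar>x i - w\<bar> \<le> \<delta>) \<Longrightarrow> \<bar>e j x\<bar> \<le> \<epsilon>'"
    using e_small[OF fw \<epsilon>'] by metis
  have "J p q (cutL k x) + J p q (cutR k x) \<le> J p q x + \<epsilon>"
    if near: "\<And>i. \<bar>i - k\<bar> \<le> 2*r \<Longrightarrow> \<bar>x i - w\<bar> \<le> \<delta>" for x k p q
  proof -
    have ej: "e j (cutL k x) + e j (cutR k x) \<le> e j x + (if j \<in> {k-r..k+r} then 3 * \<epsilon>' else 0)" for j
    proof (cases "j \<in> {k-r..k+r}")
      case True
      have "\<bar>x i - w\<bar> \<le> \<delta>" if "\<bar>i - j\<bar> \<le> r" for i using near[of i] that True by auto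
      then have "\<bar>e j x\<bar> \<le> \<epsilon>'" "\<bar>e j (cutL k x)\<bar> \<le> \<epsilon>'" "\<bar>e j (cutR k x)\<bar> \<le> \<epsilon>'"
        using \<delta> by (auto intro!: small simp: cutL_def cutR_def)
      then show ?thesis using True by simp
    next
      case False
      then consider "j < k - r" | "k + r < j" by force
      then show ?thesis
      proof cases
        case 1
        have "e j (cutL k x) = e j x" using 1 by (intro e_local) (auto simp: cutL_def)
        moreover have "e j (cutR k x) = f w" using 1 by (intro e_const) (auto simp: cutR_def)
        ultimately show ?thesis using \<epsilon>' by (simp add: fw)
      next
        case 2
        have "e j (cutR k x) = e j x" using 2 by (intro e_local) (auto simp: cutR_def)
        moreover have "e j (cutL k x) = f w" using 2 by (intro e_const) (auto simp: cutL_def)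
        ultimately show ?thesis using \<epsilon>' by (simp add: fw)
      qed
    qed
    have "J p q (cutL k x) + J p q (cutR k x) \<le> J p q x + (\<Sum>j=p..q. if j \<in> {k-r..k+r} then 3 * \<epsilon>' else 0)"
      unfolding J_def sum.distrib[symmetric] by (intro sum_mono ej)
    also have "(\<Sum>j=p..q. if j \<in> {k-r..k+r} then 3 * \<epsilon>' else 0) = (\<Sum>j\<in>{p..q} \<inter> {k-r..k+r}. 3 * \<epsilon>')"
      by (rule sum.inter_restrict[symmetric]) simp
    also have "\<dots> \<le> (\<Sum>j\<in>{k-r..k+r}. 3 * \<epsilon>')"
      using \<epsilon>' by (intro sum_mono2) auto
    also have "\<dots> = 3 * \<epsilon>' * K" using r1 by (simp add: K_def)
    also have "\<dots> = \<epsilon>" using K by (simp add: \<epsilon>'_def)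
    finally show ?thesis by simp
  qed
  with \<delta> that show ?thesis by blast
qed

text \<open>Between \<open>c\<close> and \<open>w - \<delta>\<close> the on-site energy has a
  positive minimum, so an energy bound limits the number of sites in that range, and among enough
  disjoint windows one avoids them. \<open>L\<close> depends on no sequence, so it can fix the
  distance of the transitions in advance.\<close>

lemma window_near_w:
  assumes c: "v < c" and \<delta>: "\<delta> > 0"
  obtains L :: int where "\<And>x m M. \<lbrakk>m + L \<le> M; \<And>i. m \<le> i \<Longrightarrow> i \<le> M \<Longrightarrow> c \<le> x i \<and> x i \<le> w;
      (\<Sum>j=m..M. f (x j)) \<le> C\<rbrakk>
    \<Longrightarrow> \<exists>k. m + \<rho> \<le> k \<and> k \<le> M - \<rho> \<and> (\<forall>i. \<bar>i - k\<bar> \<le> 2*r \<longrightarrow> \<bar>x i - w\<bar> \<le> \<delta>)"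
proof -
  have "\<exists>\<kappa>>0. \<forall>t. c \<le> t \<longrightarrow> t \<le> w - \<delta> \<longrightarrow> \<kappa> \<le> f t"
  proof (cases "c \<le> w - \<delta>")
    case True
    have "\<exists>t0\<in>{c..w-\<delta>}. \<forall>t\<in>{c..w-\<delta>}. f t0 \<le> f t"
      using True f_cont by (intro continuous_attains_inf) auto
    then obtain t0 where t0: "t0 \<in> {c..w-\<delta>}" "\<forall>t\<in>{c..w-\<delta>}. f t0 \<le> f t" by blast
    have "f t0 > 0" using t0(1) c \<delta> Hgt[of t0] by (simp add: f_def)
    then show ?thesis using t0(2) by auto
  next
    case False
    then show ?thesis by (intro exI[of _ 1]) auto
  qed
  then obtain \<kappa> where \<kappa>: "\<kappa> > 0" "\<And>t. c \<le> t \<Longrightarrow> t \<le> w - \<delta> \<Longrightarrow> \<kappa> \<le> f t" by blast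
  \<comment> \<open>If each of \<open>n\<close> disjoint windows of \<open>4*r + 1\<close> sites had
    a site far from \<open>w\<close>, the energy would exceed \<open>C\<close>. The length
    \<open>L\<close> below leaves room for these windows and the margin at both ends.\<close>
  obtain n :: nat where n: "C < real n * \<kappa>" using reals_Archimedean3[OF \<kappa>(1)] by blast
  define \<rho>' where "\<rho>' = max 0 \<rho>"
  define L where "L = 2 * \<rho>' + 4 * r + int n * (4 * r + 1)"
  have "\<exists>k. m + \<rho> \<le> k \<and> k \<le> M - \<rho> \<and> (\<forall>i. \<bar>i - k\<bar> \<le> 2*r \<longrightarrow> \<bar>x i - w\<bar> \<le> \<delta>)"
    if mM: "m + L \<le> M" and cx: "\<And>i. m \<le> i \<Longrightarrow> i \<le> M \<Longrightarrow> c \<le> x i \<and> x i \<le> w"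
      and sC: "(\<Sum>j=m..M. f (x j)) \<le> C" for x m M
  proof (rule ccontr)
    assume neg: "\<not> ?thesis"
    define z where "z = (\<lambda>k. m + \<rho>' + 2 * r + int k * (4 * r + 1))"
    have "\<exists>i. \<bar>i - z k\<bar> \<le> 2*r \<and> m \<le> i \<and> i \<le> M \<and> \<kappa> \<le> f (x i)" if k: "k < n" for k
    proof -
      have "0 \<le> int k * (4 * r + 1)" "int k * (4 * r + 1) \<le> int n * (4 * r + 1)"
        using k r1 by (auto intro!: mult_right_mono)
      then have z: "m + \<rho>' + 2 * r \<le> z k" "z k \<le> M - \<rho>' - 2 * r"
        using mM unfolding z_def L_def by linarith+
      then have "m + \<rho> \<le> z k \<and> z k \<le> M - \<rho>" using r1 unfolding \<rho>'_def by linarith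
      then obtain i where i: "\<bar>i - z k\<bar> \<le> 2*r" "\<not> \<bar>x i - w\<bar> \<le> \<delta>" using neg by blast
      have "0 \<le> \<rho>'" by (simp add: \<rho>'_def)
      then have mi: "m \<le> i" "i \<le> M" using z i(1) by linarith+
      then have "x i \<le> w - \<delta>" using cx[OF mi] i(2) by linarith
      then show ?thesis using \<kappa>(2)[of "x i"] cx[OF mi] mi i(1) by blast
    qed
    then obtain g where g: "\<And>k. k < n \<Longrightarrow> \<bar>g k - z k\<bar> \<le> 2*r \<and> m \<le> g k \<and> g k \<le> M \<and> \<kappa> \<le> f (x (g k))"
      by metis
    have "inj_on g {..<n}"
    proof (rule inj_onI)
      fix k l assume kl: "k \<in> {..<n}" "l \<in> {..<n}" "g k = g l"
      have "\<bar>z k - z l\<bar> \<le> 4 * r" using g[of k] g[of l] kl by auto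
      then have "\<bar>(int k - int l) * (4 * r + 1)\<bar> \<le> 4 * r" by (simp add: z_def algebra_simps)
      then have *: "\<bar>int k - int l\<bar> * (4 * r + 1) < 1 * (4 * r + 1)" using r1 by (simp add: abs_mult)
      have "\<bar>int k - int l\<bar> < 1" using mult_right_less_imp_less[OF *] r1 by simp
      then show "k = l" by simp
    qed
    then have "(\<Sum>j\<in>g ` {..<n}. f (x j)) = (\<Sum>k<n. f (x (g k)))" by (simp add: sum.reindex)
    moreover have "(\<Sum>k<n. f (x (g k))) \<ge> (\<Sum>k<n. \<kappa>)" using g by (intro sum_mono) auto
    moreover have "(\<Sum>j\<in>g ` {..<n}. f (x j)) \<le> (\<Sum>j=m..M. f (x j))"
      using g by (intro sum_mono2) (auto intro: f_nonneg)
    ultimately show False using sC n by simp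
  qed
  then show ?thesis using that by blast
qed

text \<open>Both ends approach the same equilibrium, so the tail estimate applies to the whole
  line.\<close>

lemma hasJ_homoclinic_ge:
  assumes \<theta>: "f \<theta> = 0" and x: "x \<in> \<Gamma> \<theta> \<theta>" and l: "hasJ x l"
  shows "(\<Sum>j=m..M. f (x j)) \<le> l"
proof (rule field_le_epsilon)
  fix \<epsilon> :: real assume e: "\<epsilon> > 0"
  then have e2: "\<epsilon> / 2 > 0" by simp
  obtain \<delta> where \<delta>: "\<delta> > 0" "\<And>p q x. \<lbrakk>p \<le> q; \<And>i. \<bar>i - p\<bar> \<le> 3*r \<Longrightarrow> \<bar>x i - \<theta>\<bar> \<le> \<delta>;
      \<And>i. \<bar>i - q\<bar> \<le> 3*r \<Longrightarrow> \<bar>x i - \<theta>\<bar> \<le> \<delta>\<rbrakk> \<Longrightarrow> (\<Sum>j\<in>{p+r<..<q-r}. f (x j)) \<le> J p q x + \<epsilon>/2"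
    using tail_energy_ge[OF \<theta> e2] by metis
  obtain P where P: "near \<theta> \<theta> \<delta> P x" using x \<delta>(1) unfolding \<Gamma>_def by blast
  obtain Q where Q: "\<forall>p\<le>-Q. \<forall>q\<ge>Q. \<bar>J p q x - l\<bar> \<le> \<epsilon>/2" using l e2 unfolding hasJ_def by blast
  define q where "q = max (P + 3 * r) (max Q (\<bar>m\<bar> + \<bar>M\<bar> + r + 1))"
  have q: "P + 3 * r \<le> q" "Q \<le> q" "\<bar>m\<bar> + \<bar>M\<bar> + r + 1 \<le> q" by (auto simp: q_def)
  have "(\<Sum>j=m..M. f (x j)) \<le> (\<Sum>j\<in>{-q+r<..<q-r}. f (x j))"
    using q by (intro sum_mono2) (auto intro: f_nonneg)
  also have "\<dots> \<le> J (-q) q x + \<epsilon>/2"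
    by (rule \<delta>(2)) (use P q r1 in \<open>auto simp: near_def\<close>)
  also have "\<dots> \<le> l + \<epsilon>" 
  proof -
    have "\<bar>J (-q) q x - l\<bar> \<le> \<epsilon>/2" using Q q(2) by simp
    then show ?thesis by linarith
  qed
  finally show "(\<Sum>j=m..M. f (x j)) \<le> l + \<epsilon>" .
qed

lemma lower_bound_homoclinic: "f \<theta> = 0 \<Longrightarrow> lower_bound \<theta> \<theta> 0"
  \<comment> \<open>The interval from \<open>1\<close> to \<open>0\<close> is empty, which makes the
    on-site sum zero.\<close>
  unfolding lower_bound_def using hasJ_homoclinic_ge[of \<theta> _ _ 1 0] by simp

section \<open>Translations, range of the derivative, constrained minimizers\<close>

lemma J_sh: "J p q (sh k x) = J (p + k) (q + k) x"
proof -
  have "J (p + k) (q + k) x = (\<Sum>j=p..q. e (j + k) x)"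
    unfolding J_def by (rule sum.reindex_bij_witness[of _ "\<lambda>j. j + k" "\<lambda>j. j - k"]) auto
  moreover have "e (j + k) x = e j (sh k x)" for j
    by (simp add: e_def sh_def ac_simps)
  ultimately show ?thesis by (simp add: J_def)
qed

lemma hasJ_sh: assumes "hasJ x l" shows "hasJ (sh k x) l"
  unfolding hasJ_def
proof (intro allI impI)
  fix \<epsilon> :: real assume "\<epsilon> > 0"
  then obtain P where P: "\<forall>p\<le>-P. \<forall>q\<ge>P. \<bar>J p q x - l\<bar> \<le> \<epsilon>" using assms unfolding hasJ_def by blast
  have "\<bar>J p q (sh k x) - l\<bar> \<le> \<epsilon>" if "p \<le> -(P + \<bar>k\<bar>)" "q \<ge> P + \<bar>k\<bar>" for p q
  proof -
    have "p + k \<le> -P" "P \<le> q + k" using that by linarith+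
    then show ?thesis using P by (simp add: J_sh)
  qed
  then show "\<exists>P. \<forall>p\<le>-P. \<forall>q\<ge>P. \<bar>J p q (sh k x) - l\<bar> \<le> \<epsilon>" by blast
qed

lemma \<Gamma>_sh: assumes "x \<in> \<Gamma> a b" shows "sh k x \<in> \<Gamma> a b"
proof -
  have "box (sh k x)" using assms by (simp add: \<Gamma>_def box_def sh_def)
  moreover have "\<exists>P. near a b \<delta> P (sh k x)" if "\<delta> > 0" for \<delta>
  proof -
    obtain P where "near a b \<delta> P x" using assms \<open>\<delta> > 0\<close> unfolding \<Gamma>_def by blast
    then have "near a b \<delta> (P + \<bar>k\<bar>) (sh k x)" by (auto simp: near_def sh_def)
    then show ?thesis ..
  qed
  ultimately show ?thesis by (simp add: \<Gamma>_def)
qed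

lemma argmin_sh: assumes "argmin (\<Gamma> a b) x" shows "argmin (\<Gamma> a b) (sh k x)"
  using assms hasJ_sh \<Gamma>_sh unfolding argmin_def by meson

text \<open>The terms that move with \<open>x p\<close> have index within \<open>r\<close> of
  \<open>p\<close> and read \<open>r\<close> sites further; uniqueness of derivatives does the
  rest.\<close>

lemma D_local: assumes "\<And>i. \<bar>i - p\<bar> \<le> 2 * r \<Longrightarrow> x i = y i" shows "D p x = D p y"
proof -
  have "(\<Sum>j=p-r..p+r. H (sh j (x(p := t)))) = (\<Sum>j=p-r..p+r. H (sh j (y(p := t))))" for t
    by (intro sum.cong refl H_local) (auto simp: sh_def intro!: assms)
  then show ?thesis
    using D_deriv[where p=p and x=x] D_deriv[where p=p and x=y] assms[of p] r1 by (simp add: DERIV_unique)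
qed

text \<open>Direct method: \<open>lo\<close> and \<open>hi\<close> supply compactness at infinity,
  and energies are bounded below by zero since both ends tend to the same equilibrium.\<close>

lemma exists_argmin:
  assumes \<theta>: "f \<theta> = 0" and lo: "lo \<in> \<Gamma> \<theta> \<theta>" and hi: "hi \<in> \<Gamma> \<theta> \<theta>"
    and K: "\<And>x i. x \<in> K \<Longrightarrow> lo i \<le> x i \<and> x i \<le> hi i"
    and closed: "\<And>X x. (\<And>n::nat. X n \<in> K) \<Longrightarrow> (\<And>i. (\<lambda>n. X n i) \<longlonglongrightarrow> x i) \<Longrightarrow> x \<in> K"
    and y: "y \<in> K" "hasJ y k"
  obtains x l where "argmin K x" "hasJ x l" "l \<le> k"
proof -
  define S where "S = {l. \<exists>x\<in>K. hasJ x l}"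
  have KG: "x \<in> \<Gamma> \<theta> \<theta>" if "x \<in> K" for x using \<Gamma>_squeeze[OF lo hi] K[OF that] by blast
  have "0 \<le> l" if "l \<in> S" for l
    using that KG lower_bound_homoclinic[OF \<theta>] unfolding S_def lower_bound_def by blast
  then have bdd: "bdd_below S" by (rule bdd_belowI)
  have kS: "k \<in> S" using y by (auto simp: S_def)
  have "\<exists>l x. x \<in> K \<and> hasJ x l \<and> l < Inf S + inverse (real (Suc n))" for n
  proof -
    have "Inf S < Inf S + inverse (real (Suc n))" by simp
    then obtain l where "l \<in> S" "l < Inf S + inverse (real (Suc n))"
      using cInf_lessD[of S "Inf S + inverse (real (Suc n))"] kS by blast
    then show ?thesis unfolding S_def by blast
  qed
  then obtain L X where X: "\<And>n. X n \<in> K" "\<And>n. hasJ (X n) (L n)" "\<And>n. L n < Inf S + inverse (real (Suc n))"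
    by metis
  have L: "L \<longlonglongrightarrow> Inf S"
  proof (rule tendsto_sandwich[of "\<lambda>_. Inf S"])
    show "(\<lambda>n. Inf S + inverse (real (Suc n))) \<longlonglongrightarrow> Inf S"
      using tendsto_add[OF tendsto_const[of "Inf S"] LIMSEQ_inverse_real_of_nat] by simp
    have "Inf S \<le> L n" for n using X bdd by (intro cInf_lower) (auto simp: S_def)
    then show "\<forall>\<^sub>F n in sequentially. Inf S \<le> L n" by simp
    show "\<forall>\<^sub>F n in sequentially. L n \<le> Inf S + inverse (real (Suc n))"
      using X(3) by (intro always_eventually) (simp add: less_imp_le)
  qed simp
  have "v \<le> X n i \<and> X n i \<le> w" for n i
    using KG[OF X(1)[of n]] by (simp add: \<Gamma>_def box_def)
  then obtain x \<sigma> where s: "strict_mono (\<sigma> :: nat \<Rightarrow> nat)" and x: "\<And>i. (\<lambda>n. X (\<sigma> n) i) \<longlonglongrightarrow> x i"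
    using bounded_sequences_subseq[of v X w] by metis
  have xK: "x \<in> K" by (rule closed[OF X(1) x])
  have "(\<lambda>n. L (\<sigma> n)) \<longlonglongrightarrow> Inf S" using LIMSEQ_subseq_LIMSEQ[OF L s] by (simp add: o_def)
  then obtain m where m: "hasJ x m" "m \<le> Inf S"
    using hasJ_limit[OF \<theta> \<theta> lo hi, of "\<lambda>n. X (\<sigma> n)" x "\<lambda>n. L (\<sigma> n)" "Inf S"] K[OF X(1)] x X(2) by metis
  have "m \<le> l" if "l \<in> S" for l using cInf_lower[OF that bdd] m(2) by simp
  then have "argmin K x" "m \<le> k" using xK m(1) kS unfolding argmin_def S_def by blast+
  then show ?thesis using that m(1) by blast
qed

section \<open>The homoclinic to the lower equilibrium\<close>

lemma exists_decreasing_const: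
  obtains c where "v < c" "c < w" "\<And>p. D p (\<lambda>_. c) < 0"
proof -
  define t where "t = (v + w) / 2"
  have t: "v < t" "t < w" using vw by (auto simp: t_def)
  \<comment> \<open>Along constants the energy drops from above \<open>c0\<close> at the midpoint to
    \<open>c0\<close> at \<open>w\<close>, so its derivative is negative somewhere between.\<close>
  obtain z where z: "t < z" "z < w" "H (\<lambda>_. w) - H (\<lambda>_. t) = (w - t) * D 0 (\<lambda>_. z)"
    using MVT2[OF t(2), of "\<lambda>t. H (\<lambda>_. t)" "\<lambda>c. D 0 (\<lambda>_. c)"] D_const by blast
  have "(w - t) * D 0 (\<lambda>_. z) < 0" using z(3) Hgt[OF t] Hw by simp
  then have "D 0 (\<lambda>_. z) < 0" using t by (simp add: mult_less_0_iff)
  moreover have "D p (\<lambda>_. z) = D 0 (\<lambda>_. z)" for p using DERIV_unique[OF D_const D_const] .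
  ultimately have "D p (\<lambda>_. z) < 0" for p by metis
  then show ?thesis using that[of z] z(1,2) t(1) by (meson less_trans)
qed

text \<open>The homoclinic minimizes the energy below \<open>min y1 y2\<close> (with \<open>y2\<close> shifted far to the right)
  subject to \<open>u\<close> lying beyond the midpoint of the gaps at both transitions and above a level \<open>c\<close> with
  \<open>D p c < 0\<close> in between.  Cutting \<open>u\<close> where it is close to \<open>w\<close> yields almost minimal heteroclinics, so
  by stability of the gaps no constraint is active near the transitions; the level \<open>c\<close> cannot be touched
  because of \<open>D p c < 0\<close>, and the other barriers are equilibria.\<close>

theorem exists_homoclinic:
  assumes up: "gap_pair v w x1 y1" and down: "gap_pair w v x2 y2"
  shows "\<exists>u\<in>\<Gamma> v v. (\<forall>p. D p u = 0) \<and> u \<noteq> (\<lambda>_. v)"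
proof -
  obtain c where c: "v < c" "c < w" "\<And>p. D p (\<lambda>_. c) < 0" using exists_decreasing_const by blast
  obtain c1 where x1: "x1 \<in> \<Gamma> v w" and y1: "y1 \<in> \<Gamma> v w" and x1J: "hasJ x1 c1" and y1J: "hasJ y1 c1"
    and lb1: "lower_bound v w c1" using gap_pairE[OF up] .
  obtain c2 where x2: "x2 \<in> \<Gamma> w v" and y2: "y2 \<in> \<Gamma> w v" and x2J: "hasJ x2 c2" and y2J: "hasJ y2 c2"
    and lb2: "lower_bound w v c2" using gap_pairE[OF down] .
  have xy1: "x1 i < y1 i" and xy2: "x2 i < y2 i" for i using up down by (auto simp: gap_pair_def)
  have bx1: "v \<le> x1 i" and by1: "v \<le> y1 i" "y1 i \<le> w" and bx2: "v \<le> x2 i" and by2: "v \<le> y2 i" "y2 i \<le> w" for i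
    using x1 y1 x2 y2 by (auto simp: \<Gamma>_def box_def)
  have \<delta>c: "(w - c) / 2 > 0" using c by simp
  \<comment> \<open>From \<open>m\<close> on, both bounding heteroclinics of the ascending gap lie
    above \<open>c\<close>; so do those of the descending gap up to \<open>-m\<close>.\<close>
  obtain m where m: "0 \<le> m" "\<And>i. m \<le> i \<Longrightarrow> c < x1 i" "\<And>i. i \<le> -m \<Longrightarrow> c < x2 i"
  proof -
    obtain P where P: "near v w ((w - c)/2) P x1" using x1 \<delta>c unfolding \<Gamma>_def by blast
    obtain Q where Q: "near w v ((w - c)/2) Q x2" using x2 \<delta>c unfolding \<Gamma>_def by blast
    have "c < x1 i" if "max P Q \<le> i" for i
    proof -
      have *: "\<bar>x1 i - w\<bar> \<le> (w - c)/2" using P that by (simp add: near_def)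
      show ?thesis using near_half_gt[OF * c(2)] .
    qed
    moreover have "c < x2 i" if "i \<le> - max P Q" for i
    proof -
      have "i \<le> -Q" using that by simp
      then have *: "\<bar>x2 i - w\<bar> \<le> (w - c)/2" using Q by (simp add: near_def)
      show ?thesis using near_half_gt[OF * c(2)] .
    qed
    moreover have "0 \<le> max P Q" using P by (auto simp: near_def)
    ultimately show ?thesis using that by blast
  qed
  define g1 where "g1 = (x1 0 + y1 0) / 2"
  define g2 where "g2 = (x2 0 + y2 0) / 2"
  have g: "x1 0 < g1" "g1 < y1 0" "x2 0 < g2" "g2 < y2 0" using xy1[of 0] xy2[of 0] by (auto simp: g1_def g2_def)
  obtain \<eta>1 where \<eta>1: "\<eta>1 > 0" "\<And>u l i. \<lbrakk>u \<in> \<Gamma> v w; hasJ u l; l \<le> c1 + \<eta>1; g1 \<le> u 0; i \<in> {0} \<union> {m..m+2*r}\<rbrakk>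
      \<Longrightarrow> (x1 i + y1 i) / 2 < u i"
    using gap_pair_stable_finite[OF fv fw up x1J g(1), of "{0} \<union> {m..m+2*r}"] by (metis finite.emptyI finite_UnI finite_atLeastAtMost_int finite_insert)
  obtain \<eta>2 where \<eta>2: "\<eta>2 > 0" "\<And>u l i. \<lbrakk>u \<in> \<Gamma> w v; hasJ u l; l \<le> c2 + \<eta>2; g2 \<le> u 0; i \<in> {0} \<union> {-m-2*r..-m}\<rbrakk>
      \<Longrightarrow> (x2 i + y2 i) / 2 < u i"
    using gap_pair_stable_finite[OF fw fv down x2J g(3), of "{0} \<union> {-m-2*r..-m}"] by (metis finite.emptyI finite_UnI finite_atLeastAtMost_int finite_insert)
  define \<eta> where "\<eta> = min \<eta>1 \<eta>2"
  have \<eta>: "\<eta> > 0" using \<eta>1 \<eta>2 by (simp add: \<eta>_def)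
  obtain \<delta> where \<delta>: "\<delta> > 0" "\<And>x k p q. (\<And>i. \<bar>i - k\<bar> \<le> 2*r \<Longrightarrow> \<bar>x i - w\<bar> \<le> \<delta>) \<Longrightarrow>
      J p q (cutL k x) + J p q (cutR k x) \<le> J p q x + \<eta>"
    using J_cut[OF \<eta>] by metis
  obtain L where L: "\<And>x m M. \<lbrakk>m + L \<le> M; \<And>i. m \<le> i \<Longrightarrow> i \<le> M \<Longrightarrow> c \<le> x i \<and> x i \<le> w;
      (\<Sum>j=m..M. f (x j)) \<le> c1 + c2\<rbrakk>
    \<Longrightarrow> \<exists>k. m + (2*r+1) \<le> k \<and> k \<le> M - (2*r+1) \<and> (\<forall>i. \<bar>i - k\<bar> \<le> 2*r \<longrightarrow> \<bar>x i - w\<bar> \<le> \<delta>)"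
    using window_near_w[OF c(1) \<delta>(1)] by metis
  \<comment> \<open>Large enough for a stretch near \<open>w\<close> to fit between the transitions,
    and for each heteroclinic to exceed the level required at the other's transition, which makes
    their minimum admissible.\<close>
  obtain N where N: "0 < N" "m + L \<le> N - m" "g2 < y1 N" "g1 < y2 (-N)"
  proof -
    have g1w: "(w - g1) / 2 > 0" and g2w: "(w - g2) / 2 > 0" using g by1[of 0] by2[of 0] by auto
    obtain P where P: "near v w ((w - g2)/2) P y1" using y1 g2w unfolding \<Gamma>_def by blast
    obtain Q where Q: "near w v ((w - g1)/2) Q y2" using y2 g1w unfolding \<Gamma>_def by blast
    define N where "N = max (max P Q) (max 1 (2 * m + L))"
    have N: "P \<le> N" "Q \<le> N" "1 \<le> N" "2 * m + L \<le> N" by (auto simp: N_def)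
    have *: "\<bar>y1 N - w\<bar> \<le> (w - g2)/2" "\<bar>y2 (-N) - w\<bar> \<le> (w - g1)/2" using P Q N by (auto simp: near_def)
    have "g2 < y1 N" using near_half_gt[OF *(1)] g2w by simp
    moreover have "g1 < y2 (-N)" using near_half_gt[OF *(2)] g1w by simp
    ultimately have "g2 < y1 N" "g1 < y2 (-N)" .
    then show ?thesis using that[of N] N by auto
  qed
  define z2 where "z2 = sh (-N) y2"
  have z2: "z2 \<in> \<Gamma> w v" and z2J: "hasJ z2 c2" unfolding z2_def by (intro \<Gamma>_sh hasJ_sh y2 y2J)+
  have bz2: "v \<le> z2 i" "z2 i \<le> w" for i using by2 by (auto simp: z2_def sh_def)
  \<comment> \<open>Upper barrier and competitor at once; being a minimum of two stationary
    sequences, it can be touched only where one of them is.\<close>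
  define b where "b = mn y1 z2"
  have near_y1_z2: "\<exists>P. near v w d P y1 \<and> near w v d P z2" if "d > 0" for d
  proof -
    obtain P where "near v w d P y1" using y1 \<open>d > 0\<close> unfolding \<Gamma>_def by blast
    moreover obtain Q where "near w v d Q z2" using z2 \<open>d > 0\<close> unfolding \<Gamma>_def by blast
    ultimately show ?thesis
      using near_mono[of v w d P y1 "max P Q"] near_mono[of w v d Q z2 "max P Q"] by auto
  qed
  have bG: "b \<in> \<Gamma> v v"
  proof -
    have "box b" using by1 bz2 by (auto simp: box_def b_def min_def)
    moreover have "\<exists>P. near v v d P b" if "d > 0" for d
    proof -
      obtain P where P: "near v w d P y1" "near w v d P z2" using near_y1_z2[OF \<open>d > 0\<close>] by blast
      have *: "\<bar>b i - v\<bar> \<le> d" if "\<bar>y1 i - v\<bar> \<le> d \<or> \<bar>z2 i - v\<bar> \<le> d" for i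
        using that by1(1)[of i] bz2(1)[of i] by (auto simp: b_def)
      show ?thesis using P * by (intro exI[of _ P]) (auto simp: near_def)
    qed
    ultimately show ?thesis by (simp add: \<Gamma>_def)
  qed
  have mxG: "mx y1 z2 \<in> \<Gamma> w w"
  proof -
    have "box (mx y1 z2)" using by1 bz2 by (auto simp: box_def max_def)
    moreover have "\<exists>P. near w w d P (mx y1 z2)" if "d > 0" for d
    proof -
      obtain P where P: "near v w d P y1" "near w v d P z2" using near_y1_z2[OF \<open>d > 0\<close>] by blast
      have *: "\<bar>max (y1 i) (z2 i) - w\<bar> \<le> d" if "\<bar>y1 i - w\<bar> \<le> d \<or> \<bar>z2 i - w\<bar> \<le> d" for i
        using that by1(2)[of i] bz2(2)[of i] by auto
      show ?thesis using P * by (intro exI[of _ P]) (auto simp: near_def)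
    qed
    ultimately show ?thesis by (simp add: \<Gamma>_def)
  qed
  \<comment> \<open>The complementary maximum tends to \<open>w\<close> at both ends and has
    nonnegative energy, so the minimum keeps at most \<open>c1 + c2\<close>.\<close>
  obtain lb where lb: "hasJ b lb" "lb \<le> c1 + c2"
  proof -
    have "\<exists>P. \<forall>p\<le>-P. \<forall>q\<ge>P. J p q b + J p q (mx y1 z2) \<le> (c1 + c2) + \<epsilon>" if "\<epsilon> > 0" for \<epsilon>
    proof -
      have "J p q b + J p q (mx y1 z2) \<le> J p q y1 + J p q z2" for p q
        using J_submodular[of p q y1 z2] by (simp add: b_def)
      then show ?thesis using hasJ_add[OF y1J z2J that] by (meson order_trans)
    qed
    then show ?thesis
      using hasJ_if_sum_le[OF fv fv bG fw fw mxG lower_bound_homoclinic[OF fw]] that by (metis diff_zero)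
  qed
  define K where "K = {u. (\<forall>i. v \<le> u i \<and> u i \<le> b i) \<and> g1 \<le> u 0 \<and> g2 \<le> u N \<and> (\<forall>i\<in>{m..N-m}. c \<le> u i)}"
  have bK: "b \<in> K"
  proof -
    have "c \<le> b i" if "i \<in> {m..N-m}" for i
      using m(2)[of i] m(3)[of "i - N"] xy1[of i] xy2[of "i - N"] that by (auto simp: b_def z2_def sh_def)
    moreover have "v \<le> b i" for i using by1 bz2 by (simp add: b_def)
    ultimately show ?thesis
      using g N by (auto simp: K_def b_def z2_def sh_def)
  qed
  have v\<Gamma>: "(\<lambda>_. v) \<in> \<Gamma> v v" using vw by (auto simp: \<Gamma>_def box_def near_def)
  have Kb: "v \<le> u i \<and> u i \<le> b i" if "u \<in> K" for u i using that by (simp add: K_def)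
  have closed: "x \<in> K" if X: "\<And>n::nat. X n \<in> K" and x: "\<And>i. (\<lambda>n. X n i) \<longlonglongrightarrow> x i" for X x
  proof -
    have "v \<le> x i" "x i \<le> b i" for i
      using x[of i] Kb[OF X] by (auto intro: LIMSEQ_le_const LIMSEQ_le_const2)
    moreover have "g1 \<le> x 0" "g2 \<le> x N" using X by (auto intro!: LIMSEQ_le_const[OF x] simp: K_def)
    moreover have "c \<le> x i" if "i \<in> {m..N-m}" for i
      using X that by (intro LIMSEQ_le_const[OF x]) (auto simp: K_def)
    ultimately show ?thesis by (auto simp: K_def)
  qed
  obtain u l where u: "argmin K u" and uJ: "hasJ u l" and l: "l \<le> c1 + c2"
  proof -
    obtain u l where "argmin K u" "hasJ u l" "l \<le> lb"
    proof (rule exists_argmin[OF fv v\<Gamma> bG, of K b lb])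
      show "x \<in> K" if "\<And>n::nat. X n \<in> K" "\<And>i. (\<lambda>n. X n i) \<longlonglongrightarrow> x i" for X x
        using that by (rule closed)
    qed (use Kb bK lb(1) in auto)
    then show ?thesis using that lb(2) by (meson order_trans)
  qed
  have uK: "u \<in> K" using u by (simp add: argmin_def)
  have uv: "v \<le> u i" and uy1: "u i \<le> y1 i" and uz2: "u i \<le> z2 i" for i
    using Kb[OF uK, of i] by (auto simp: b_def)
  have uw: "u i \<le> w" for i using uy1[of i] by1(2)[of i] by simp
  have uG: "u \<in> \<Gamma> v v" using \<Gamma>_squeeze[OF v\<Gamma> bG] Kb[OF uK] by blast
  have ug: "g1 \<le> u 0" "g2 \<le> u N" and uc: "\<And>i. i \<in> {m..N-m} \<Longrightarrow> c \<le> u i" using uK by (auto simp: K_def)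
  \<comment> \<open>The energy of \<open>u\<close> bounds its on-site energies between the
    transitions, which forces a stretch near \<open>w\<close> where it can be cut.\<close>
  have "(\<Sum>j=m..N-m. f (u j)) \<le> c1 + c2" using hasJ_homoclinic_ge[OF fv uG uJ, of m "N-m"] l by simp
  then obtain k where k: "m + (2*r+1) \<le> k" "k \<le> N - m - (2*r+1)" "\<And>i. \<bar>i - k\<bar> \<le> 2*r \<Longrightarrow> \<bar>u i - w\<bar> \<le> \<delta>"
    using L[of m "N - m" u] N(2) uc uw by auto
  have cutLG: "cutL k u \<in> \<Gamma> v w"
  proof -
    have "box (cutL k u)" using uv uw vw by (auto simp: box_def cutL_def)
    moreover have "\<exists>P. near v w d P (cutL k u)" if "d > 0" for d
    proof -
      obtain P where "near v v d P u" using uG \<open>d > 0\<close> unfolding \<Gamma>_def by blast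
      then have "near v w d (max P (k + 1)) (cutL k u)" using m(1) k(1) r1 \<open>d > 0\<close> by (auto simp: near_def cutL_def)
      then show ?thesis ..
    qed
    ultimately show ?thesis by (simp add: \<Gamma>_def)
  qed
  have cutRG: "cutR k u \<in> \<Gamma> w v"
  proof -
    have "box (cutR k u)" using uv uw vw by (auto simp: box_def cutR_def)
    moreover have "\<exists>P. near w v d P (cutR k u)" if "d > 0" for d
    proof -
      obtain P where "near v v d P u" using uG \<open>d > 0\<close> unfolding \<Gamma>_def by blast
      then have "near w v d (max P (k + 1)) (cutR k u)" using m(1) k(1) r1 \<open>d > 0\<close> by (auto simp: near_def cutR_def)
      then show ?thesis ..
    qed
    ultimately show ?thesis by (simp add: \<Gamma>_def)
  qed
  have cut: "\<exists>P. \<forall>p\<le>-P. \<forall>q\<ge>P. J p q (cutL k u) + J p q (cutR k u) \<le> (c1 + c2 + \<eta>) + \<epsilon>" if "\<epsilon> > 0" for \<epsilon>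
  proof -
    obtain P where P: "\<forall>p\<le>-P. \<forall>q\<ge>P. \<bar>J p q u - l\<bar> \<le> \<epsilon>" using uJ \<open>\<epsilon> > 0\<close> unfolding hasJ_def by blast
    have "J p q (cutL k u) + J p q (cutR k u) \<le> (c1 + c2 + \<eta>) + \<epsilon>" if "p \<le> -P" "q \<ge> P" for p q
    proof -
      have "\<bar>J p q u - l\<bar> \<le> \<epsilon>" using P that by blast
      moreover have "J p q (cutL k u) + J p q (cutR k u) \<le> J p q u + \<eta>" by (rule \<delta>(2)[OF k(3)])
      ultimately show ?thesis using l by linarith
    qed
    then show ?thesis by blast
  qed
  have cut': "\<exists>P. \<forall>p\<le>-P. \<forall>q\<ge>P. J p q (cutR k u) + J p q (cutL k u) \<le> (c1 + c2 + \<eta>) + \<epsilon>" if "\<epsilon> > 0" for \<epsilon>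
    using cut[OF that] by (simp add: add.commute)
  \<comment> \<open>The right half costs at least \<open>c2\<close>, which leaves the left half
    within \<eta> of the minimum \<open>c1\<close>.\<close>
  obtain l1 where l1: "hasJ (cutL k u) l1" "l1 \<le> c1 + c2 + \<eta> - c2"
    using hasJ_if_sum_le[OF fv fw cutLG fw fv cutRG lb2 cut] .
  obtain l2 where l2: "hasJ (cutR k u) l2" "l2 \<le> c1 + c2 + \<eta> - c1"
    using hasJ_if_sum_le[OF fw fv cutRG fv fw cutLG lb1 cut'] .
  have k0: "0 \<le> k" "k < N" using k m(1) r1 by linarith+
  \<comment> \<open>Left of the cut \<open>u\<close> coincides with an almost minimal heteroclinic.
    Stability makes the constraint at \<open>0\<close> strict and, as the midpoints exceed
    \<open>c\<close> from \<open>m\<close> on, lifts \<open>u\<close> above \<open>c\<close> near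
    \<open>m\<close>.\<close>
  have left: "(x1 i + y1 i) / 2 < u i" if i: "i \<in> {0} \<union> {m..m+2*r}" for i
  proof -
    have "i \<le> k" using i k(1) k0 by auto
    moreover have "(x1 i + y1 i) / 2 < cutL k u i"
    proof (rule \<eta>1(2)[OF cutLG l1(1) _ _ i])
      show "l1 \<le> c1 + \<eta>1" using l1(2) by (simp add: \<eta>_def)
      show "g1 \<le> cutL k u 0" using ug k0 by (simp add: cutL_def)
    qed
    ultimately show ?thesis by (simp add: cutL_def)
  qed
  have right: "(x2 i + y2 i) / 2 < u (i + N)" if i: "i \<in> {0} \<union> {-m-2*r..-m}" for i
  proof -
    have "k < i + N" using i k(2) k0 by auto
    moreover have "(x2 i + y2 i) / 2 < sh N (cutR k u) i"
    proof (rule \<eta>2(2)[OF \<Gamma>_sh[OF cutRG] hasJ_sh[OF l2(1)] _ _ i])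
      show "l2 \<le> c2 + \<eta>2" using l2(2) by (simp add: \<eta>_def)
      show "g2 \<le> sh N (cutR k u) 0" using ug k0 by (simp add: cutR_def sh_def)
    qed
    ultimately show ?thesis by (simp add: cutR_def sh_def)
  qed
  have upd: "u(p := t) \<in> K"
    if "v \<le> t" "t \<le> b p" "p = 0 \<Longrightarrow> g1 \<le> t" "p = N \<Longrightarrow> g2 \<le> t" "p \<in> {m..N-m} \<Longrightarrow> c \<le> t" for p t
    using uK that unfolding K_def by auto
  have "D p u = 0" for p
  proof (rule antisym)
    have Dy1: "D p y1 = 0" using up argmin_\<Gamma>_D_zero unfolding gap_pair_def by blast
    have Dz2: "D p z2 = 0"
      using down argmin_\<Gamma>_D_zero[OF argmin_sh] unfolding gap_pair_def z2_def by blast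
    show "0 \<le> D p u"
    proof (cases "u p < b p")
      case True
      show ?thesis
      proof (rule argmin_D_nonneg[OF u True])
        fix t assume t: "u p < t" "t < b p"
        show "u(p := t) \<in> K"
        proof (rule upd)
          show "v \<le> t" using t uv[of p] by simp
          show "c \<le> t" if "p \<in> {m..N-m}" using t uc[OF that] by simp
        qed (use t ug in auto)
      qed
    next
      case False
      \<comment> \<open>A contact with \<open>b\<close> is a contact with a stationary sequence
        above \<open>u\<close>, and order reversal of \<open>D\<close> gives the inequality.\<close>
      then consider "u p = y1 p" | "u p = z2 p" using uy1[of p] uz2[of p] by (auto simp: b_def min_def split: if_splits)
      then show ?thesis
      proof cases
        case 1 
        have "D p y1 \<le> D p u" by (intro D_antimono uy1 1)
        then show ?thesis using Dy1 by simp
      next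
        case 2
        have "D p z2 \<le> D p u" by (intro D_antimono uz2 2)
        then show ?thesis using Dz2 by simp
      qed
    qed
    show "D p u \<le> 0"
    proof (cases "u p = v")
      case True
      then have "D p u \<le> D p (\<lambda>_. v)" by (intro D_antimono uv) simp
      then show ?thesis by (simp add: D_const_zero[OF fv])
    next
      case False
      then have vu: "v < u p" using uv[of p] by simp
      show ?thesis
      proof (cases "p \<in> {m..N-m} \<and> u p = c")
        case True
        have far: "m + 2 * r < p \<and> p < N - m - 2 * r"
        proof (rule ccontr)
          assume "\<not> ?thesis"
          then have "p \<in> {m..m+2*r} \<or> p - N \<in> {-m-2*r..-m}" using True by auto
          then have "c < u p"
          proof
            assume p: "p \<in> {m..m+2*r}"
            then have "(x1 p + y1 p) / 2 < u p" by (intro left) simp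
            then show ?thesis using m(2)[of p] xy1[of p] p by simp
          next
            assume p: "p - N \<in> {-m-2*r..-m}"
            then have "(x2 (p-N) + y2 (p-N)) / 2 < u (p - N + N)" by (intro right) simp
            then show ?thesis using m(3)[of "p-N"] xy2[of "p-N"] p by simp
          qed
          then show False using True by simp
        qed
        \<comment> \<open>Within \<open>2*r\<close> of \<open>p\<close> this is \<open>u\<close>, so
          \<open>D p\<close> does not notice the change; globally it lies above the constant
          \<open>c\<close> and can be compared with it.\<close>
        define y where "y = (\<lambda>i. max c (u i))"
        have "D p u = D p y"
        proof (rule D_local)
          fix i assume "\<bar>i - p\<bar> \<le> 2 * r"
          then have "i \<in> {m..N-m}" using far by auto
          then show "u i = y i" using uc by (simp add: y_def)
        qed
        also have "\<dots> \<le> D p (\<lambda>_. c)" by (rule D_antimono) (use True in \<open>auto simp: y_def\<close>)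
        also have "\<dots> < 0" by (rule c(3))
        finally show ?thesis by simp
      next
        case notc: False
        \<comment> \<open>The largest lower bound in force at \<open>p\<close>, with
          \<open>v\<close> as neutral value where a constraint is absent. All of them are strict in
          this case, so \<open>u p\<close> may be lowered.\<close>
        define d where "d = max (max v (if p = 0 then g1 else v))
          (max (if p = N then g2 else v) (if p \<in> {m..N-m} then c else v))"
        have g10: "g1 < u 0" using left[of 0] by (simp add: g1_def)
        have g2N: "g2 < u N" using right[of 0] by (simp add: g2_def)
        have "d < u p" using vu g10 g2N notc uc[of p] by (auto simp: d_def less_le)
        show ?thesis
        proof (rule argmin_D_nonpos[OF u \<open>d < u p\<close>])
          fix t assume t: "d < t" "t < u p"
          then have tv: "v \<le> t" "p = 0 \<Longrightarrow> g1 \<le> t" "p = N \<Longrightarrow> g2 \<le> t" "p \<in> {m..N-m} \<Longrightarrow> c \<le> t"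
            by (auto simp: d_def split: if_splits)
          have "t \<le> b p" using t(2) Kb[OF uK, of p] by simp
          then show "u(p := t) \<in> K" by (intro upd tv)
        qed
      qed
    qed
  qed
  moreover have "u \<noteq> (\<lambda>_. v)" using ug(1) g(1) bx1[of 0] by auto
  ultimately show ?thesis using uG by blast
qed


section \<open>Reflection of the values\<close>

text \<open>Negation exchanges maxima with minima and the two equilibria. It reverses the order of
  the arguments and the sign of \<open>D\<close>, so order reversal of the derivative is
  preserved.\<close>

lemma negated: "sequence_energy r (\<lambda>x. H (\<lambda>i. - x i)) (\<lambda>p x. - D p (\<lambda>i. - x i)) (- w) (- v) c0"
proof
  show "1 \<le> r" by (rule r1)
  show "H (\<lambda>i. - x i) = H (\<lambda>i. - y i)" if "\<And>i. \<bar>i\<bar> \<le> r \<Longrightarrow> x i = y i" for x y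
    using that by (intro H_local) simp
  show "(\<lambda>n. H (\<lambda>i. - X n i)) \<longlonglongrightarrow> H (\<lambda>i. - x i)" if "\<And>i. (\<lambda>n. X n i) \<longlonglongrightarrow> x i" for X x
    using that by (intro H_tendsto tendsto_minus)
  show "H (\<lambda>i. - max (x i) (y i)) + H (\<lambda>i. - min (x i) (y i)) \<le> H (\<lambda>i. - x i) + H (\<lambda>i. - y i)" for x y
    using H_submodular[of "\<lambda>i. - x i" "\<lambda>i. - y i"] by (simp add: minus_max_eq_min minus_min_eq_max)
  show "((\<lambda>t. \<Sum>j=p-r..p+r. H (\<lambda>i. - sh j (x(p := t)) i)) has_real_derivative - D p (\<lambda>i. - x i)) (at (x p))" for p x
  proof -
    have "((\<lambda>t. \<Sum>j=p-r..p+r. H (sh j ((\<lambda>i. - x i)(p := t)))) has_real_derivative D p (\<lambda>i. - x i)) (at (- x p))"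
      using D_deriv[where p=p and x="\<lambda>i. - x i"] by simp
    then have "((\<lambda>t. \<Sum>j=p-r..p+r. H (sh j ((\<lambda>i. - x i)(p := - t)))) has_real_derivative D p (\<lambda>i. - x i) * (- 1)) (at (x p))"
      by (rule DERIV_chain2) (auto intro!: derivative_eq_intros)
    moreover have "sh j ((\<lambda>i. - x i)(p := - t)) = (\<lambda>i. - sh j (x(p := t)) i)" for j t
      by (auto simp: sh_def)
    ultimately show ?thesis by simp
  qed
  show "((\<lambda>t. H (\<lambda>_. - t)) has_real_derivative - D p (\<lambda>_. - c)) (at c)" for p c
  proof -
    have "((\<lambda>t. H (\<lambda>_. - t)) has_real_derivative D p (\<lambda>_. - c) * (- 1)) (at c)"
      by (rule DERIV_chain2[OF D_const]) (auto intro!: derivative_eq_intros)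
    then show ?thesis by simp
  qed
  show "- D p (\<lambda>i. - y i) \<le> - D p (\<lambda>i. - x i)" if "\<And>i. x i \<le> y i" "x p = y p" for p x y
    using D_antimono[of "\<lambda>i. - y i" "\<lambda>i. - x i" p] that by simp
  show "x (p - 1) = y (p - 1) \<and> x (p + 1) = y (p + 1)"
    if "\<And>i. x i \<le> y i" "x p = y p" "- D p (\<lambda>i. - x i) = - D p (\<lambda>i. - y i)" for p x y
    using D_strict[of "\<lambda>i. - y i" "\<lambda>i. - x i" p] that by simp
  show "- w < - v" using vw by simp
  show "H (\<lambda>_. - (- w)) = c0" "H (\<lambda>_. - (- v)) = c0" using Hv Hw by auto
  show "c0 \<le> H (\<lambda>_. - t)" for t by (rule Hge)
  show "c0 < H (\<lambda>_. - t)" if "- w < t" "t < - v" for t using that by (intro Hgt) auto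
qed

theorem exists_homoclinic_above:
  assumes up: "gap_pair v w x1 y1" and down: "gap_pair w v x2 y2"
  shows "\<exists>u\<in>\<Gamma> w w. (\<forall>p. D p u = 0) \<and> u \<noteq> (\<lambda>_. w)"
proof -
  interpret neg: sequence_energy r "\<lambda>x. H (\<lambda>i. - x i)" "\<lambda>p x. - D p (\<lambda>i. - x i)" "- w" "- v" c0 by (rule negated)
  have e: "neg.e j x = e j (\<lambda>i. - x i)" for j x by (simp add: neg.e_def e_def sh_def)
  have J: "neg.hasJ x l \<longleftrightarrow> hasJ (\<lambda>i. - x i) l" for x l
    by (simp add: neg.hasJ_def hasJ_def neg.J_def J_def e)
  have abs_neg: "\<bar>- s - t\<bar> = \<bar>s - (- t)\<bar>" for s t :: real by simp
  have near: "near a b \<delta> P (\<lambda>i. - x i) \<longleftrightarrow> neg.near (- a) (- b) \<delta> P x" for a b \<delta> P x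
    by (simp add: neg.near_def near_def abs_neg)
  have box: "box (\<lambda>i. - x i) \<longleftrightarrow> neg.box x" for x
    unfolding neg.box_def box_def by (metis minus_le_iff le_minus_iff)
  have \<Gamma>: "(\<lambda>i. - x i) \<in> \<Gamma> a b \<longleftrightarrow> x \<in> neg.\<Gamma> (- a) (- b)" for x a b
    by (simp add: \<Gamma>_def neg.\<Gamma>_def near box)
  have \<Gamma>': "(\<lambda>i. - x i) \<in> neg.\<Gamma> (- a) (- b) \<longleftrightarrow> x \<in> \<Gamma> a b" for x a b
    using \<Gamma>[of "\<lambda>i. - x i" a b] by simp
  have argmin: "neg.argmin (neg.\<Gamma> (- a) (- b)) x \<longleftrightarrow> argmin (\<Gamma> a b) (\<lambda>i. - x i)" for a b x
  proof -
    have "(\<forall>y\<in>neg.\<Gamma> (- a) (- b). \<forall>l'. hasJ (\<lambda>i. - y i) l' \<longrightarrow> l \<le> l') \<longleftrightarrow> (\<forall>y\<in>\<Gamma> a b. \<forall>l'. hasJ y l' \<longrightarrow> l \<le> l')" for l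
    proof
      assume *: "\<forall>y\<in>neg.\<Gamma> (- a) (- b). \<forall>l'. hasJ (\<lambda>i. - y i) l' \<longrightarrow> l \<le> l'"
      show "\<forall>y\<in>\<Gamma> a b. \<forall>l'. hasJ y l' \<longrightarrow> l \<le> l'"
      proof (intro ballI allI impI)
        fix y l' assume "y \<in> \<Gamma> a b" "hasJ y l'"
        then show "l \<le> l'" using *[rule_format, of "\<lambda>i. - y i" l'] by (simp add: \<Gamma>')
      qed
    next
      assume "\<forall>y\<in>\<Gamma> a b. \<forall>l'. hasJ y l' \<longrightarrow> l \<le> l'"
      then show "\<forall>y\<in>neg.\<Gamma> (- a) (- b). \<forall>l'. hasJ (\<lambda>i. - y i) l' \<longrightarrow> l \<le> l'" using \<Gamma> by blast
    qed
    then show ?thesis by (simp add: neg.argmin_def argmin_def J \<Gamma>)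
  qed
  have gap: "neg.gap_pair (- a) (- b) (\<lambda>i. - y i) (\<lambda>i. - x i)" if g: "gap_pair a b x y" for a b x y
    unfolding neg.gap_pair_def
  proof (intro conjI)
    show "\<not> (\<exists>z. neg.argmin (neg.\<Gamma> (- a) (- b)) z \<and> (\<forall>i. - y i < z i \<and> z i < - x i))"
    proof
      assume "\<exists>z. neg.argmin (neg.\<Gamma> (- a) (- b)) z \<and> (\<forall>i. - y i < z i \<and> z i < - x i)"
      then obtain z where z: "argmin (\<Gamma> a b) (\<lambda>i. - z i)" "\<And>i. - y i < z i \<and> z i < - x i"
        by (auto simp: argmin)
      have "x i < - z i \<and> - z i < y i" for i using z(2)[of i] by auto
      then show False using g z(1) unfolding gap_pair_def by blast
    qed
  qed (use g in \<open>auto simp: argmin gap_pair_def\<close>)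
  \<comment> \<open>Descending heteroclinics become ascending ones, so the two gaps trade
    roles.\<close>
  obtain u where u: "u \<in> neg.\<Gamma> (- w) (- w)" "\<And>p. D p (\<lambda>i. - u i) = 0" "u \<noteq> (\<lambda>_. - w)"
    using neg.exists_homoclinic[OF gap[OF down] gap[OF up]] by auto
  have "(\<lambda>i. - u i) \<noteq> (\<lambda>_. w)" using u(3) by (metis minus_minus)
  then show ?thesis using u \<Gamma> by blast
qed

end

section \<open>Calculus in finitely many coordinates\<close>

lemma tendsto_fun_componentwise:
  fixes g :: "'b \<Rightarrow> 'a \<Rightarrow> 'c::topological_space"
  assumes "\<And>i. ((\<lambda>t. g t i) \<longlongrightarrow> l i) F"
  shows "(g \<longlongrightarrow> l) F"
proof -
  have "limitin (product_topology (\<lambda>_::'a. euclidean :: 'c topology) UNIV) g l F"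
    by (subst limitin_componentwise) (use assms in auto)
  then show ?thesis by (simp add: euclidean_product_topology)
qed

lemma C1_on_deriv:
  assumes "C1_on I f" "x \<in> extensional I" "k \<in> I"
  shows "((\<lambda>t. f (x(k := t))) has_real_derivative pderiv_at k f (x(k := t0))) (at t0)"
proof -
  have "x(k := t0) \<in> extensional I" using assms by (simp add: extensional_def)
  then have "(\<lambda>t. f ((x(k := t0))(k := t))) differentiable at ((x(k := t0)) k)"
    using assms unfolding C1_on_def by blast
  then have "(\<lambda>t. f (x(k := t))) differentiable at t0" by simp
  then show ?thesis by (simp add: pderiv_at_def DERIV_deriv_iff_real_differentiable)
qed

text \<open>Covers both orders and equal points, so the intermediate point tends to \<open>a\<close>
  when \<open>b\<close> does, from either side.\<close>

lemma MVT_symmetric: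
  fixes g :: "real \<Rightarrow> real"
  assumes "\<And>t. (g has_real_derivative g' t) (at t)"
  obtains z where "\<bar>z - a\<bar> \<le> \<bar>b - a\<bar>" "g b - g a = (b - a) * g' z"
proof (cases a b rule: linorder_cases)
  case less
  then obtain z where "a < z" "z < b" "g b - g a = (b - a) * g' z" using MVT2[of a b g g'] assms by blast
  then show ?thesis using that[of z] by auto
next
  case greater
  then obtain z where "b < z" "z < a" "g a - g b = (a - b) * g' z" using MVT2[of b a g g'] assms by blast
  then show ?thesis using that[of z] by (auto simp: algebra_simps)
qed (use that[of a] in auto)

text \<open>One value of a sequence occupies many sites of the ball, so moving it moves a block of
  coordinates. Coordinates join the block one at a time: the mean value theorem yields a partial
  derivative at a displaced point, and its continuity removes the displacement.\<close>

lemma C1_on_block_deriv: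
  assumes C1: "C1_on I f" and "finite A" "A \<subseteq> I" and z: "z \<in> extensional I" and "\<And>k. k \<in> A \<Longrightarrow> z k = t0"
  shows "((\<lambda>t. f (\<lambda>k. if k \<in> A then t else z k)) has_real_derivative (\<Sum>k\<in>A. pderiv_at k f z)) (at t0)"
  using assms(2,3,5)
proof (induction A)
  case (insert k A)
  define y where "y = (\<lambda>t j. if j \<in> A then t else z j)"
  have y: "y t \<in> extensional I" for t using z insert.prems(1) by (auto simp: y_def extensional_def)
  have kI: "k \<in> I" using insert.prems(1) by simp
  have yt0: "y t0 = z" using insert.prems(2) by (auto simp: y_def)
  have yk: "y t k = t0" for t using insert by (simp add: y_def)
  have "\<exists>\<xi>. \<bar>\<xi> - t0\<bar> \<le> \<bar>t - t0\<bar> \<and> f ((y t)(k := t)) - f (y t) = (t - t0) * pderiv_at k f ((y t)(k := \<xi>))" for t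
  proof -
    obtain \<xi> where "\<bar>\<xi> - t0\<bar> \<le> \<bar>t - t0\<bar>"
      "f ((y t)(k := t)) - f ((y t)(k := t0)) = (t - t0) * pderiv_at k f ((y t)(k := \<xi>))"
      using MVT_symmetric[of "\<lambda>s. f ((y t)(k := s))" "\<lambda>s. pderiv_at k f ((y t)(k := s))" t0 t]
        C1_on_deriv[OF C1 y kI] by blast
    moreover have "(y t)(k := t0) = y t" using yk by auto
    ultimately show ?thesis by auto
  qed
  then obtain \<xi> where \<xi>: "\<And>t. \<bar>\<xi> t - t0\<bar> \<le> \<bar>t - t0\<bar>"
    "\<And>t. f ((y t)(k := t)) - f (y t) = (t - t0) * pderiv_at k f ((y t)(k := \<xi> t))" by metis
  have "((\<lambda>t. \<bar>t - t0\<bar>) \<longlongrightarrow> 0) (at t0)" by (rule tendsto_rabs_zero[OF LIM_zero[OF tendsto_ident_at]])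
  then have "((\<lambda>t. \<bar>\<xi> t - t0\<bar>) \<longlongrightarrow> 0) (at t0)"
    by (rule tendsto_sandwich[OF _ _ tendsto_const, rotated 2]) (use \<xi>(1) in auto)
  then have \<xi>lim: "(\<xi> \<longlongrightarrow> t0) (at t0)" by (rule LIM_zero_cancel[OF tendsto_rabs_zero_cancel])
  have "((\<lambda>t. (y t)(k := \<xi> t)) \<longlongrightarrow> z) (at t0)"
  proof (rule tendsto_fun_componentwise)
    fix i show "((\<lambda>t. ((y t)(k := \<xi> t)) i) \<longlongrightarrow> z i) (at t0)"
    proof (cases "i = k")
      case True
      then show ?thesis using \<xi>lim insert.prems(2)[of k] by simp
    next
      case False
      then show ?thesis using insert.prems(2)[of i] by (cases "i \<in> A") (auto simp: y_def)
    qed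
  qed
  moreover have "continuous_on (extensional I) (pderiv_at k f)" using C1 kI unfolding C1_on_def by blast
  moreover have "\<forall>\<^sub>F t in at t0. (y t)(k := \<xi> t) \<in> extensional I"
    using y kI by (auto simp: extensional_def)
  ultimately have lim: "((\<lambda>t. pderiv_at k f ((y t)(k := \<xi> t))) \<longlongrightarrow> pderiv_at k f z) (at t0)"
    by (intro continuous_on_tendsto_compose[where s="extensional I" and f="pderiv_at k f"] z)
  have "((\<lambda>t. f ((y t)(k := t)) - f (y t)) has_real_derivative pderiv_at k f z) (at t0)"
    unfolding has_field_derivative_iff
  proof (rule Lim_transform_eventually[OF lim])
    have "f ((y t0)(k := t0)) - f (y t0) = 0" using \<xi>(2)[of t0] by simp
    then show "\<forall>\<^sub>F t in at t0. pderiv_at k f ((y t)(k := \<xi> t)) =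
        (f ((y t)(k := t)) - f (y t) - (f ((y t0)(k := t0)) - f (y t0))) / (t - t0)"
      by (auto simp: \<xi>(2) eventually_at_filter)
  qed
  moreover have "((\<lambda>t. f (y t)) has_real_derivative (\<Sum>k\<in>A. pderiv_at k f z)) (at t0)"
    using insert unfolding y_def by simp
  ultimately have "((\<lambda>t. (f ((y t)(k := t)) - f (y t)) + f (y t)) has_real_derivative
      pderiv_at k f z + (\<Sum>k\<in>A. pderiv_at k f z)) (at t0)" by (rule DERIV_add)
  moreover have "(y t)(k := t) = (\<lambda>j. if j \<in> insert k A then t else z j)" for t by (auto simp: y_def)
  ultimately show ?case using insert(1,2) by simp
qed simp

lemma C1_on_antimono:
  assumes C1: "C1_on I f" and "finite A" "A \<subseteq> I"
    and neg: "\<And>j x. j \<in> A \<Longrightarrow> x \<in> extensional I \<Longrightarrow> pderiv_at j f x \<le> 0"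
    and x: "x \<in> extensional I" and le: "\<And>i. x i \<le> y i"
  shows "f (\<lambda>i. if i \<in> A then y i else x i) \<le> f x"
  using assms(2,3) neg
proof (induction A)
  case (insert k A)
  define z where "z = (\<lambda>i. if i \<in> A then y i else x i)"
  have z: "z \<in> extensional I" using x insert.prems(1) by (auto simp: z_def extensional_def)
  have kI: "k \<in> I" using insert.prems(1) by simp
  have "f (z(k := y k)) \<le> f (z(k := x k))"
  proof (rule DERIV_nonpos_imp_nonincreasing[OF le[of k]])
    fix t
    have "z(k := t) \<in> extensional I" using z kI by (auto simp: extensional_def)
    then show "\<exists>d. ((\<lambda>t. f (z(k := t))) has_real_derivative d) (at t) \<and> d \<le> 0"
      using C1_on_deriv[OF C1 z kI, of t] insert.prems(2)[of k "z(k := t)"] by blast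
  qed
  moreover have "z(k := x k) = z" using insert(2) by (auto simp: z_def)
  moreover have "f z \<le> f x" unfolding z_def using insert by simp
  moreover have "z(k := y k) = (\<lambda>i. if i \<in> insert k A then y i else x i)" by (auto simp: z_def)
  ultimately show ?case by simp
qed simp

text \<open>Decreasing differences: each partial derivative decreases in the other coordinates, so
  along each raised coordinate the difference of the two sides is monotone. This is the source of
  submodularity.\<close>

lemma C1_on_increments:
  assumes C1: "C1_on I f" and "finite A" "A \<subseteq> I"
    and anti: "\<And>k x y. \<lbrakk>k \<in> I; x \<in> extensional I; y \<in> extensional I; \<And>i. x i \<le> y i; x k = y k\<rbrakk>
        \<Longrightarrow> pderiv_at k f y \<le> pderiv_at k f x"
    and x: "x \<in> extensional I" and y: "y \<in> extensional I" and xy: "\<And>i. x i \<le> y i"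
    and eq: "\<And>k. k \<in> A \<Longrightarrow> x k = y k" and q: "\<And>k. k \<in> A \<Longrightarrow> x k \<le> q k"
  shows "f (\<lambda>i. if i \<in> A then q i else y i) - f y \<le> f (\<lambda>i. if i \<in> A then q i else x i) - f x"
  using assms(2,3) eq q
proof (induction A)
  case (insert k A)
  define x' where "x' = (\<lambda>i. if i \<in> A then q i else x i)"
  define y' where "y' = (\<lambda>i. if i \<in> A then q i else y i)"
  have kI: "k \<in> I" using insert.prems(1) by simp
  have ext: "x' \<in> extensional I" "y' \<in> extensional I"
    using x y insert.prems(1) by (auto simp: x'_def y'_def extensional_def)
  have "f (y'(k := q k)) - f (x'(k := q k)) \<le> f (y'(k := x k)) - f (x'(k := x k))"
  proof (rule DERIV_nonpos_imp_nonincreasing[where f="\<lambda>t. f (y'(k := t)) - f (x'(k := t))"])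
    show "x k \<le> q k" using insert.prems(3) by simp
    fix t
    have "pderiv_at k f (y'(k := t)) \<le> pderiv_at k f (x'(k := t))"
      using ext kI xy by (intro anti) (auto simp: extensional_def x'_def y'_def)
    moreover have "((\<lambda>t. f (y'(k := t)) - f (x'(k := t))) has_real_derivative
        pderiv_at k f (y'(k := t)) - pderiv_at k f (x'(k := t))) (at t)"
      by (rule DERIV_diff[OF C1_on_deriv[OF C1 ext(2) kI] C1_on_deriv[OF C1 ext(1) kI]])
    ultimately show "\<exists>d. ((\<lambda>t. f (y'(k := t)) - f (x'(k := t))) has_real_derivative d) (at t) \<and> d \<le> 0"
      by (intro exI conjI) auto
  qed
  moreover have "x'(k := x k) = x'" "y'(k := x k) = y'"
    using insert(2) insert.prems(2)[of k] by (auto simp: x'_def y'_def)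
  moreover have "f y' - f y \<le> f x' - f x" unfolding x'_def y'_def using insert by simp
  moreover have "x'(k := q k) = (\<lambda>i. if i \<in> insert k A then q i else x i)"
    "y'(k := q k) = (\<lambda>i. if i \<in> insert k A then q i else y i)" by (auto simp: x'_def y'_def)
  ultimately show ?case by simp
qed simp

section \<open>Reduction of the lattice to sequences\<close>

lemma abs_component_le_l1: "\<bar>k $ a\<bar> \<le> l1 k"
  unfolding l1_def by (rule member_le_sum) auto

lemma l1_axis: "l1 (axis a t) = \<bar>t\<bar>"
proof -
  have "l1 (axis a t) = (\<Sum>k\<in>UNIV. if k = a then \<bar>t\<bar> else 0)"
    unfolding l1_def by (intro sum.cong) (auto simp: axis_def)
  then show ?thesis by simp
qed

lemma l1_uminus: "l1 (- i) = l1 i"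
  by (simp add: l1_def)

lemma l1_minus_commute: "l1 (i - j) = l1 (j - i)"
  by (metis l1_uminus minus_diff_eq)

lemma periodic_in_axis:
  assumes "periodic_in k u" shows "u (i + axis k m) = u i"
proof -
  have step: "u (j + axis k (t + 1)) = u (j + axis k t)" for j t
  proof -
    have "axis k (t + 1) = axis k t + axis k (1::int)" by (simp add: axis_def vec_eq_iff)
    then have "j + axis k (t + 1) = (j + axis k t) + axis k 1" by (simp add: ac_simps)
    then show ?thesis using assms unfolding periodic_in_def by metis
  qed
  show ?thesis
  proof (induction m rule: int_induct[of _ 0])
    case base
    have "axis k (0::int) = 0" by simp
    then show ?case by (simp only: add_0_right)
  next
    case (step1 t) then show ?case using step[of i t] by simp
  next
    case (step2 t) then show ?case using step[of i "t - 1"] by simp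
  qed
qed

lemma periodic_off_eq:
  assumes "periodic_off a u" shows "u i = u (axis a (i $ a))"
proof -
  have *: "u (axis a (i $ a) + (\<Sum>k\<in>F. axis k (i $ k))) = u (axis a (i $ a))" if "finite F" "a \<notin> F" for F
    using that
  proof (induction F)
    case (insert k F)
    have "periodic_in k u" using assms insert.prems unfolding periodic_off_def by auto
    then have "u ((axis a (i $ a) + (\<Sum>k\<in>F. axis k (i $ k))) + axis k (i $ k)) = u (axis a (i $ a))"
      using insert by (simp add: periodic_in_axis)
    then show ?case using insert(1,2) by (simp add: ac_simps)
  qed simp
  have "axis a (i $ a) + (\<Sum>k\<in>UNIV - {a}. axis k (i $ k)) = (\<Sum>k\<in>UNIV. axis k (i $ k))"
    by (rule sum.remove[symmetric]) auto
  also have "\<dots> = i"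
    by (simp add: vec_eq_iff axis_def)
  finally show ?thesis using *[of "UNIV - {a}"] by simp
qed

lemma periodic_all_eq:
  assumes "\<And>k. periodic_in k u" shows "u = (\<lambda>_. u 0)"
proof
  fix i :: "int ^ 'a"
  show "u i = u 0"
  proof -
    obtain a :: 'a where True by simp
    have "u i = u (axis a (i $ a))" by (rule periodic_off_eq) (use assms in \<open>simp add: periodic_off_def\<close>)
    also have "\<dots> = u (0 + axis a (i $ a))" by simp
    also have "\<dots> = u 0" by (rule periodic_in_axis[OF assms])
    finally show ?thesis .
  qed
qed

definition conf :: "'n \<Rightarrow> sequence \<Rightarrow> ('n::finite) config" where "conf a x = (\<lambda>i. x (i $ a))"

text \<open>The argument of \<open>s\<close> at every lattice site with first coordinate
  \<open>p\<close> when the configuration is \<open>conf a x\<close>.\<close>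

definition window :: "int \<Rightarrow> ('n::finite) \<Rightarrow> int \<Rightarrow> sequence \<Rightarrow> 'n config" where
  "window r a p x = restrict (\<lambda>k. x (k $ a + p)) (B r)"

lemma window_sh: "window r a p (sh k x) = window r a (p + k) x"
  by (simp add: window_def sh_def ac_simps)

lemma window_ext: "window r a p x \<in> extensional (B r)" by (simp add: window_def)

lemma window_apply: "k \<in> B r \<Longrightarrow> window r a p x k = x (k $ a + p)" by (simp add: window_def)

lemma conf_axis: "conf a x (axis a i) = x i" by (simp add: conf_def)

lemma conf_const: "conf a (\<lambda>_. t) = (\<lambda>_. t)" by (simp add: conf_def)

lemma conf_inject: "conf a x = conf a y \<longleftrightarrow> x = y" by (metis conf_axis ext)

lemma periodic_off_conf: "periodic_off a (conf a x)"
  by (simp add: periodic_off_def periodic_in_def conf_def axis_def)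

lemma periodic_off_conf_eq: "periodic_off a u \<Longrightarrow> u = conf a (\<lambda>i. u (axis a i))"
  by (rule ext) (simp add: conf_def periodic_off_eq[symmetric])

lemma S_at_conf: "S_at r s j (conf a x) = s (window r a (j $ a) x)"
  by (simp add: S_at_def conf_def window_def ac_simps)

text \<open>The quadrants with corner \<open>(-N, N)\<close> form a base of the product filter,
  which matches the single threshold in \<open>hasJ\<close>.\<close>

lemma eventually_at_bot_at_top_int:
  "eventually P (at_bot \<times>\<^sub>F at_top :: (int \<times> int) filter) \<longleftrightarrow> (\<exists>N. \<forall>p\<le>-N. \<forall>q\<ge>N. P (p, q))"
proof
  assume "eventually P (at_bot \<times>\<^sub>F at_top :: (int \<times> int) filter)"
  then obtain Q R where "eventually Q at_bot" "eventually R at_top" and QR: "\<And>p q. Q p \<Longrightarrow> R q \<Longrightarrow> P (p, q)"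
    unfolding eventually_prod_filter by blast
  then obtain M N where M: "\<And>p. p \<le> M \<Longrightarrow> Q p" "\<And>q. q \<ge> N \<Longrightarrow> R q"
    unfolding eventually_at_bot_linorder eventually_at_top_linorder by blast
  have "P (p, q)" if "p \<le> - max N (- M)" "q \<ge> max N (- M)" for p q
    using that by (intro QR M) auto
  then show "\<exists>N. \<forall>p\<le>-N. \<forall>q\<ge>N. P (p, q)" by blast
next
  assume "\<exists>N. \<forall>p\<le>-N. \<forall>q\<ge>N. P (p, q)"
  then obtain N where "\<And>p q. p \<le> -N \<Longrightarrow> q \<ge> N \<Longrightarrow> P (p, q)" by blast
  then show "eventually P (at_bot \<times>\<^sub>F at_top :: (int \<times> int) filter)"
    unfolding eventually_prod_filter
    by (intro exI[of _ "\<lambda>p. p \<le> -N"] exI[of _ "\<lambda>q. q \<ge> N"])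
      (auto intro: eventually_le_at_bot eventually_ge_at_top)
qed

section \<open>The lattice model as a sequence energy\<close>

locale lattice_gap =
  fixes r :: int and s :: "('n::finite) config \<Rightarrow> real" and a :: 'n and \<alpha> \<beta> :: real
  assumes r_ge_1: "r \<ge> 1" and C2: "C2_on (B r) s" and s2: "S2 r s" and s3: "S3 r s"
    and adj: "adjacent (M0 r s) (\<lambda>_. \<alpha>) (\<lambda>_. \<beta>)"
begin

definition HH :: "sequence \<Rightarrow> real" where "HH x = s (window r a 0 x)"

text \<open>The Euler-Lagrange sum at any lattice site with first coordinate \<open>p\<close>,
  indexed by the position \<open>k\<close> of that site in each ball containing it. It is also the
  derivative of the reduced energy, in which a whole hyperplane of sites moves at once.\<close>

definition DD :: "int \<Rightarrow> sequence \<Rightarrow> real" where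
  "DD p x = (\<Sum>k\<in>B r. pderiv_at k s (window r a (p - k $ a) x))"

lemma HH_sh: "HH (sh j x) = s (window r a j x)" by (simp add: HH_def window_sh)

lemma C1: "C1_on (B r) s" and C1_pderiv: "k \<in> B r \<Longrightarrow> C1_on (B r) (pderiv_at k s)"
  using C2 by (auto simp: C2_on_def)

lemma fin: "finite (B r :: (int ^ 'n) set)" by (rule finite_B)

lemma component_le: "k \<in> B r \<Longrightarrow> \<bar>k $ b\<bar> \<le> r"
  using abs_component_le_l1[of k b] by (simp add: B_def)

lemma pderiv_antimono:
  assumes k: "k \<in> B r" and x: "x \<in> extensional (B r)" and y: "y \<in> extensional (B r)"
    and le: "\<And>i. x i \<le> y i" and eq: "x k = y k"
  shows "pderiv_at k s y \<le> pderiv_at k s x"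
proof -
  have "pderiv_at k s (\<lambda>i. if i \<in> B r - {k} then y i else x i) \<le> pderiv_at k s x"
  proof (rule C1_on_antimono[OF C1_pderiv[OF k] _ _ _ x le])
    show "pderiv_at j (pderiv_at k s) z \<le> 0" if "j \<in> B r - {k}" "z \<in> extensional (B r)" for j z
      using s3 that k unfolding S3_def by auto
  qed (use fin in auto)
  moreover have "(\<lambda>i. if i \<in> B r - {k} then y i else x i) = y"
    using x y eq by (intro ext) (auto simp: extensional_def)
  ultimately show ?thesis by simp
qed

text \<open>The mixed derivative is strictly negative for the centre and a neighbour. The centre is
  therefore raised first, with strict loss, and the remaining coordinates afterwards, with weak
  loss.\<close>

lemma pderiv_strict_antimono:
  assumes k: "l1 k = 1" and x: "x \<in> extensional (B r)" and y: "y \<in> extensional (B r)"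
    and le: "\<And>i. x i \<le> y i" and eq: "x k = y k" and lt: "x 0 < y 0"
  shows "pderiv_at k s y < pderiv_at k s x"
proof -
  have kB: "k \<in> B r" and B0: "0 \<in> (B r :: (int ^ 'n) set)" using k r_ge_1 by (auto simp: B_def l1_def)
  have k0: "k \<noteq> 0" using k by (auto simp: l1_def)
  have ext: "x(0 := t) \<in> extensional (B r)" for t using x B0 by (auto simp: extensional_def)
  have "pderiv_at k s (x(0 := y 0)) < pderiv_at k s (x(0 := x 0))"
  proof (rule DERIV_neg_imp_decreasing[OF lt])
    fix t
    have "pderiv_at 0 (pderiv_at k s) (x(0 := t)) < 0" using s3 k ext unfolding S3_def by blast
    then show "\<exists>d. ((\<lambda>t. pderiv_at k s (x(0 := t))) has_real_derivative d) (at t) \<and> d < 0"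
      using C1_on_deriv[OF C1_pderiv[OF kB] x B0, of t] by blast
  qed
  moreover have "pderiv_at k s y \<le> pderiv_at k s (x(0 := y 0))"
    by (rule pderiv_antimono[OF kB ext y]) (use le eq k0 in auto)
  ultimately show ?thesis by simp
qed

text \<open>Passing from \<open>mn x y\<close> to \<open>x\<close> raises exactly the coordinates in
  \<open>A\<close>. The same rise applied to the larger \<open>y\<close> yields
  \<open>mx x y\<close> and costs no more.\<close>

lemma s_submodular:
  assumes x: "x \<in> extensional (B r)" and y: "y \<in> extensional (B r)"
  shows "s (mx x y) + s (mn x y) \<le> s x + s y"
proof -
  define A where "A = {i \<in> B r. y i < x i}"
  have out: "x i = y i" if "i \<notin> B r" for i using x y that by (simp add: extensional_def)
  have "s (\<lambda>i. if i \<in> A then x i else y i) - s y \<le> s (\<lambda>i. if i \<in> A then x i else mn x y i) - s (mn x y)"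
  proof (rule C1_on_increments[OF C1 _ _ pderiv_antimono])
    show "mn x y \<in> extensional (B r)" using x y by (auto simp: extensional_def)
  qed (use fin y in \<open>auto simp: A_def\<close>)
  moreover have "(\<lambda>i. if i \<in> A then x i else y i) = mx x y" 
    by (rule ext) (use out in \<open>force simp: A_def max_def\<close>)
  moreover have "(\<lambda>i. if i \<in> A then x i else mn x y i) = x"
    by (rule ext) (use out in \<open>force simp: A_def min_def\<close>)
  ultimately show ?thesis by simp
qed

lemma window_block: "window r a j (x(p := t)) = (\<lambda>k. if k \<in> {k \<in> B r. k $ a + j = p} then t else window r a j x k)"
  by (auto simp: window_def)

lemma DD_deriv: "((\<lambda>t. \<Sum>j=p-r..p+r. HH (sh j (x(p := t)))) has_real_derivative DD p x) (at (x p))"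
proof -
  have "((\<lambda>t. \<Sum>j=p-r..p+r. HH (sh j (x(p := t)))) has_real_derivative
      (\<Sum>j=p-r..p+r. \<Sum>k | k \<in> B r \<and> k $ a + j = p. pderiv_at k s (window r a j x))) (at (x p))"
    unfolding HH_sh window_block
    by (intro DERIV_sum C1_on_block_deriv[OF C1]) (use fin in \<open>auto simp: window_ext window_apply\<close>)
  also have "(\<Sum>j=p-r..p+r. \<Sum>k | k \<in> B r \<and> k $ a + j = p. pderiv_at k s (window r a j x)) =
      (\<Sum>j=p-r..p+r. \<Sum>k\<in>B r. if j = p - k $ a then pderiv_at k s (window r a j x) else 0)"
  proof (rule sum.cong[OF refl])
    fix j
    have "{k \<in> B r. k $ a + j = p} = B r \<inter> {k. j = p - k $ a}" by auto
    then show "(\<Sum>k | k \<in> B r \<and> k $ a + j = p. pderiv_at k s (window r a j x)) =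
        (\<Sum>k\<in>B r. if j = p - k $ a then pderiv_at k s (window r a j x) else 0)"
      by (simp only: sum.inter_restrict[OF fin] mem_Collect_eq)
  qed
  \<comment> \<open>For each \<open>k\<close> exactly one window places \<open>x p\<close> at
    \<open>k\<close>, and its index is in range because the first coordinate of \<open>k\<close> is
    at most \<open>r\<close> in modulus.\<close>
  also have "\<dots> = (\<Sum>k\<in>B r. \<Sum>j=p-r..p+r. if j = p - k $ a then pderiv_at k s (window r a j x) else 0)"
    by (rule sum.swap)
  also have "\<dots> = DD p x"
    unfolding DD_def
  proof (rule sum.cong[OF refl])
    fix k :: "int ^ 'n" assume "k \<in> B r"
    then have "p - k $ a \<in> {p-r..p+r}" using component_le[of k a] by auto
    then show "(\<Sum>j=p-r..p+r. if j = p - k $ a then pderiv_at k s (window r a j x) else 0) =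
        pderiv_at k s (window r a (p - k $ a) x)" by simp
  qed
  finally show ?thesis .
qed

lemma DD_const: "((\<lambda>t. HH (\<lambda>_. t)) has_real_derivative DD p (\<lambda>_. c)) (at c)"
proof -
  have HH: "HH (\<lambda>_. t) = s (\<lambda>k. if k \<in> B r then t else window r a 0 (\<lambda>_. c) k)" for t
    unfolding HH_def by (intro arg_cong[where f=s]) (auto simp: window_def)
  have DD: "DD p (\<lambda>_. c) = (\<Sum>k\<in>B r. pderiv_at k s (window r a 0 (\<lambda>_. c)))"
    unfolding DD_def by (simp add: window_def)
  show ?thesis
    unfolding HH DD by (intro C1_on_block_deriv[OF C1 fin]) (auto simp: window_ext window_apply)
qed

lemma window_le: "(\<And>i. x i \<le> y i) \<Longrightarrow> window r a p x k \<le> window r a p y k"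
  by (auto simp: window_def restrict_def)

lemma DD_term: "x p = y p \<Longrightarrow> window r a (p - k $ a) x k = window r a (p - k $ a) y k"
  by (simp add: window_def restrict_def)

lemma DD_antimono: "(\<And>i. x i \<le> y i) \<Longrightarrow> x p = y p \<Longrightarrow> DD p y \<le> DD p x"
  unfolding DD_def by (intro sum_mono pderiv_antimono window_ext window_le DD_term)

lemma DD_strict:
  assumes le: "\<And>i. x i \<le> y i" and eq: "x p = y p" and D: "DD p x = DD p y"
  shows "x (p - 1) = y (p - 1) \<and> x (p + 1) = y (p + 1)"
proof -
  have *: "x (p - t) = y (p - t)" if t: "\<bar>t\<bar> = 1" for t
  proof (rule ccontr)
    assume "x (p - t) \<noteq> y (p - t)"
    then have lt: "x (p - t) < y (p - t)" using le[of "p - t"] by simp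
    \<comment> \<open>In the window centred at \<open>p - t\<close> the site \<open>p\<close> sits
      at the neighbour \<open>k\<close> of the centre, where strictness is available.\<close>
    define k where "k = (axis a t :: int ^ 'n)"
    have k1: "l1 k = 1" using t by (simp add: k_def l1_axis)
    have kB: "k \<in> B r" and B0: "0 \<in> (B r :: (int ^ 'n) set)" using k1 r_ge_1 by (auto simp: B_def l1_def)
    have "pderiv_at k s (window r a (p - k $ a) y) < pderiv_at k s (window r a (p - k $ a) x)"
    proof (rule pderiv_strict_antimono[OF k1 window_ext window_ext window_le[where x=x and y=y, OF le]])
      show "window r a (p - k $ a) x k = window r a (p - k $ a) y k" by (rule DD_term) (rule eq)
      show "window r a (p - k $ a) x 0 < window r a (p - k $ a) y 0"
        using lt B0 by (simp add: window_def k_def)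
    qed
    moreover have "\<forall>k\<in>B r. pderiv_at k s (window r a (p - k $ a) y) \<le> pderiv_at k s (window r a (p - k $ a) x)"
      by (intro ballI pderiv_antimono window_ext window_le DD_term le eq)
    ultimately have "DD p y < DD p x"
      unfolding DD_def using kB by (intro sum_strict_mono_ex1[OF fin]) auto
    then show False using D by simp
  qed
  show ?thesis using *[of 1] *[of "-1"] by simp
qed

lemma c0_le: "c0 r s \<le> HH (\<lambda>_. t)"
proof -
  have "bdd_below (S_at r s 0 ` A)" for A
  proof -
    have "bdd_below (s ` extensional (B r))" using s2 by (simp add: S2_def)
    then show ?thesis by (rule bdd_below_mono) (auto simp: S_at_def)
  qed
  then have "c0 r s \<le> S_at r s 0 (\<lambda>_. t)"
    unfolding c0_def by (intro cINF_lower) (auto simp: periodic_in_def)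
  then show ?thesis by (simp add: S_at_def HH_def window_def)
qed

lemma M0_const: "(\<lambda>_. t) \<in> M0 r s \<longleftrightarrow> HH (\<lambda>_. t) = c0 r s"
  by (simp add: M0_def periodic_in_def S_at_def HH_def window_def)

sublocale sequence_energy r HH DD \<alpha> \<beta> "c0 r s"
proof
  show "1 \<le> r" by (rule r_ge_1)
  show "HH x = HH y" if "\<And>i. \<bar>i\<bar> \<le> r \<Longrightarrow> x i = y i" for x y
  proof -
    have "window r a 0 x = window r a 0 y"
      using that component_le[of _ a] by (auto simp: window_def restrict_def)
    then show ?thesis by (simp add: HH_def)
  qed
  show "(\<lambda>n. HH (X n)) \<longlonglongrightarrow> HH x" if X: "\<And>i. (\<lambda>n. X n i) \<longlonglongrightarrow> x i" for X x
    unfolding HH_def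
  proof (rule continuous_on_tendsto_compose[where s="extensional (B r)" and f=s])
    show "continuous_on (extensional (B r)) s" using C1 by (simp add: C1_on_def)
    show "(\<lambda>n. window r a 0 (X n)) \<longlonglongrightarrow> window r a 0 x"
      by (rule tendsto_fun_componentwise) (auto simp: window_def restrict_def intro: X)
  qed (auto simp: window_ext)
  show "HH (mx x y) + HH (mn x y) \<le> HH x + HH y" for x y
  proof -
    have "window r a 0 (mx x y) = mx (window r a 0 x) (window r a 0 y)"
      "window r a 0 (mn x y) = mn (window r a 0 x) (window r a 0 y)"
      by (auto simp: window_def restrict_def)
    then show ?thesis using s_submodular[OF window_ext window_ext] by (simp add: HH_def)
  qed
  show "\<alpha> < \<beta>" "HH (\<lambda>_. \<alpha>) = c0 r s" "HH (\<lambda>_. \<beta>) = c0 r s"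
    using adj by (auto simp: adjacent_def strictly_below_def M0_const)
  show "c0 r s < HH (\<lambda>_. t)" if "\<alpha> < t" "t < \<beta>" for t
  proof -
    have "(\<lambda>_. \<alpha>) \<lless> (\<lambda>_. t)" "(\<lambda>_. t) \<lless> (\<lambda>_. \<beta>)"
      using that by (simp_all add: strictly_below_def)
    then have "(\<lambda>_. t) \<notin> M0 r s" using adj unfolding adjacent_def by blast
    then show ?thesis using c0_le[of t] by (simp add: M0_const)
  qed
qed (fact DD_deriv DD_const DD_antimono DD_strict c0_le)+

section \<open>Asymptotics and minimality on the lattice and for sequences\<close>

lemma asymp_to_conf:
  "asymp_to a (\<lambda>_. \<gamma>) F (conf a x) \<longleftrightarrow> (\<forall>\<delta>>0. eventually (\<lambda>i. \<bar>x i - \<gamma>\<bar> \<le> \<delta>) F)"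
proof -
  have "asymp_to a (\<lambda>_. \<gamma>) F (conf a x) \<longleftrightarrow> (\<forall>\<delta>>0. eventually (\<lambda>i. \<bar>x i - \<gamma>\<bar> < \<delta>) F)"
    by (simp add: asymp_to_def conf_axis tendsto_iff)
  also have "\<dots> \<longleftrightarrow> (\<forall>\<delta>>0. eventually (\<lambda>i. \<bar>x i - \<gamma>\<bar> \<le> \<delta>) F)"
  proof (intro iffI allI impI)
    fix \<delta> :: real assume "\<forall>\<delta>>0. eventually (\<lambda>i. \<bar>x i - \<gamma>\<bar> < \<delta>) F" "0 < \<delta>"
    then have "eventually (\<lambda>i. \<bar>x i - \<gamma>\<bar> < \<delta>) F" by blast
    then show "eventually (\<lambda>i. \<bar>x i - \<gamma>\<bar> \<le> \<delta>) F" by (rule eventually_mono) simp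
  next
    fix \<delta> :: real assume *: "\<forall>\<delta>>0. eventually (\<lambda>i. \<bar>x i - \<gamma>\<bar> \<le> \<delta>) F" "0 < \<delta>"
    then have "eventually (\<lambda>i. \<bar>x i - \<gamma>\<bar> \<le> \<delta> / 2) F" using half_gt_zero by blast
    then show "eventually (\<lambda>i. \<bar>x i - \<gamma>\<bar> < \<delta>) F" by (rule eventually_mono) (use *(2) in linarith)
  qed
  finally show ?thesis .
qed

lemma near_iff_eventually:
  "(\<exists>P. near \<gamma> \<gamma>' \<delta> P x) \<longleftrightarrow>
     eventually (\<lambda>i. \<bar>x i - \<gamma>\<bar> \<le> \<delta>) at_bot \<and> eventually (\<lambda>i. \<bar>x i - \<gamma>'\<bar> \<le> \<delta>) at_top"
proof
  assume "\<exists>P. near \<gamma> \<gamma>' \<delta> P x"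
  then show "eventually (\<lambda>i. \<bar>x i - \<gamma>\<bar> \<le> \<delta>) at_bot \<and> eventually (\<lambda>i. \<bar>x i - \<gamma>'\<bar> \<le> \<delta>) at_top"
    unfolding near_def eventually_at_bot_linorder eventually_at_top_linorder by blast
next
  assume "eventually (\<lambda>i. \<bar>x i - \<gamma>\<bar> \<le> \<delta>) at_bot \<and> eventually (\<lambda>i. \<bar>x i - \<gamma>'\<bar> \<le> \<delta>) at_top"
  then obtain M N where "\<forall>i\<le>M. \<bar>x i - \<gamma>\<bar> \<le> \<delta>" "\<forall>i\<ge>N. \<bar>x i - \<gamma>'\<bar> \<le> \<delta>"
    unfolding eventually_at_bot_linorder eventually_at_top_linorder by blast
  then have "near \<gamma> \<gamma>' \<delta> (max 0 (max (- M) N)) x" by (auto simp: near_def)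
  then show "\<exists>P. near \<gamma> \<gamma>' \<delta> P x" ..
qed

lemma \<Gamma>_asymp:
  "x \<in> \<Gamma> \<gamma> \<gamma>' \<longleftrightarrow> box x \<and> asymp_to a (\<lambda>_. \<gamma>) at_bot (conf a x) \<and> asymp_to a (\<lambda>_. \<gamma>') at_top (conf a x)"
  unfolding \<Gamma>_def asymp_to_conf by (auto simp: near_iff_eventually)

lemma Gamma1_conf: "conf a x \<in> Gamma1 a (\<lambda>_. \<alpha>) (\<lambda>_. \<beta>) (\<lambda>_. \<gamma>) (\<lambda>_. \<gamma>') \<longleftrightarrow> x \<in> \<Gamma> \<gamma> \<gamma>'"
proof -
  have "(\<lambda>_. \<alpha>) \<le> conf a x \<and> conf a x \<le> (\<lambda>_. \<beta>) \<longleftrightarrow> box x"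
    unfolding le_fun_def box_def by (metis conf_axis conf_def)
  then show ?thesis by (auto simp: Gamma1_def Gamma1_hat_def periodic_off_conf \<Gamma>_asymp)
qed

lemma Gamma1_E:
  assumes "u \<in> Gamma1 a (\<lambda>_. \<alpha>) (\<lambda>_. \<beta>) (\<lambda>_. \<gamma>) (\<lambda>_. \<gamma>')"
  obtains x where "u = conf a x" "x \<in> \<Gamma> \<gamma> \<gamma>'"
proof -
  have "u = conf a (\<lambda>i. u (axis a i))"
    using assms by (intro periodic_off_conf_eq) (simp add: Gamma1_def Gamma1_hat_def)
  then show ?thesis using that assms Gamma1_conf by metis
qed

lemma J1_conf: "J1 r s a (conf a x) = Liminf (at_bot \<times>\<^sub>F at_top) (\<lambda>(p, q). ereal (J p q x))"
  by (simp add: J1_def J1_sum_def J_def e_def S_at_conf HH_sh)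

lemma J1_hasJ: assumes "hasJ x l" shows "J1 r s a (conf a x) = ereal l"
  unfolding J1_conf
proof (rule lim_imp_Liminf)
  show "(at_bot \<times>\<^sub>F at_top :: (int \<times> int) filter) \<noteq> bot" by (simp add: prod_filter_eq_bot)
  have "((\<lambda>(p, q). J p q x) \<longlongrightarrow> l) (at_bot \<times>\<^sub>F at_top)"
  proof (rule tendstoI)
    fix \<epsilon> :: real assume e: "\<epsilon> > 0"
    then obtain P where P: "\<forall>p\<le>-P. \<forall>q\<ge>P. \<bar>J p q x - l\<bar> \<le> \<epsilon>/2" using assms half_gt_zero unfolding hasJ_def by blast
    have "dist (J p q x) l < \<epsilon>" if "p \<le> -P" "q \<ge> P" for p q
    proof -
      have "\<bar>J p q x - l\<bar> \<le> \<epsilon>/2" using P that by blast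
      then show ?thesis using e by (simp add: dist_real_def)
    qed
    then show "\<forall>\<^sub>F z in at_bot \<times>\<^sub>F at_top. dist (case z of (p, q) \<Rightarrow> J p q x) l < \<epsilon>"
      unfolding eventually_at_bot_at_top_int by auto
  qed
  then show "((\<lambda>(p, q). ereal (J p q x)) \<longlongrightarrow> ereal l) (at_bot \<times>\<^sub>F at_top)"
    using tendsto_ereal by (fastforce simp: case_prod_unfold)
qed

text \<open>A lower limit below \<open>C\<close> means partial sums at most \<open>C\<close> on
  arbitrarily large windows, which already forces convergence.\<close>

lemma hasJ_if_J1_finite:
  assumes "f \<gamma> = 0" "f \<gamma>' = 0" "x \<in> \<Gamma> \<gamma> \<gamma>'" "J1 r s a (conf a x) < \<infinity>"
  obtains l where "hasJ x l"
proof -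
  obtain C where C: "J1 r s a (conf a x) < ereal C" using assms(4) less_PInf_Ex_of_nat by force
  have "\<exists>p\<le>-P. \<exists>q\<ge>P. J p q x \<le> C + \<epsilon>" if "\<epsilon> > 0" for \<epsilon> P
  proof (rule ccontr)
    assume "\<not> ?thesis"
    then have "\<forall>p\<le>-P. \<forall>q\<ge>P. C \<le> J p q x" using that by force
    then have "\<forall>\<^sub>F z in at_bot \<times>\<^sub>F at_top. ereal C \<le> (case z of (p, q) \<Rightarrow> ereal (J p q x))"
      unfolding eventually_at_bot_at_top_int by auto
    then show False using Liminf_bounded C unfolding J1_conf by fastforce
  qed
  then show ?thesis using hasJ_if_frequently_le[OF assms(1-3)] that by blast
qed

text \<open>For a step sequence only windows straddling the jump contribute. This excludes an
  infinite infimum, with which membership in \<open>M1\<close> would not give a convergent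
  energy.\<close>

lemma exists_finite_energy:
  assumes "\<gamma> \<in> {\<alpha>, \<beta>}" "\<gamma>' \<in> {\<alpha>, \<beta>}"
  obtains x l where "x \<in> \<Gamma> \<gamma> \<gamma>'" "hasJ x l"
proof -
  define x where "x = (\<lambda>i::int. if i \<le> 0 then \<gamma> else \<gamma>')"
  have "near \<gamma> \<gamma>' \<delta> 1 x" if "\<delta> > 0" for \<delta> using that by (auto simp: near_def x_def)
  then have "x \<in> \<Gamma> \<gamma> \<gamma>'" using assms vw unfolding \<Gamma>_def by (auto simp: box_def x_def)
  moreover have "hasJ x (J (-r) r x)"
    unfolding hasJ_def
  proof (intro allI impI exI)
    fix \<epsilon> :: real and p q assume "\<epsilon> > 0" "p \<le> - r" "q \<ge> r"
    have "e j x = 0" if "j \<notin> {-r..r}" for j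
    proof -
      have "e j x = f (if j < 0 then \<gamma> else \<gamma>')"
        using that r_ge_1 by (intro e_const) (auto simp: x_def)
      then show ?thesis using assms fv fw by auto
    qed
    then have "J p q x = J (-r) r x"
      unfolding J_def using \<open>p \<le> - r\<close> \<open>q \<ge> r\<close> by (intro sum.mono_neutral_right) auto
    then show "\<bar>J p q x - J (-r) r x\<bar> \<le> \<epsilon>" using \<open>\<epsilon> > 0\<close> by simp
  qed
  ultimately show ?thesis using that by blast
qed

text \<open>Where the lower limit is less than infinity it is a limit, so both notions of energy
  agree there, and configurations of infinite energy never beat one of finite energy.\<close>

lemma M1_conf:
  assumes g: "\<gamma> \<in> {\<alpha>, \<beta>}" "\<gamma>' \<in> {\<alpha>, \<beta>}"
  shows "conf a x \<in> M1 r s a (\<lambda>_. \<alpha>) (\<lambda>_. \<beta>) (\<lambda>_. \<gamma>) (\<lambda>_. \<gamma>') \<longleftrightarrow> argmin (\<Gamma> \<gamma> \<gamma>') x"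
    (is "_ \<in> ?M \<longleftrightarrow> _")
proof
  have z: "f \<gamma> = 0" "f \<gamma>' = 0" using g fv fw by auto
  let ?G = "Gamma1 a (\<lambda>_. \<alpha>) (\<lambda>_. \<beta>) (\<lambda>_. \<gamma>) (\<lambda>_. \<gamma>')"
  {
    assume x: "conf a x \<in> ?M"
    then have xG: "x \<in> \<Gamma> \<gamma> \<gamma>'" by (simp add: M1_def Gamma1_conf)
    have min: "J1 r s a (conf a x) \<le> J1 r s a (conf a y)" if "y \<in> \<Gamma> \<gamma> \<gamma>'" for y
    proof -
      have "J1 r s a (conf a x) = (INF u\<in>?G. J1 r s a u)" using x by (simp add: M1_def c1_def)
      also have "\<dots> \<le> J1 r s a (conf a y)" using that by (intro INF_lower) (simp add: Gamma1_conf)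
      finally show ?thesis .
    qed
    obtain y k where "y \<in> \<Gamma> \<gamma> \<gamma>'" "hasJ y k" using exists_finite_energy[OF g] .
    then have "J1 r s a (conf a x) \<le> ereal k" using min J1_hasJ by metis
    then have "J1 r s a (conf a x) < \<infinity>" using le_less_trans less_ereal.simps(4) by blast
    then obtain l where l: "hasJ x l" using hasJ_if_J1_finite[OF z xG] by blast
    have "l \<le> l'" if "y \<in> \<Gamma> \<gamma> \<gamma>'" "hasJ y l'" for y l'
      using min[OF that(1)] J1_hasJ[OF that(2)] J1_hasJ[OF l] by simp
    then show "argmin (\<Gamma> \<gamma> \<gamma>') x" unfolding argmin_def using xG l by blast
  }
  assume "argmin (\<Gamma> \<gamma> \<gamma>') x"
  then obtain l where xG: "x \<in> \<Gamma> \<gamma> \<gamma>'" and l: "hasJ x l" and min: "\<And>y l'. y \<in> \<Gamma> \<gamma> \<gamma>' \<Longrightarrow> hasJ y l' \<Longrightarrow> l \<le> l'"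
    unfolding argmin_def by blast
  have "J1 r s a (conf a x) \<le> J1 r s a u" if "u \<in> ?G" for u
  proof -
    obtain y where y: "u = conf a y" "y \<in> \<Gamma> \<gamma> \<gamma>'" using Gamma1_E[OF \<open>u \<in> ?G\<close>] .
    show ?thesis
    proof (cases "J1 r s a u < \<infinity>")
      case True
      then obtain l' where "hasJ y l'" using hasJ_if_J1_finite[OF z y(2)] y(1) by blast
      then show ?thesis using min[OF y(2)] J1_hasJ[OF l] J1_hasJ[of y l'] y(1) by simp
    qed simp
  qed
  then have "J1 r s a (conf a x) = (INF u\<in>?G. J1 r s a u)"
    using xG by (intro antisym INF_greatest INF_lower) (auto simp: Gamma1_conf)
  then show "conf a x \<in> ?M" using xG by (simp add: M1_def c1_def Gamma1_conf)
qed

lemma adjacent_gap_pair: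
  assumes g: "\<gamma> \<in> {\<alpha>, \<beta>}" "\<gamma>' \<in> {\<alpha>, \<beta>}"
    and adj1: "adjacent (M1 r s a (\<lambda>_. \<alpha>) (\<lambda>_. \<beta>) (\<lambda>_. \<gamma>) (\<lambda>_. \<gamma>')) v1 w1"
  obtains x y where "gap_pair \<gamma> \<gamma>' x y"
proof -
  let ?M = "M1 r s a (\<lambda>_. \<alpha>) (\<lambda>_. \<beta>) (\<lambda>_. \<gamma>) (\<lambda>_. \<gamma>')"
  have M: "v1 \<in> ?M" "w1 \<in> ?M" and lt: "v1 \<lless> w1" and no: "\<not> (\<exists>u\<in>?M. v1 \<lless> u \<and> u \<lless> w1)"
    using adj1 by (auto simp: adjacent_def)
  obtain x where x: "v1 = conf a x" using M(1) Gamma1_E unfolding M1_def by blast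
  obtain y where y: "w1 = conf a y" using M(2) Gamma1_E unfolding M1_def by blast
  have below: "conf a x \<lless> conf a z \<longleftrightarrow> (\<forall>i. x i < z i)" for x z
    unfolding strictly_below_def by (metis conf_axis conf_def)
  have "gap_pair \<gamma> \<gamma>' x y"
    unfolding gap_pair_def
  proof (intro conjI)
    show "argmin (\<Gamma> \<gamma> \<gamma>') x" "argmin (\<Gamma> \<gamma> \<gamma>') y" using M by (simp_all add: x y M1_conf[OF g])
    show "\<forall>i. x i < y i" using lt by (simp add: x y below)
    show "\<not> (\<exists>z. argmin (\<Gamma> \<gamma> \<gamma>') z \<and> (\<forall>i. x i < z i \<and> z i < y i))"
      using no by (metis M1_conf[OF g] x y below)
  qed
  then show ?thesis using that by blast
qed

lemma solution_EL_conf: assumes "\<And>p. DD p x = 0" shows "solution_EL r s (conf a x)"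
  unfolding solution_EL_def
proof
  fix i :: "int ^ 'n"
  have "(\<Sum>j | l1 (j - i) \<le> r. pderiv_at i (S_at r s j) (conf a x)) =
      (\<Sum>k\<in>B r. pderiv_at k s (window r a (i $ a - k $ a) x))"
  proof (rule sum.reindex_bij_witness[of _ "\<lambda>k. i - k" "\<lambda>j. i - j"])
    fix j assume "j \<in> {j. l1 (j - i) \<le> r}"
    then have ij: "i - j \<in> B r" by (simp add: B_def l1_minus_commute)
    then show "i - j \<in> B r" .
    define z where "z = window r a (j $ a) x"
    \<comment> \<open>Changing the configuration at the single site \<open>i\<close> changes the
      window at \<open>j\<close> in the single coordinate \<open>i - j\<close>.\<close>
    have "restrict (\<lambda>k. ((conf a x)(i := t)) (j + k)) (B r) = z(i - j := t)" for t
    proof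
      fix k
      show "restrict (\<lambda>k. ((conf a x)(i := t)) (j + k)) (B r) k = (z(i - j := t)) k"
      proof (cases "k = i - j")
        case False
        then have "j + k \<noteq> i" by auto
        then show ?thesis using False by (simp add: z_def window_def conf_def restrict_def add.commute)
      qed (use ij in simp)
    qed
    moreover have "z (i - j) = conf a x i" using ij by (simp add: z_def window_def conf_def)
    ultimately have "pderiv_at (i - j) s z = pderiv_at i (S_at r s j) (conf a x)"
      by (simp add: pderiv_at_def S_at_def)
    then show "pderiv_at (i - j) s (window r a (i $ a - (i - j) $ a) x) = pderiv_at i (S_at r s j) (conf a x)"
      by (simp add: z_def)
  qed (auto simp: B_def l1_uminus)
  also have "\<dots> = 0" using assms[of "i $ a"] by (simp add: DD_def)
  finally show "(\<Sum>j | l1 (j - i) \<le> r. pderiv_at i (S_at r s j) (conf a x)) = 0" .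
qed

section \<open>Infinitely many solutions by translation\<close>

lemma DD_sh: "DD p (sh k x) = DD (p + k) x"
  unfolding DD_def window_sh by (intro sum.cong refl) (simp add: algebra_simps)

text \<open>Two equal translates would make \<open>x\<close> periodic, and a periodic sequence with
  a limit at plus infinity is constant.\<close>

lemma inj_translates:
  assumes x: "x \<in> \<Gamma> \<gamma> \<gamma>'" and nc: "x \<noteq> (\<lambda>_. \<gamma>')"
  shows "inj (\<lambda>k. conf a (sh k x))"
proof -
  have neq: "sh k x \<noteq> sh l x" if "k < l" for k l
  proof
    assume eq: "sh k x = sh l x"
    define d where "d = l - k"
    have d: "d > 0" using that by (simp add: d_def)
    have per1: "x (i + d) = x i" for i
      using fun_cong[OF eq, of "i - k"] by (simp add: sh_def d_def algebra_simps)
    have per: "x (i + int n * d) = x i" for i n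
    proof (induction n)
      case (Suc n)
      then show ?case using per1[of "i + int n * d"] by (simp add: algebra_simps)
    qed simp
    have "x i = \<gamma>'" for i
    proof -
      have "\<bar>x i - \<gamma>'\<bar> \<le> \<delta>" if "\<delta> > 0" for \<delta>
      proof -
        obtain P where P: "near \<gamma> \<gamma>' \<delta> P x" using x \<open>\<delta> > 0\<close> unfolding \<Gamma>_def by blast
        define n where "n = nat (P - i)"
        have "int n * 1 \<le> int n * d" using d by (intro mult_left_mono) auto
        moreover have "P - i \<le> int n" by (simp add: n_def)
        ultimately have "P \<le> i + int n * d" by linarith
        then show ?thesis using P per[of i n] unfolding near_def by metis
      qed
      then have "\<bar>x i - \<gamma>'\<bar> \<le> 0" by (meson dense_ge)
      then show ?thesis by simp
    qed
    then show False using nc by blast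
  qed
  show ?thesis
    by (rule injI) (metis conf_inject linorder_neqE neq)
qed

lemma infinite_translates:
  assumes "x \<in> \<Gamma> \<gamma> \<gamma>'" "x \<noteq> (\<lambda>_. \<gamma>')" "\<And>k. P (conf a (sh k x))"
  shows "infinite {u. P u}"
proof -
  have "infinite (range (\<lambda>k. conf a (sh k x)))"
    using inj_translates[OF assms(1,2)] infinite_UNIV_int by (simp add: finite_image_iff)
  then show ?thesis by (rule infinite_super[rotated]) (use assms(3) in auto)
qed

lemma infinite_heteroclinics:
  assumes "gap_pair \<gamma> \<gamma>' x y" "\<gamma> \<noteq> \<gamma>'"
  shows "infinite {u. heteroclinic r s a (\<lambda>_. \<gamma>) (\<lambda>_. \<gamma>') u}"
proof (rule infinite_translates)
  have min: "argmin (\<Gamma> \<gamma> \<gamma>') x" using assms by (simp add: gap_pair_def)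
  then show xG: "x \<in> \<Gamma> \<gamma> \<gamma>'" by (simp add: argmin_def)
  show "x \<noteq> (\<lambda>_. \<gamma>')"
  proof
    assume c: "x = (\<lambda>_. \<gamma>')"
    have "\<bar>\<gamma>' - \<gamma>\<bar> / 2 > 0" using assms(2) by simp
    then obtain P where "near \<gamma> \<gamma>' (\<bar>\<gamma>' - \<gamma>\<bar> / 2) P x" using xG unfolding \<Gamma>_def by blast
    then have "\<bar>x (-P) - \<gamma>\<bar> \<le> \<bar>\<gamma>' - \<gamma>\<bar> / 2" by (simp add: near_def)
    then show False using c assms(2) by simp
  qed
  show "heteroclinic r s a (\<lambda>_. \<gamma>) (\<lambda>_. \<gamma>') (conf a (sh k x))" for k
    using \<Gamma>_sh[OF xG, of k] argmin_\<Gamma>_D_zero[OF min]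
    by (auto simp: heteroclinic_def \<Gamma>_asymp periodic_off_conf DD_sh intro!: solution_EL_conf)
qed

lemma infinite_homoclinics:
  assumes xG: "x \<in> \<Gamma> \<gamma> \<gamma>" and D: "\<And>p. DD p x = 0" and nc: "x \<noteq> (\<lambda>_. \<gamma>)"
  shows "infinite {u. homoclinic r s a (\<lambda>_. \<gamma>) u}"
proof (rule infinite_translates[OF xG nc])
  fix k
  have "sh k x \<noteq> (\<lambda>_. \<gamma>)"
  proof
    assume eq: "sh k x = (\<lambda>_. \<gamma>)"
    have "x i = \<gamma>" for i using fun_cong[OF eq, of "i - k"] unfolding sh_def by simp
    then show False using nc by blast
  qed
  then have "conf a (sh k x) \<noteq> conf a (\<lambda>_. \<gamma>)" by (simp add: conf_inject)
  then have "conf a (sh k x) \<noteq> (\<lambda>_. \<gamma>)" by (simp only: conf_const not_False_eq_True)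
  then show "homoclinic r s a (\<lambda>_. \<gamma>) (conf a (sh k x))"
    using \<Gamma>_sh[OF xG, of k] D
    by (auto simp: homoclinic_def \<Gamma>_asymp periodic_off_conf DD_sh intro!: solution_EL_conf)
qed

end

theorem mainTheorem1:
  fixes r :: int and s :: "('n::finite) config \<Rightarrow> real" and a :: 'n and v0 w0 :: "'n config"
  assumes "CARD('n) \<ge> 2" and "r \<ge> 1"
    and "C2_on (B r) s" and "S1 r s" and "S2 r s" and "S3 r s"
    and "adjacent (M0 r s) v0 w0"
    and "gap1 r s a v0 w0"
  shows "(infinite {u. homoclinic r s a v0 u} \<and> infinite {u. homoclinic r s a w0 u}) \<and>
         (infinite {u. heteroclinic r s a v0 w0 u} \<and> infinite {u. heteroclinic r s a w0 v0 u})"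
proof -
  define \<alpha> where "\<alpha> = v0 0"
  define \<beta> where "\<beta> = w0 0"
  \<comment> \<open>Members of \<open>M0\<close> are periodic in every direction, hence
    constant.\<close>
  have v0: "v0 = (\<lambda>_. \<alpha>)" and w0: "w0 = (\<lambda>_. \<beta>)"
    using assms(7) periodic_all_eq[of v0] periodic_all_eq[of w0]
    unfolding adjacent_def M0_def \<alpha>_def \<beta>_def by blast+
  interpret lattice_gap r s a \<alpha> \<beta>
    by unfold_locales (use assms v0 w0 in auto)
  obtain x1 y1 where up: "gap_pair \<alpha> \<beta> x1 y1"
    using assms(8) adjacent_gap_pair[of \<alpha> \<beta>] unfolding gap1_def v0 w0 by blast
  obtain x2 y2 where down: "gap_pair \<beta> \<alpha> x2 y2"
    using assms(8) adjacent_gap_pair[of \<beta> \<alpha>] unfolding gap1_def v0 w0 by blast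
  obtain x where x: "x \<in> \<Gamma> \<alpha> \<alpha>" "\<And>p. DD p x = 0" "x \<noteq> (\<lambda>_. \<alpha>)"
    using exists_homoclinic[OF up down] by blast
  obtain y where y: "y \<in> \<Gamma> \<beta> \<beta>" "\<And>p. DD p y = 0" "y \<noteq> (\<lambda>_. \<beta>)"
    using exists_homoclinic_above[OF up down] by blast
  show ?thesis
    unfolding v0 w0
    using infinite_homoclinics[OF x] infinite_homoclinics[OF y]
      infinite_heteroclinics[OF up] infinite_heteroclinics[OF down] vw by simp
qed

end
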